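(* Let $\alpha^* = \sum_{i=1}^{\infty} \frac{1}{2^{i-1}+1}$. Every instance $A = (a_i)_{i \in [k]}$ consisting of positive integers and satisfying $\mathrm{D}(A) \ge \alpha^*$ is covering-schedulable.
   Context: For a positive integer $k$, $[k] = \{1, \ldots, k\}$. An instance (of pinwheel covering) is a nonempty finite array $A = (a_i)_{i \in [k]}$ of positive integers (called periods; repetitions allowed), assumed to be arranged in non-decreasing order. Its density is $\mathrm{D}(A) = \sum_{i \in [k]} \frac{1}{a_i}$. The instance $A$ is covering-schedulable (or simply schedulable) if there exists a map $S \colon \mathbb{Z} \to [k]$ (a schedule) such that for every $i \in [k]$ and every $m \in \mathbb{Z}$, $\bigl| [m, m + a_i) \cap S^{-1}(i) \bigr| \le 1$, where $[m, m+a_i)$ denotes the set of integers $t$ with $m \le t < m + a_i$. *)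

theory Defs
  imports Complex_Main
begin

text \<open>
  An array \<open>(a_i)\<close> indexed by \<open>[k] = {1..k}\<close> is a length \<open>k\<close> together with a function
  \<open>a :: nat \<Rightarrow> nat\<close>; the values of \<open>a\<close> outside \<open>{1..k}\<close> are never looked at.
\<close>

definition is_instance :: "nat \<Rightarrow> (nat \<Rightarrow> nat) \<Rightarrow> bool" where
  "is_instance k a \<longleftrightarrow> k \<ge> 1 \<and> (\<forall>i\<in>{1..k}. a i > 0) \<and> mono_on {1..k} a"

definition density :: "nat \<Rightarrow> (nat \<Rightarrow> nat) \<Rightarrow> real" where
  "density k a = (\<Sum>i\<in>{1..k}. 1 / real (a i))"

definition is_schedule :: "nat \<Rightarrow> (nat \<Rightarrow> nat) \<Rightarrow> (int \<Rightarrow> nat) \<Rightarrow> bool" where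
  "is_schedule k a S \<longleftrightarrow>
     (\<forall>t. S t \<in> {1..k}) \<and>
     (\<forall>i\<in>{1..k}. \<forall>m::int. card ({m..<m + int (a i)} \<inter> S -` {i}) \<le> 1)"

definition covering_schedulable :: "nat \<Rightarrow> (nat \<Rightarrow> nat) \<Rightarrow> bool" where
  "covering_schedulable k a \<longleftrightarrow> (\<exists>S. is_schedule k a S)"

text \<open>The series starts at index 0, so the exponent \<open>i - 1\<close> for \<open>i \<ge> 1\<close> becomes \<open>i\<close>.\<close>

definition alpha_star :: real where
  "alpha_star = (\<Sum>i. 1 / (2 ^ i + 1))"

lemma summable_alpha_star: "summable (\<lambda>i. 1 / (2 ^ i + 1 :: real))"
proof (rule summable_comparison_test')
  show "summable (\<lambda>i. (1 / 2 :: real) ^ i)"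
    by (rule summable_geometric) simp
  show "norm (1 / (2 ^ i + 1 :: real)) \<le> (1 / 2) ^ i" if "i \<ge> 0" for i :: nat
    by (simp add: power_one_over frac_le add_pos_pos)
qed

end

theory Submission
  imports Defs "HOL-Combinatorics.Permutations"
begin

text \<open>
  Suppose that some tasks \<open>P\<close> can be scheduled so that one residue class modulo \<open>n\<close> stays free. If a
  remaining period is at most \<open>n\<close>, we are done; if it lies in \<open>{n<..2 * n}\<close>, it takes half of the class, using
  density at most \<open>1 / (n + 1)\<close>; and if all remaining periods exceed \<open>2 * n\<close>, then dividing them by \<open>n\<close> gives
  periods of at least 3 and multiplies the density by at least \<open>(2 * n + 1) / 3\<close>. Starting with \<open>n = 1\<close>,
  the densities used up sum to \<open>\<alpha>\<^sup>*\<close>, and it remains to treat density at least 1.264 with all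
  periods at least 3. Starting with two tasks of period 3 and \<open>n = 3\<close>, the same argument and an
  induction on the number of tasks leave only instances with at most one period 3.

  In such an instance we merge the two longest periods \<open>a \<le> b\<close> into the real period \<open>b / 2\<close> again and
  again, until all periods are at most 16 (or 20, if there is no period below 9). This decreases the
  density by little. After rounding up, the instance is determined by the numbers \<open>N c\<close> of periods
  up to \<open>c\<close>, of which finitely many possibilities remain. They are exhausted by a branch and bound
  search over boxes of such counting functions: a box is discarded when its upper corner is not dense
  enough, or when its lower corner is dense enough for an explicit periodic schedule. The search trees
  and the schedules below were found by computer.
\<close>

section \<open>Schedules of multisets of periods\<close>

text \<open>\<open>alpha_star\<close> is about 1.2645, and 1.264 is a decimal just below it. The
  case \<open>n = 1\<close> of the chain forces a target of this size: there the rescaling factor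
  \<open>(2 * n + 1) / 3\<close> is 1, so the density demanded of periods of at least 3 cannot
  exceed \<open>chain_sum 1\<close>, which is \<open>alpha_star\<close>. For larger \<open>n\<close>
  the factor gives a surplus. With a decimal target the search is integer arithmetic in millionths,
  and weights are rounded up so that no sufficiently dense instance is discarded. Finiteness has two
  sources. Merging bounds the periods. Multiplicities are bounded because \<open>c\<close> tasks of
  period at most \<open>c\<close> can run in rotation: an unschedulable instance has fewer than
  \<open>c\<close> periods up to \<open>c\<close>. Merging is done in the reals, since rounding
  after every merge would accumulate errors. The price is that a rounded period \<open>v\<close>
  only certifies a real period above \<open>v - 1\<close>. Periods up to half of the merging bound
  escape this, because merging never touches them. With the bound 16 these are the periods up to 8;
  an instance that has none of them would lose density at every period, so it gets the bound
  20.\<close>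

definition lsched :: "nat list \<Rightarrow> bool" where
  "lsched xs \<longleftrightarrow> (\<exists>S :: int \<Rightarrow> nat. (\<forall>t. S t < length xs) \<and>
     (\<forall>s t. s < t \<longrightarrow> S s = S t \<longrightarrow> int (xs ! S s) \<le> t - s))"

text \<open>At most one occurrence in each window of length \<open>p\<close> is the same as gaps of
  at least \<open>p\<close>, the form used in \<open>lsched\<close>. Tasks are list positions, so
  equal periods remain different tasks, while the multiset forgets their order and makes adding,
  dropping and merging tasks plain multiset algebra.\<close>

definition sched :: "nat multiset \<Rightarrow> bool" where
  "sched A \<longleftrightarrow> (\<exists>xs. mset xs = A \<and> lsched xs)"

lemma lsched_perm:
  assumes "lsched xs" "mset xs = mset ys"
  shows "lsched ys"
proof -
  from assms(2) obtain f where f: "f permutes {..<length ys}" "permute_list f ys = xs"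
    by (metis mset_eq_permutation)
  obtain S where S: "\<And>t. S t < length xs"
    "\<And>s t. s < t \<Longrightarrow> S s = S t \<Longrightarrow> int (xs ! S s) \<le> t - s"
    using assms(1) unfolding lsched_def by blast
  have len: "length xs = length ys"
    using assms(2) by (metis size_mset)
  have lt: "f i < length ys" if "i < length ys" for i
    using permutes_in_image[OF f(1), of i] that by simp
  have nth: "ys ! f i = xs ! i" if "i < length ys" for i
    using permute_list_nth[OF f(1), of i] that f(2) by simp
  have inj: "f i = f j \<longleftrightarrow> i = j" for i j
    using permutes_inj[OF f(1)] by (auto dest: injD)
  show ?thesis
    unfolding lsched_def
    by (rule exI[of _ "\<lambda>t. f (S t)"]) (use S len lt nth inj in auto)
qed

lemma sched_mset: "sched (mset xs) \<longleftrightarrow> lsched xs"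
  unfolding sched_def using lsched_perm by blast

text \<open>A covering schedule only limits how often a task may run, so additional tasks can stay
  idle forever.\<close>

lemma sched_mono:
  assumes "sched A" "A \<subseteq># B"
  shows "sched B"
proof -
  obtain xs where xs: "mset xs = A" "lsched xs"
    using assms(1) unfolding sched_def by blast
  obtain ys where ys: "mset ys = B - A"
    using ex_mset by blast
  obtain S where S: "\<And>t. S t < length xs"
    "\<And>s t. s < t \<Longrightarrow> S s = S t \<Longrightarrow> int (xs ! S s) \<le> t - s"
    using xs(2) unfolding lsched_def by blast
  have "lsched (xs @ ys)"
    unfolding lsched_def
  proof (intro exI conjI allI impI)
    show "S t < length (xs @ ys)" for t
      using S(1)[of t] by simp
    show "int ((xs @ ys) ! S s) \<le> t - s" if "s < t" "S s = S t" for s t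
      using S(1)[of s] S(2)[OF that] by (simp add: nth_append)
  qed
  moreover have "mset (xs @ ys) = B"
    using xs ys assms(2) by simp
  ultimately show ?thesis
    using sched_mset by metis
qed

text \<open>Round robin: on day \<open>t\<close> the task \<open>t mod n\<close> runs.\<close>

lemma sched_replicate: "n > 0 \<Longrightarrow> sched (replicate_mset n n)"
proof -
  assume n: "n > 0"
  have "lsched (replicate n n)"
    unfolding lsched_def
  proof (intro exI conjI allI impI)
    show "nat (t mod int n) < length (replicate n n)" for t
      using n by (simp add: nat_less_iff)
  next
    fix s t :: int
    assume st: "s < t" "nat (s mod int n) = nat (t mod int n)"
    then have "s mod int n = t mod int n"
      using n by (simp add: nat_eq_iff)
    then have "int n dvd t - s"
      by (metis mod_eq_dvd_iff)
    then have "int n \<le> t - s"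
      using st(1) by (simp add: zdvd_imp_le)
    then show "int (replicate n n ! nat (s mod int n)) \<le> t - s"
      using n by (simp add: nat_less_iff)
  qed
  then show ?thesis
    by (metis sched_mset mset_replicate)
qed

text \<open>Signed number of elements of \<open>T\<close> between 0 and \<open>s\<close>. It numbers
  the elements of \<open>T\<close> by consecutive integers in both directions, and makes sense even
  if \<open>T\<close> is finite or bounded on one side.\<close>

definition tally :: "int set \<Rightarrow> int \<Rightarrow> int" where
  "tally T s = (if 0 \<le> s then int (card (T \<inter> {0..<s})) else - int (card (T \<inter> {s..<0})))"

lemma tally_diff:
  assumes "s \<le> t"
  shows "tally T t - tally T s = int (card (T \<inter> {s..<t}))"
proof -
  have split: "card (T \<inter> {a..<c}) = card (T \<inter> {a..<b}) + card (T \<inter> {b..<c})"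
    if "a \<le> b" "b \<le> c" for a b c :: int
  proof -
    have "T \<inter> {a..<c} = (T \<inter> {a..<b}) \<union> (T \<inter> {b..<c})"
      using that by auto
    then show ?thesis
      by (simp add: card_Un_disjoint disjoint_iff)
  qed
  show ?thesis
    using assms split[of 0 s t] split[of s 0 t] split[of s t 0] by (auto simp: tally_def)
qed

text \<open>Since \<open>s\<close> and \<open>t\<close> both lie in \<open>T\<close>, the elements
  in \<open>{s..<t}\<close> correspond to the gaps between \<open>s\<close> and \<open>t\<close>,
  each of length at least \<open>p\<close>. The induction splits off the last gap, from the largest
  element \<open>m\<close> before \<open>t\<close>.\<close>

lemma spaced_card:
  fixes T :: "int set"
  assumes "\<And>s t. s \<in> T \<Longrightarrow> t \<in> T \<Longrightarrow> s < t \<Longrightarrow> int p \<le> t - s"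
    and "s \<in> T" "t \<in> T" "s \<le> t"
  shows "int p * int (card (T \<inter> {s..<t})) \<le> t - s"
  using assms(3,4)
proof (induction "nat (t - s)" arbitrary: t rule: less_induct)
  case less
  show ?case
  proof (cases "s = t")
    case False
    define m where "m = Max (T \<inter> {s..<t})"
    have fin: "finite (T \<inter> {s..<t})" and ne: "s \<in> T \<inter> {s..<t}"
      using less.prems assms(2) False by auto
    have m: "m \<in> T \<inter> {s..<t}"
      unfolding m_def by (rule Max_in) (use fin ne in auto)
    have up: "x \<le> m" if "x \<in> T \<inter> {s..<t}" for x
      unfolding m_def using fin that by (rule Max_ge)
    have eq: "T \<inter> {s..<t} = insert m (T \<inter> {s..<m})"
      using m up by fastforce
    have "card (T \<inter> {s..<t}) = Suc (card (T \<inter> {s..<m}))"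
      unfolding eq by (rule card_insert_disjoint) auto
    moreover have "int p * int (card (T \<inter> {s..<m})) \<le> m - s"
      using m by (intro less.hyps) auto
    moreover have "int p \<le> t - m"
      using m less.prems by (intro assms(1)) auto
    ultimately show ?thesis
      by (simp add: algebra_simps)
  qed simp
qed

text \<open>The group \<open>bs\<close> takes over the slots of one task of period \<open>p\<close>, following a schedule
  of the periods \<open>cs\<close> on the bi-infinite enumeration of these slots.\<close>

lemma lsched_subst:
  assumes "lsched (p # xs)" "lsched cs" "length bs = length cs"
    and "\<And>i. i < length bs \<Longrightarrow> bs ! i \<le> p * cs ! i"
  shows "lsched (bs @ xs)"
proof -
  obtain S where S: "\<And>t. S t < length (p # xs)"
    "\<And>s t. s < t \<Longrightarrow> S s = S t \<Longrightarrow> int ((p # xs) ! S s) \<le> t - s"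
    using assms(1) unfolding lsched_def by blast
  obtain C where C: "\<And>t. C t < length cs"
    "\<And>s t. s < t \<Longrightarrow> C s = C t \<Longrightarrow> int (cs ! C s) \<le> t - s"
    using assms(2) unfolding lsched_def by blast
  define T where "T = {t. S t = 0}"
  define n where "n = length bs"
  \<comment> \<open>Members of the group get the indices below \<open>n\<close>; the task
    \<open>i + 1\<close> of \<open>p # xs\<close> moves to \<open>n + i\<close>, its position in
    \<open>bs @ xs\<close>.\<close>
  define S' where "S' t = (if S t = 0 then C (tally T t) else n + (S t - 1))" for t
  have nC: "C t < n" for t
    using C(1) assms(3) by (simp add: n_def)
  show ?thesis
    unfolding lsched_def
  proof (intro exI conjI allI impI)
    show "S' t < length (bs @ xs)" for t
      using S(1)[of t] nC[of "tally T t"] by (auto simp: S'_def n_def)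
  next
    fix s t :: int
    assume st: "s < t" "S' s = S' t"
    show "int ((bs @ xs) ! S' s) \<le> t - s"
    proof (cases "S s = 0")
      case True
      then have True': "S t = 0"
        using st(2) nC[of "tally T s"] by (auto simp: S'_def split: if_splits)
      have sT: "s \<in> T" "t \<in> T"
        using True True' by (auto simp: T_def)
      have sp: "int p * int (card (T \<inter> {s..<t})) \<le> t - s"
      proof (rule spaced_card)
        show "int p \<le> b - a" if "a \<in> T" "b \<in> T" "a < b" for a b
          using S(2)[of a b] that by (simp add: T_def)
      qed (use sT st in auto)
      have df: "tally T t - tally T s = int (card (T \<inter> {s..<t}))"
        using st by (intro tally_diff) auto
      have "s \<in> T \<inter> {s..<t}" "finite (T \<inter> {s..<t})"
        using sT st by auto
      then have "0 < card (T \<inter> {s..<t})"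
        using card_gt_0_iff by blast
      then have "tally T s < tally T t"
        using df by simp
      moreover have Ceq: "C (tally T s) = C (tally T t)"
        using st True True' by (simp add: S'_def)
      \<comment> \<open>In the numbering of slots, \<open>s\<close> and \<open>t\<close> are
        \<open>card (T \<inter> {s..<t})\<close> apart, so \<open>C\<close> forces this number to be
        at least the period in \<open>cs\<close>. Each slot gap in turn costs at least
        \<open>p\<close> days.\<close>
      ultimately have "int (cs ! C (tally T s)) \<le> int (card (T \<inter> {s..<t}))"
        using C(2) df by metis
      then have "int p * int (cs ! C (tally T s)) \<le> t - s"
        using sp mult_left_mono[of "int (cs ! C (tally T s))" "int (card (T \<inter> {s..<t}))" "int p"] by linarith
      moreover have "bs ! C (tally T s) \<le> p * cs ! C (tally T s)"
        using assms(4) nC by (simp add: n_def)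
      then have "int (bs ! C (tally T s)) \<le> int p * int (cs ! C (tally T s))"
        by (metis of_nat_le_iff of_nat_mult)
      ultimately show ?thesis
        using True nC by (simp add: S'_def nth_append n_def)
    next
      case False
      then have "S t \<noteq> 0" "S s = S t"
        using st(2) nC[of "tally T t"] by (auto simp: S'_def split: if_splits)
      moreover have "(bs @ xs) ! S' s = (p # xs) ! S s"
        using False nth_append_length_plus[of bs xs "S s - 1"] by (simp add: S'_def n_def nth_Cons')
      ultimately show ?thesis
        using S(2)[OF st(1)] by simp
    qed
  qed
qed

text \<open>Measured in slots of a task of period \<open>p\<close>, a period \<open>b\<close> is
  satisfied by any gap \<open>f b\<close> with \<open>b \<le> p * f b\<close>. The applications take
  \<open>f\<close> constant or \<open>f b\<close> equal to \<open>b / p\<close> rounded up.\<close>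

lemma sched_subst:
  assumes "sched (add_mset p A)" "sched (image_mset f B)"
    and "\<And>b. b \<in># B \<Longrightarrow> b \<le> p * f b"
  shows "sched (A + B)"
proof -
  obtain xs where xs: "mset xs = A"
    using ex_mset by blast
  obtain bs where bs: "mset bs = B"
    using ex_mset by blast
  have "lsched (p # xs)"
    using assms(1) xs sched_mset[of "p # xs"] by simp
  moreover have "lsched (map f bs)"
    using assms(2) bs sched_mset[of "map f bs"] by simp
  ultimately have "lsched (bs @ xs)"
    by (rule lsched_subst) (use assms(3) bs in auto)
  then show ?thesis
    using sched_mset[of "bs @ xs"] xs bs by (simp add: add.commute)
qed

section \<open>Shortening, merging and pooling of tasks\<close>

lemma sched_single: "sched {#Suc 0#}"
  using sched_replicate[of "Suc 0"] by simp

lemma sched_decrease: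
  assumes "sched (add_mset b A)" "a \<le> b"
  shows "sched (add_mset a A)"
  using sched_subst[OF assms(1), of "\<lambda>_. Suc 0" "{#a#}"] sched_single assms(2) by simp

text \<open>The two tasks use the slots of the task of period \<open>c\<close> alternately, so each
  of them runs at gaps of at least \<open>2 * c\<close>.\<close>

lemma sched_fold:
  assumes "sched (add_mset c A)" "a \<le> 2 * c" "b \<le> 2 * c"
  shows "sched (add_mset a (add_mset b A))"
proof -
  have "sched {#2, 2#}"
    using sched_replicate[of 2] by (simp add: numeral_2_eq_2)
  then show ?thesis
    using sched_subst[OF assms(1), of "\<lambda>_. 2" "{#a, b#}"] assms(2,3)
    by (force simp: mult.commute)
qed

text \<open>Choose \<open>n\<close> tasks of period at most \<open>n\<close>, treat all of them as
  having period \<open>n\<close>, and let them run in rotation. Read backwards, this bounds the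
  counts of every unschedulable multiset and supplies the initial boxes of the search.\<close>

lemma sched_of_many:
  assumes "n > 0" "n \<le> size (filter_mset (\<lambda>v. v \<le> n) A)"
  shows "sched A"
proof -
  let ?F = "filter_mset (\<lambda>v. v \<le> n) A"
  obtain xs where xs: "mset xs = ?F"
    using ex_mset by blast
  have len: "n \<le> length xs"
    using assms(2) xs by (metis size_mset)
  have "sched (image_mset (\<lambda>_. n) (mset (take n xs)))"
    using sched_replicate[OF assms(1)] len by (simp add: image_mset_const_eq)
  then have "sched ({#} + mset (take n xs))"
  proof (rule sched_subst[rotated])
    show "sched (add_mset 1 {#})"
      using sched_single by simp
    show "b \<le> 1 * n" if "b \<in># mset (take n xs)" for b
    proof -
      have "b \<in># ?F"
        using that xs in_set_takeD by (metis set_mset_mset)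
      then show ?thesis
        by simp
    qed
  qed
  moreover have "mset (take n xs) \<subseteq># mset xs"
    by (metis append_take_drop_id mset_append mset_subset_eq_add_left)
  then have "mset (take n xs) \<subseteq># A"
    using xs multiset_filter_subset subset_mset.order_trans by metis
  ultimately show ?thesis
    using sched_mono by simp
qed

text \<open>List positions start at 0 and task indices at 1, hence the \<open>Suc\<close>. Two
  occurrences of \<open>i\<close> in a window of length \<open>a i\<close> would be less than
  \<open>a i\<close> apart.\<close>

lemma covering_schedulableI:
  assumes "sched (image_mset a (mset_set {1..k}))"
  shows "covering_schedulable k a"
proof -
  have "mset (map a [1..<Suc k]) = image_mset a (mset_set {1..k})"
    by (metis mset_map mset_upt atLeastLessThanSuc_atLeastAtMost)
  then have "lsched (map a [1..<Suc k])"
    using assms sched_mset by metis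
  then obtain S where S: "\<And>t. S t < length (map a [1..<Suc k])"
    "\<And>s t. s < t \<Longrightarrow> S s = S t \<Longrightarrow> int (map a [1..<Suc k] ! S s) \<le> t - s"
    unfolding lsched_def by blast
  have Sk: "S t < k" for t
    using S(1)[of t] by (simp del: upt_Suc)
  have gap: "int (a (Suc (S s))) \<le> t - s" if "s < t" "S s = S t" for s t
    using S(2)[OF that] Sk[of s] by (simp del: upt_Suc)
  have "is_schedule k a (\<lambda>t. Suc (S t))"
    unfolding is_schedule_def
  proof (intro conjI allI ballI)
    show "Suc (S t) \<in> {1..k}" for t
      using Sk[of t] by auto
  next
    fix i and m :: int
    let ?X = "{m..<m + int (a i)} \<inter> (\<lambda>t. Suc (S t)) -` {i}"
    have "s = t" if "s \<in> ?X" "t \<in> ?X" for s t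
      using that gap[of s t] gap[of t s] by (cases s t rule: linorder_cases) auto
    then show "card ?X \<le> 1"
      by (metis card_le_Suc0_iff_eq One_nat_def card.infinite zero_le)
  qed
  then show ?thesis
    unfolding covering_schedulable_def by blast
qed

section \<open>Chains of doubling moduli\<close>

definition rdens :: "real multiset \<Rightarrow> real" where
  "rdens R = (\<Sum>r\<in>#R. 1 / r)"

definition ndens :: "nat multiset \<Rightarrow> real" where
  "ndens A = (\<Sum>a\<in>#A. 1 / real a)"

lemma rdens_simps [simp]:
  "rdens {#} = 0" "rdens (add_mset r R) = 1 / r + rdens R"
  by (simp_all add: rdens_def)

lemma ndens_simps [simp]:
  "ndens {#} = 0" "ndens (add_mset a A) = 1 / real a + ndens A"
  by (simp_all add: ndens_def)

text \<open>The most density a chain can spend when it starts from a free class modulo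
  \<open>n\<close> and halves it forever: at modulus \<open>2 ^ j * n\<close> the cost is at most
  the reciprocal of \<open>2 ^ j * n + 1\<close>. In particular \<open>chain_sum 1\<close> is
  \<open>alpha_star\<close>.\<close>

definition chain_sum :: "nat \<Rightarrow> real" where
  "chain_sum n = (\<Sum>j. 1 / (2 ^ j * real n + 1))"

section \<open>Estimates for the chain sums\<close>

lemma chain_summable:
  assumes "n \<ge> 1"
  shows "summable (\<lambda>j. 1 / (2 ^ j * real n + 1))"
proof (rule summable_comparison_test')
  show "summable (\<lambda>j. (1 / 2 :: real) ^ j)"
    by (rule summable_geometric) simp
  show "norm (1 / (2 ^ j * real n + 1)) \<le> (1 / 2) ^ j" for j
  proof -
    have "(2::real) ^ j * 1 \<le> 2 ^ j * real n"
      using assms by (intro mult_left_mono) auto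
    then have "(2::real) ^ j \<le> 2 ^ j * real n + 1"
      by linarith
    then have "1 / (2 ^ j * real n + 1) \<le> 1 / 2 ^ j"
      by (intro frac_le) simp_all
    then show ?thesis
      by (simp add: power_one_over)
  qed
qed

lemma chain_sum_step:
  assumes "n \<ge> 1"
  shows "chain_sum n = 1 / real (n + 1) + chain_sum (2 * n)"
proof -
  have "chain_sum n = (\<Sum>j. 1 / (2 ^ Suc j * real n + 1)) + 1 / (2 ^ 0 * real n + 1)"
    using suminf_split_head[OF chain_summable[OF assms]] unfolding chain_sum_def by linarith
  then show ?thesis
    by (simp add: chain_sum_def mult_ac)
qed

text \<open>The denominator lies between \<open>2 ^ j * n\<close> and
  \<open>2 ^ j * (n + 1)\<close>, so both bounds are geometric series of ratio 1/2.\<close>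

lemma chain_sum_bounds:
  assumes "n \<ge> 1"
  shows "2 / real (n + 1) \<le> chain_sum n" "chain_sum n \<le> 2 / real n"
proof -
  have geo: "(\<lambda>j. (1 / 2 :: real) ^ j * c) sums (2 * c)" for c
    using sums_mult2[OF geometric_sums[of "1 / 2 :: real"], of c] by simp
  have "1 / real (n + 1) * (1 / 2) ^ j \<le> 1 / (2 ^ j * real n + 1)" for j
  proof -
    have "2 ^ j * real n + 1 \<le> 2 ^ j * real (n + 1)"
      by (simp add: algebra_simps)
    then have "1 / (2 ^ j * real (n + 1)) \<le> 1 / (2 ^ j * real n + 1)"
      by (intro frac_le add_nonneg_pos) auto
    then show ?thesis
      by (simp add: power_one_over mult.commute)
  qed
  then have "2 * (1 / real (n + 1)) \<le> chain_sum n"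
    unfolding chain_sum_def
    by (intro sums_le[OF _ geo summable_sums[OF chain_summable[OF assms]]]) (simp add: mult_ac)
  then show "2 / real (n + 1) \<le> chain_sum n"
    by simp
  have "1 / (2 ^ j * real n + 1) \<le> (1 / 2) ^ j * (1 / real n)" for j
  proof -
    have "1 / (2 ^ j * real n + 1) \<le> 1 / (2 ^ j * real n)"
      using assms by (intro frac_le) auto
    then show ?thesis
      by (simp add: power_one_over)
  qed
  then have "chain_sum n \<le> 2 * (1 / real n)"
    unfolding chain_sum_def
    by (intro sums_le[OF _ summable_sums[OF chain_summable[OF assms]] geo])
  then show "chain_sum n \<le> 2 / real n"
    by simp
qed

text \<open>If all remaining periods exceed \<open>2 * n\<close>, rescaling by \<open>n\<close>
  multiplies the density by at least \<open>(2 * n + 1) / 3\<close>; this must still leave 1.264.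
  The case \<open>n = 1\<close> is tight up to the third decimal, while the right-hand side tends to
  4/3 for large \<open>n\<close>.\<close>

lemma chain_sum_scaled:
  assumes "n \<ge> 1"
  shows "1.264 \<le> chain_sum n * (2 * real n + 1) / 3"
proof (cases "n = 1")
  case True
  \<comment> \<open>Six terms and the tail bound 2/65 already give more than 1.2643.\<close>
  have "chain_sum 1 = 1/2 + (1/3 + (1/5 + (1/9 + (1/17 + (1/33 + chain_sum 64)))))"
    using chain_sum_step[of 1] chain_sum_step[of 2] chain_sum_step[of 4] chain_sum_step[of 8]
      chain_sum_step[of 16] chain_sum_step[of 32] by simp
  then show ?thesis
    using chain_sum_bounds(1)[of 64] True by simp
next
  case False
  \<comment> \<open>Shifting \<open>n\<close> by 2 turns the claim, after clearing denominators,
    into a polynomial inequality whose coefficients are all positive.\<close>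
  define x where "x = real n - 2"
  have x: "x \<ge> 0" "real n = x + 2"
    using False assms by (auto simp: x_def)
  have "1 / (real n + 1) + 1 / (2 * real n + 1) + 1 / (4 * real n + 1) + 2 / (8 * real n + 1) \<le> chain_sum n"
    using chain_sum_step[of n] chain_sum_step[of "2 * n"] chain_sum_step[of "4 * n"]
      chain_sum_bounds(1)[of "8 * n"] assms by (simp add: add_ac)
  \<comment> \<open>3.792 is three times 1.264. One unit of this numerator is the summand with
    denominator \<open>2 * n + 1\<close>, so the polynomial inequality below only deals with
    2.792.\<close>
  moreover have "3.792 / (2 * real n + 1) \<le>
    1 / (real n + 1) + 1 / (2 * real n + 1) + 1 / (4 * real n + 1) + 2 / (8 * real n + 1)"
  proof -
    have "(2*x+5) * ((4*x+9) * (8*x+17) + (x+3) * (8*x+17) + 2 * (x+3) * (4*x+9)) -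
      2.792 * ((x+3) * (4*x+9) * (8*x+17)) = 8.472 + 31.184 * x + 27.088 * x^2 + 6.656 * x^3"
      by (simp add: field_simps power2_eq_square power3_eq_cube)
    also have "\<dots> \<ge> 0"
      using x(1) by simp
    finally have le: "2.792 * ((x+3) * (4*x+9) * (8*x+17)) \<le>
      (2*x+5) * ((4*x+9) * (8*x+17) + (x+3) * (8*x+17) + 2 * (x+3) * (4*x+9))"
      by simp
    have frac: "c / p \<le> n / d" if "c * d \<le> p * n" "0 < p" "0 < d" for c p n d :: real
      using that by (simp add: field_simps)
    have "2.792 / (2*x+5) \<le>
      ((4*x+9) * (8*x+17) + (x+3) * (8*x+17) + 2 * (x+3) * (4*x+9)) / ((x+3) * (4*x+9) * (8*x+17))"
      by (rule frac[OF le]) (use x(1) in auto)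
    also have "\<dots> = 1 / (x+3) + 1 / (4*x+9) + 2 / (8*x+17)"
    proof -
      have split: "(B * D + A * D + 2 * A * B) / (A * B * D) = 1 / A + 1 / B + 2 / D"
        if "A \<noteq> 0" "B \<noteq> 0" "D \<noteq> 0" for A B D :: real
        using that by (simp add: field_simps)
      show ?thesis
        by (rule split) (use x(1) in auto)
    qed
    finally have "2.792 / (2*x+5) \<le> 1 / (x+3) + 1 / (4*x+9) + 2 / (8*x+17)" .
    moreover have "3.792 / (2*x+5) = 2.792 / (2*x+5) + 1 / (2*x+5)"
      by (subst add_divide_distrib[symmetric]) simp
    ultimately have "3.792 / (2*x+5) \<le> 1 / (x+3) + 1 / (2*x+5) + 1 / (4*x+9) + 2 / (8*x+17)"
      by linarith
    then show ?thesis
      unfolding x(2) by (simp add: add_ac)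
  qed
  ultimately have "3.792 / (2 * real n + 1) \<le> chain_sum n"
    by linarith
  then show ?thesis
    by (simp add: field_simps)
qed

text \<open>\<open>q\<close> is \<open>r / n\<close> rounded up. The last inequality bounds the loss
  by rounding; equality holds for \<open>r = 2 * n + 1\<close>, where \<open>q = 3\<close>, and this
  is the origin of the factor \<open>(2 * n + 1) / 3\<close>.\<close>

lemma ceil_div:
  fixes n r :: nat
  assumes "n \<ge> 1" "2 * n < r"
  defines "q \<equiv> (r + n - 1) div n"
  shows "3 \<le> q" "r \<le> n * q" "(2 * n + 1) * q \<le> 3 * r"
proof -
  define k where "k = (r - 1) div n"
  have q: "q = Suc k"
  proof -
    have eq: "r + n - 1 = (r - 1) + n"
      using assms by simp
    have "((r - 1) + n) div n = (r - 1) div n + 1"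
      using assms(1) by (intro div_add_self2) auto
    then show ?thesis
      unfolding q_def k_def eq by (simp only: Suc_eq_plus1)
  qed
  have dm: "n * k + (r - 1) mod n = r - 1"
    unfolding k_def by simp
  have k2: "2 \<le> k"
    using assms unfolding k_def by (simp add: less_eq_div_iff_mult_less_eq)
  show "3 \<le> q"
    using k2 q by simp
  have "(r - 1) mod n < n"
    using assms(1) by simp
  then have "r - 1 < n * k + n"
    using dm by linarith
  then show "r \<le> n * q"
    unfolding q mult_Suc_right by linarith
  have r: "n * k + 1 \<le> r"
    using dm assms(2) by linarith
  \<comment> \<open>The two sides of the next inequality differ by \<open>(n - 1) * (k - 2)\<close>,
    which becomes the visibly nonnegative \<open>m * j\<close>.\<close>
  obtain m j where mj: "n = Suc m" "k = 2 + j"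
    using assms(1) k2 by (metis Suc_le_D One_nat_def le_Suc_ex)
  have le: "(2 * n + 1) * q \<le> 3 * (n * k + 1)"
    unfolding q mj by (simp add: algebra_simps)
  show "(2 * n + 1) * q \<le> 3 * r"
    using order_trans[OF le mult_le_mono2[OF r]] .
qed

text \<open>\<open>P\<close> leaves one residue class modulo \<open>n\<close> free. A member of \<open>R\<close> in \<open>{n<..2 * n}\<close> halves
  that class at the cost of at most \<open>1 / (n + 1)\<close>; if there is none, then rescaling
  by \<open>n\<close> increases the density enough.\<close>

lemma sched_chain:
  assumes "n \<ge> 1" "sched (add_mset n P)" "\<forall>r\<in>#R. 0 < r" "chain_sum n \<le> ndens R"
    and big: "\<And>T. size T \<le> size R \<Longrightarrow> \<forall>r\<in>#T. 3 \<le> r \<Longrightarrow> 1.264 \<le> ndens T \<Longrightarrow> sched T"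
  shows "sched (P + R)"
  using assms
proof (induction "size R" arbitrary: n P R rule: less_induct)
  case less
  consider r where "r \<in># R" "r \<le> n" | r where "r \<in># R" "n < r" "r \<le> 2 * n" | "\<forall>r\<in>#R. 2 * n < r"
    by (meson not_less)
  then show ?case
  proof cases
    case 1
    have "sched (add_mset r P)"
      using sched_decrease[OF less.prems(2) 1(2)] .
    moreover have "add_mset r P \<subseteq># P + R"
      using 1(1) by (metis add_mset_add_single mset_subset_eq_mono_add_left_cancel single_subset_iff)
    ultimately show ?thesis
      by (rule sched_mono)
  next
    case 2
    obtain R' where R': "R = add_mset r R'"
      using 2(1) by (metis multi_member_split)
    have "sched (P + R) \<longleftrightarrow> sched (add_mset r P + R')"
      by (simp add: R')
    also have "sched (add_mset r P + R')"
    proof (rule less.hyps[of R' "2 * n" "add_mset r P"])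
      \<comment> \<open>The task \<open>r\<close> takes every other slot of the free class; a class
        modulo \<open>2 * n\<close> stays free.\<close>
      have "sched (add_mset r (add_mset (2 * n) P))"
        by (rule sched_fold[OF less.prems(2)]) (use 2 in auto)
      then show "sched (add_mset (2 * n) (add_mset r P))"
        by (simp add: add_mset_commute)
      have "1 / real r \<le> 1 / real (n + 1)"
        using 2 by (intro divide_left_mono) auto
      then show "chain_sum (2 * n) \<le> ndens R'"
        using chain_sum_step[OF less.prems(1)] less.prems(4) by (simp add: R')
    qed (use less.prems R' in auto)
    finally show ?thesis .
  next
    case 3
    let ?f = "\<lambda>r. (r + n - 1) div n"
    have "sched (image_mset ?f R)"
    \<comment> \<open>Rescaling keeps the number of tasks, so the size bound in \<open>big\<close>
      is met.\<close>
    proof (rule less.prems(5))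
      show "\<forall>q\<in>#image_mset ?f R. 3 \<le> q"
        using ceil_div(1)[OF less.prems(1)] 3 by auto
      let ?c = "(2 * real n + 1) / 3"
      have "ndens R * ?c \<le> ndens (image_mset ?f R)"
      proof -
        have "ndens R * ?c = (\<Sum>r\<in>#R. 1 / real r * ?c)"
          unfolding ndens_def by (rule sum_mset_distrib_right)
        also have "\<dots> \<le> (\<Sum>r\<in>#R. 1 / real (?f r))"
        proof (rule sum_mset_mono)
          fix r assume r: "r \<in># R"
          then have f: "3 \<le> ?f r" "(2 * n + 1) * ?f r \<le> 3 * r" "0 < r"
            using ceil_div(1,3)[OF less.prems(1)] 3 less.prems(3) by auto
          from f(2) have "real ((2 * n + 1) * ?f r) \<le> real (3 * r)"
            by (rule of_nat_mono)
          then have "(2 * real n + 1) * real (?f r) \<le> 3 * real r"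
            by (simp add: algebra_simps)
          moreover have "0 < real (?f r)" "0 < real r"
            using f by linarith+
          ultimately show "1 / real r * ?c \<le> 1 / real (?f r)"
            by (simp add: field_simps)
        qed
        finally show ?thesis
          by (simp add: ndens_def image_mset.compositionality comp_def)
      qed
      moreover have "chain_sum n * ?c \<le> ndens R * ?c"
        using less.prems(4) by (intro mult_right_mono) auto
      ultimately show "1.264 \<le> ndens (image_mset ?f R)"
        using chain_sum_scaled[OF less.prems(1)] unfolding times_divide_eq_right
        by (meson order_trans)
    qed simp
    then show ?thesis
      by (rule sched_subst[OF less.prems(2)]) (use ceil_div(2)[OF less.prems(1)] 3 in auto)
  qed
qed

section \<open>Merging long periods\<close>

text \<open>Rounding is postponed to the end, so that \<open>b\<close> can be halved exactly as
  often as needed.\<close>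

definition rsched :: "real multiset \<Rightarrow> bool" where
  "rsched R \<longleftrightarrow> sched (image_mset (\<lambda>r. nat \<lceil>r\<rceil>) R)"

lemma rsched_mono: "rsched R \<Longrightarrow> rsched (add_mset b R)"
  unfolding rsched_def by (erule sched_mono) simp

text \<open>Merging survives rounding because \<open>b\<close> rounded up is at most twice
  \<open>b / 2\<close> rounded up; the shorter period \<open>a\<close> is treated like
  \<open>b\<close>.\<close>

lemma rsched_fold:
  assumes "rsched (add_mset (b / 2) R)" "a \<le> b"
  shows "rsched (add_mset a (add_mset b R))"
proof -
  have "nat \<lceil>b\<rceil> \<le> 2 * nat \<lceil>b / 2\<rceil>"
    by linarith
  moreover have "nat \<lceil>a\<rceil> \<le> nat \<lceil>b\<rceil>"
    using assms(2) by (intro nat_mono ceiling_mono)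
  ultimately show ?thesis
    using assms(1) sched_fold[of "nat \<lceil>b / 2\<rceil>" _ "nat \<lceil>a\<rceil>" "nat \<lceil>b\<rceil>"] unfolding rsched_def by simp
qed

text \<open>Merging the two largest periods \<open>a \<le> b\<close> into \<open>b / 2\<close> (or dropping \<open>b\<close> if \<open>a < b / 2\<close>) does not
  decrease the density plus the reciprocal of the largest period.\<close>

lemma fold_down_aux:
  assumes "0 < \<theta>" "2 / \<theta> < C" "\<forall>r\<in>#R. 0 < r" "R \<noteq> {#}"
    and "Max_mset R > \<theta>" "C \<le> rdens R + 1 / Max_mset R"
  shows "\<exists>R'. (rsched R' \<longrightarrow> rsched R) \<and> (\<forall>r\<in>#R'. 0 < r \<and> r \<le> \<theta>) \<and> R' \<noteq> {#} \<and>
    filter_mset (\<lambda>r. r \<le> \<theta> / 2) R' = filter_mset (\<lambda>r. r \<le> \<theta> / 2) R \<and>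
    C \<le> rdens R' + min (1 / Max_mset R') (2 / \<theta>)"
  using assms(3-6)
proof (induction "size R" arbitrary: R rule: less_induct)
  case less
  define b where "b = Max_mset R"
  have "b \<in># R"
    using less.prems(2) unfolding b_def by simp
  then obtain R0 where R0: "R = add_mset b R0"
    by (metis multi_member_split)
  have b: "b > \<theta>" "C \<le> rdens R + 1 / b" "0 < b"
    using less.prems assms(1) by (auto simp: b_def)
  have b2: "1 / b \<le> 1 / \<theta>"
    using b assms(1) by (intro divide_left_mono) auto
  \<comment> \<open>If \<open>b\<close> were the only period, density and bonus together would be
    \<open>2 / b\<close>, below \<open>2 / \<theta>\<close> and hence below
    \<open>C\<close>.\<close>
  have "R0 \<noteq> {#}"
    using b b2 assms(2) R0 by auto
  define a where "a = Max_mset R0"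
  have "a \<in># R0"
    using \<open>R0 \<noteq> {#}\<close> unfolding a_def by simp
  then obtain Q where Q: "R0 = add_mset a Q"
    by (metis multi_member_split)
  have aR: "a \<in># R"
    using \<open>a \<in># R0\<close> by (simp add: R0)
  have "0 < a"
    using less.prems(1) aR by blast
  moreover have "a \<le> b"
    using aR unfolding b_def by simp
  moreover have "r \<le> a" if "r \<in># R0" for r
    using that unfolding a_def by simp
  ultimately have a: "0 < a" "a \<le> b" "\<And>r. r \<in># R0 \<Longrightarrow> r \<le> a"
    by blast+
  define R1 where "R1 = (if a < b / 2 then R0 else add_mset (b / 2) Q)"
  have "R1 \<noteq> {#}" "size R1 < size R"
    using \<open>R0 \<noteq> {#}\<close> by (auto simp: R1_def R0 Q)
  moreover have "rsched R1 \<Longrightarrow> rsched R"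
    using rsched_mono[of R0 b] rsched_fold[OF _ a(2), of Q]
    by (simp add: R1_def R0 Q add_mset_commute split: if_splits)
  moreover have "\<forall>r\<in>#R1. 0 < r"
    using less.prems(1) b by (simp add: R1_def R0 Q)
  \<comment> \<open>Two periods are merged only if \<open>a \<ge> b / 2\<close>, and
    \<open>b / 2\<close> exceeds \<open>\<theta> / 2\<close>. So neither the periods that disappear
    nor the new one are counted here.\<close>
  moreover have "filter_mset (\<lambda>r. r \<le> \<theta> / 2) R1 = filter_mset (\<lambda>r. r \<le> \<theta> / 2) R"
    using b(1) assms(1) by (simp add: R1_def R0 Q)
  moreover have "\<forall>r\<in>#R1. r \<le> a"
    using a(3) by (simp add: R1_def Q)
  ultimately have R1: "R1 \<noteq> {#}" "size R1 < size R" "rsched R1 \<Longrightarrow> rsched R"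
    "\<forall>r\<in>#R1. 0 < r" "\<forall>r\<in>#R1. r \<le> a"
    "filter_mset (\<lambda>r. r \<le> \<theta> / 2) R1 = filter_mset (\<lambda>r. r \<le> \<theta> / 2) R"
    by blast+
  define M where "M = Max_mset R1"
  have M: "0 < M" "M \<le> a"
    using R1 by (auto simp: M_def)
  have M1: "1 / a \<le> 1 / M"
    using M by (intro divide_left_mono) auto
  \<comment> \<open>Merging changes the density by \<open>1 / b - 1 / a\<close>, which a bonus
    rising from \<open>1 / b\<close> to \<open>1 / a\<close> balances exactly. Dropping
    \<open>b\<close> costs twice \<open>1 / b\<close>, in density and in bonus, and the new bonus
    \<open>1 / a\<close> is at least \<open>2 / b\<close>. The first bound, a loss of at most
    \<open>1 / b\<close>, is for the final step only.\<close>
  have dens: "rdens R - 1 / b \<le> rdens R1" "rdens R + 1 / b \<le> rdens R1 + 1 / a"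
  proof -
    have "1 / a \<le> 2 / b \<or> a < b / 2" "a < b / 2 \<Longrightarrow> 2 / b \<le> 1 / a"
      using a(1) b(3) by (auto simp: field_simps)
    then show "rdens R - 1 / b \<le> rdens R1" "rdens R + 1 / b \<le> rdens R1 + 1 / a"
      by (auto simp: R1_def R0 Q)
  qed
  have CM: "C \<le> rdens R1 + 1 / M"
    using dens(2) b(2) M1 by linarith
  show ?case
  proof (cases "M > \<theta>")
    case True
    then show ?thesis
      using less.hyps[OF R1(2) R1(4) R1(1)] CM R1(3,6) by (auto simp: M_def)
  next
    case False
    \<comment> \<open>The process stops here. The last step started from a maximum
      \<open>b > \<theta>\<close>, so the old bonus and the density lost in this step are each at
      most \<open>1 / \<theta>\<close>. This gives the second argument of the minimum.\<close>
    have "C \<le> rdens R1 + 2 / \<theta>"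
      using dens(1) b(2) b2 by (simp add: field_simps)
    moreover have "\<forall>r\<in>#R1. r \<le> \<theta>"
    proof
      fix r assume "r \<in># R1"
      then have "r \<le> M"
        by (simp add: M_def)
      then show "r \<le> \<theta>"
        using False by simp
    qed
    ultimately show ?thesis
      using R1 CM by (intro exI[of _ R1]) (auto simp: M_def min_def)
  qed
qed

text \<open>Adds the case in which no period exceeds \<open>\<theta>\<close> and \<open>R\<close>
  itself is taken. The equality of the filtered multisets is kept because the periods up to
  \<open>\<theta> / 2\<close> remain integers and need no rounding.\<close>

lemma fold_down:
  assumes "0 < \<theta>" "2 / \<theta> < C" "\<forall>r\<in>#R. 0 < r" "C \<le> rdens R"
  obtains R' where "rsched R' \<Longrightarrow> rsched R" "\<forall>r\<in>#R'. 0 < r \<and> r \<le> \<theta>" "R' \<noteq> {#}"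
    "filter_mset (\<lambda>r. r \<le> \<theta> / 2) R' = filter_mset (\<lambda>r. r \<le> \<theta> / 2) R"
    "C \<le> rdens R' + min (1 / Max_mset R') (2 / \<theta>)"
proof -
  have "0 < 2 / \<theta>"
    using assms(1) by simp
  then have "0 < rdens R"
    using assms(2,4) by linarith
  then have ne: "R \<noteq> {#}"
    by auto
  then have "Max_mset R \<in># R"
    by simp
  then have M: "0 < Max_mset R"
    using assms(3) by blast
  show ?thesis
  proof (cases "Max_mset R > \<theta>")
    case True
    have "C \<le> rdens R + 1 / Max_mset R"
      using assms(4) M by (simp add: add_increasing2)
    from fold_down_aux[OF assms(1-3) ne True this] show ?thesis
      using that by blast
  next
    case False
    have "r \<le> \<theta>" if "r \<in># R" for r
    proof -
      have "r \<le> Max_mset R"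
        using that by simp
      then show ?thesis
        using False by linarith
    qed
    moreover have "0 \<le> min (1 / Max_mset R) (2 / \<theta>)"
      using M assms(1) by simp
    then have "C \<le> rdens R + min (1 / Max_mset R) (2 / \<theta>)"
      using assms(4) by linarith
    ultimately show ?thesis
      using that[of R] assms(3) ne by blast
  qed
qed

section \<open>Periodic words\<close>

text \<open>The simulation matches on \<open>0\<close> and \<open>Suc\<close> throughout, so that
  certificates are evaluated by plain rewriting of unary numbers, without arithmetic.\<close>

fun ready :: "nat \<Rightarrow> nat list \<Rightarrow> bool" where
  "ready n [] = False"
| "ready 0 (0 # cs) = True"
| "ready 0 (Suc c # cs) = False"
| "ready (Suc n) (c # cs) = ready n cs"

fun decs :: "nat list \<Rightarrow> nat list" where
  "decs [] = []"
| "decs (0 # cs) = 0 # decs cs"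
| "decs (Suc c # cs) = c # decs cs"

text \<open>One day passes: every timer goes down by one and stops at 0. The timer of the chosen
  task is reset to its period minus 1, since the current day counts as one of the days to
  wait.\<close>

fun pick :: "nat \<Rightarrow> nat list \<Rightarrow> nat list \<Rightarrow> nat list" where
  "pick 0 (c # cs) (0 # ps) = 0 # decs cs"
| "pick 0 (c # cs) (Suc p # ps) = p # decs cs"
| "pick (Suc n) (0 # cs) (p # ps) = 0 # pick n cs ps"
| "pick (Suc n) (Suc c # cs) (p # ps) = c # pick n cs ps"
| "pick n [] ps = []"
| "pick n cs [] = []"

text \<open>\<open>cs\<close> holds, for each task, the number of days until it may run again; a
  word is accepted if each letter names a task whose timer is 0.\<close>

fun run :: "nat list \<Rightarrow> nat list \<Rightarrow> nat list \<Rightarrow> bool" where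
  "run cs ps [] = True"
| "run cs ps (x # xs) = (if ready x cs then run (pick x cs ps) ps xs else False)"

lemma ready_iff: "ready n cs \<longleftrightarrow> n < length cs \<and> cs ! n = 0"
  by (induction n cs rule: ready.induct) auto

lemma decs_eq: "decs cs = map (\<lambda>c. c - 1) cs"
  by (induction cs rule: decs.induct) auto

lemma pick_nth:
  assumes "n < length cs" "length ps = length cs"
  shows "length (pick n cs ps) = length cs \<and>
    (\<forall>k<length cs. pick n cs ps ! k = (if k = n then ps ! k else cs ! k) - 1)"
  using assms by (induction n cs ps rule: pick.induct) (auto simp: decs_eq nth_Cons' less_Suc_eq_0_disj split: if_splits)

text \<open>Arbitrary initial timers are needed for the induction: a timer bounds the first
  occurrence of its task from below, and the period bounds the distance of any two
  occurrences.\<close>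

lemma run_nth:
  assumes "run cs ps xs" "length cs = length ps" "i < length xs"
  shows "xs ! i < length ps \<and> cs ! (xs ! i) \<le> i \<and>
    (\<forall>j. i < j \<longrightarrow> j < length xs \<longrightarrow> xs ! j = xs ! i \<longrightarrow> i + ps ! (xs ! i) \<le> j)"
  using assms
proof (induction xs arbitrary: cs i)
  case (Cons x xs)
  have x: "x < length cs" "cs ! x = 0" and r: "run (pick x cs ps) ps xs"
    using Cons.prems(1) by (auto simp: ready_iff split: if_splits)
  note p = pick_nth[OF x(1) Cons.prems(2)[symmetric]]
  note IH = Cons.IH[OF r]
  show ?case
  proof (cases i)
    case 0
    \<comment> \<open>An occurrence of \<open>x\<close> at \<open>j\<close> is one at
      \<open>j - 1\<close> in the rest of the word, where the timer of \<open>x\<close> starts from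
      \<open>ps ! x - 1\<close>.\<close>
    have "ps ! x \<le> j" if "0 < j" "j < length (x # xs)" "(x # xs) ! j = x" for j
      using that IH[of "j - 1"] p x(1) Cons.prems(2) by (cases j) auto
    then show ?thesis
      using 0 x Cons.prems(2) by simp
  next
    case (Suc i')
    have IH': "xs ! i' < length ps" "pick x cs ps ! (xs ! i') \<le> i'"
      "\<And>j. i' < j \<Longrightarrow> j < length xs \<Longrightarrow> xs ! j = xs ! i' \<Longrightarrow> i' + ps ! (xs ! i') \<le> j"
      using IH[of i'] p Cons.prems Suc by auto
    have "cs ! (xs ! i') \<le> i"
      using IH'(1,2) p x(2) Cons.prems(2) Suc by (auto split: if_splits)
    moreover have "i + ps ! (xs ! i') \<le> j" if "i < j" "j < length (x # xs)" "(x # xs) ! j = xs ! i'" for j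
      using IH'(3)[of "j - 1"] that Suc by (cases j) auto
    ultimately show ?thesis
      using IH'(1) Suc by simp
  qed
qed simp

text \<open>The word is repeated periodically in both directions. Two copies are enough: equal
  letters less than \<open>length w\<close> apart can be found inside \<open>w @ w\<close>, and a
  letter together with its repetition in the second copy shows that its period is at most
  \<open>length w\<close>.\<close>

lemma lsched_word:
  assumes "w \<noteq> []" "run (replicate (length ps) 0) ps (w @ w)"
  shows "lsched ps"
proof -
  have run: "(w @ w) ! i < length ps"
    "i < j \<Longrightarrow> j < length (w @ w) \<Longrightarrow> (w @ w) ! j = (w @ w) ! i \<Longrightarrow> i + ps ! ((w @ w) ! i) \<le> j"
    if "i < length (w @ w)" for i j
    using run_nth[OF assms(2) _ that] by auto
  let ?n = "length w"
  have n: "0 < int ?n"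
    using assms(1) by simp
  define pos where "pos t = nat (t mod int ?n)" for t
  have pos: "pos t < ?n" "int (pos t) = t mod int ?n" for t
    using n by (auto simp: pos_def nat_less_iff)
  show ?thesis
    unfolding lsched_def
  proof (intro exI conjI allI impI)
    show "w ! pos t < length ps" for t
      using run(1)[of "pos t"] pos(1)[of t] by (simp add: nth_append)
  next
    fix s t :: int
    assume st: "s < t" "w ! pos s = w ! pos t"
    show "int (ps ! (w ! pos s)) \<le> t - s"
    proof -
      \<comment> \<open>If \<open>t\<close> is at least a full word after \<open>s\<close>, the copy
        of \<open>s\<close> one word later takes the place of \<open>t\<close>.\<close>
      define d where "d = (if t - s < int ?n then nat (t - s) else ?n)"
      have d: "0 < d" "d \<le> ?n" "int d \<le> t - s"
        using st(1) n by (auto simp: d_def)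
      have same: "(w @ w) ! (pos s + d) = w ! pos s"
      proof (cases "t - s < int ?n")
        case False
        then show ?thesis
          by (simp add: d_def nth_append)
      next
        case True
        have "t mod int ?n = (int (pos s) + int d) mod int ?n"
          using True st(1) unfolding pos(2) d_def by (simp add: mod_add_left_eq)
        then have "pos t = (pos s + d) mod ?n"
          by (metis nat_int of_nat_add pos(2) zmod_int)
        moreover have "(pos s + d) mod ?n = (if pos s + d < ?n then pos s + d else pos s + d - ?n)"
          using pos(1)[of s] d(2) by (simp add: mod_if)
        ultimately show ?thesis
          using st(2) by (simp add: nth_append split: if_splits)
      qed
      have "pos s + ps ! ((w @ w) ! pos s) \<le> pos s + d"
      proof (rule run(2))
        show "(w @ w) ! (pos s + d) = (w @ w) ! pos s"
          using same pos(1)[of s] by (simp add: nth_append)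
      qed (use pos(1)[of s] d in auto)
      then show ?thesis
        using d(3) pos(1)[of s] by (simp add: nth_append)
    qed
  qed
qed

text \<open>Periods and task indices are encoded as letters: \<open>c\<close> is the period 3, and \<open>a\<close> is the task 0.\<close>

definition period :: "char \<Rightarrow> nat" where
  "period c = of_char c - 96"

definition index :: "char \<Rightarrow> nat" where
  "index c = of_char c - 97"

definition valid :: "string \<Rightarrow> bool" where
  "valid s \<longleftrightarrow> lsched (map period s)"

fun cert_ok :: "string \<times> string \<Rightarrow> bool" where
  "cert_ok (p, w) = run (map (\<lambda>_. 0) p) (map period p) (map index (w @ w))"

text \<open>Stated for lists, so that one evaluation of a table turns all its period strings into
  simplification rules for the leaves \<open>W\<close> of the trees. A cyclic schedule needs a
  nonempty word, which is the second assumption.\<close>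

lemma certs_valid:
  assumes "list_all cert_ok cs" "list_all (\<lambda>c. snd c \<noteq> []) cs"
  shows "list_all valid (map fst cs)"
proof -
  have "valid p" if "(p, w) \<in> set cs" for p w
  proof -
    have "cert_ok (p, w)" "w \<noteq> []"
      using assms that by (auto simp: list_all_iff)
    then show ?thesis
      using lsched_word[of "map index w" "map period p"] by (simp add: valid_def map_replicate_const)
  qed
  then show ?thesis
    by (auto simp: list_all_iff)
qed

section \<open>Branch and bound over counting functions\<close>

text \<open>Cumulative counts are the right coordinates: shortening a period or adding a task raises
  them pointwise, and both schedulability and total weight increase with them. Therefore the corners
  of a box speak for all of its members.\<close>

definition cnt :: "nat multiset \<Rightarrow> nat \<Rightarrow> nat" where
  "cnt V c = size (filter_mset (\<lambda>v. v \<le> c) V)"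

lemma lsched_mono:
  assumes "lsched ps" "length ps \<le> length qs" "\<And>i. i < length ps \<Longrightarrow> qs ! i \<le> ps ! i"
  shows "lsched qs"
proof -
  obtain S where S: "\<And>t. S t < length ps"
    "\<And>s t. s < t \<Longrightarrow> S s = S t \<Longrightarrow> int (ps ! S s) \<le> t - s"
    using assms(1) unfolding lsched_def by blast
  show ?thesis
    unfolding lsched_def
  proof (intro exI conjI allI impI)
    show "S t < length qs" for t
      using S(1)[of t] assms(2) by simp
    show "int (qs ! S s) \<le> t - s" if "s < t" "S s = S t" for s t
      using S(2)[OF that] assms(3)[OF S(1)[of s]] by linarith
  qed
qed

text \<open>The hypothesis says that the period at position \<open>i\<close> of the sorted
  \<open>V\<close>, counted from 0, is at most \<open>ps ! i\<close>. So the sorted \<open>V\<close>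
  has enough entries and lies below \<open>ps\<close> entry by entry, and a schedule for
  \<open>ps\<close> serves it.\<close>

lemma sched_cnt:
  assumes "lsched ps" "\<And>i. i < length ps \<Longrightarrow> i < cnt V (ps ! i)"
  shows "sched V"
proof -
  define qs where "qs = sorted_list_of_multiset V"
  have qs: "mset qs = V" "sorted qs"
    by (simp_all add: qs_def)
  have cnt: "cnt V c = length (filter (\<lambda>v. v \<le> c) qs)" for c
    by (simp add: cnt_def qs(1)[symmetric] flip: size_mset mset_filter)
  have nth: "i < length qs \<and> qs ! i \<le> c" if "i < cnt V c" for i c
  proof -
    have i: "i < length (filter (\<lambda>v. v \<le> c) qs)"
      using that cnt by simp
    have "i < length qs"
      using i length_filter_le less_le_trans by blast
    moreover have "qs ! i \<le> c"
    proof (rule ccontr)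
      assume "\<not> qs ! i \<le> c"
      \<comment> \<open>In the sorted list everything from position \<open>i\<close> on would exceed
        \<open>c\<close>, leaving at most \<open>i\<close> entries up to \<open>c\<close>.\<close>
      then have "\<forall>j\<in>{i..<length qs}. \<not> qs ! j \<le> c"
        using sorted_nth_mono[OF qs(2), of i] by (metis atLeastLessThan_iff order_trans)
      then have "{j. j < length qs \<and> qs ! j \<le> c} \<subseteq> {..<i}"
        by force
      then have "card {j. j < length qs \<and> qs ! j \<le> c} \<le> i"
        using card_mono[of "{..<i}"] by fastforce
      then show False
        using i by (simp add: length_filter_conv_card)
    qed
    ultimately show ?thesis
      by simp
  qed
  have "lsched qs"
  proof (rule lsched_mono[OF assms(1)])
    show "qs ! i \<le> ps ! i" if "i < length ps" for i
      using nth assms(2)[OF that] by blast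
    show "length ps \<le> length qs"
      using nth[OF assms(2), of "length ps - 1"] by (cases ps) auto
  qed
  then show ?thesis
    using qs(1) sched_mset by blast
qed

text \<open>A configuration \<open>(a, ds, ws, m)\<close> describes periods in \<open>{a..<a + length ds}\<close>, where the period \<open>a + i\<close>
  has weight \<open>ws ! i\<close>, the \<open>i\<close>-th suffix sum of \<open>ds\<close>. The largest period counts twice,
  the second time with a weight of at most \<open>m\<close>.\<close>

type_synonym cfg = "nat \<times> nat list \<times> nat list \<times> nat"

fun suffix_sums :: "nat list \<Rightarrow> nat list" where
  "suffix_sums [] = []"
| "suffix_sums (d # ds) = sum_list (d # ds) # suffix_sums ds"

text \<open>Weights are in millionths, so 1264000 stands for the density 1.264. The minimum mirrors
  the bonus that is left by \<open>fold_down\<close>.\<close>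

fun heavy :: "cfg \<Rightarrow> nat multiset \<Rightarrow> bool" where
  "heavy (a, ds, ws, m) V \<longleftrightarrow> V \<noteq> {#} \<and> (\<forall>v\<in>#V. a \<le> v \<and> v < a + length ds) \<and>
     1264000 \<le> (\<Sum>v\<in>#V. ws ! (v - a)) + min m (ws ! (Max_mset V - a))"

definition in_box :: "nat \<Rightarrow> nat list \<Rightarrow> nat list \<Rightarrow> nat multiset \<Rightarrow> bool" where
  "in_box a l u V \<longleftrightarrow> (\<forall>i<length l. l ! i \<le> cnt V (a + i)) \<and> (\<forall>i<length u. cnt V (a + i) \<le> u ! i)"

definition solved :: "cfg \<Rightarrow> nat list \<Rightarrow> nat list \<Rightarrow> bool" where
  "solved cf l u \<longleftrightarrow> (\<forall>V. heavy cf V \<longrightarrow> in_box (fst cf) l u V \<longrightarrow> sched V)"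

fun dot :: "nat list \<Rightarrow> nat list \<Rightarrow> nat" where
  "dot (x # xs) (y # ys) = x * y + dot xs ys"
| "dot _ _ = 0"

text \<open>If there are at least \<open>k\<close> periods, then the largest one is at least \<open>a + i\<close> for the first \<open>i\<close>
  with \<open>k \<le> u ! i\<close>.\<close>

fun bonus :: "nat list \<Rightarrow> nat list \<Rightarrow> nat \<Rightarrow> nat" where
  "bonus (w # ws) (x # xs) k = (if k \<le> x then w else bonus ws xs k)"
| "bonus _ _ k = 0"

text \<open>Bounds the weight over the whole box: \<open>u\<close> bounds the counts, and
  \<open>last l\<close> bounds the number of periods from below, which forces the largest period up
  and thus its second weight down. The nested conditional is \<open>min\<close>, spelled out for
  evaluation.\<close>

fun light :: "cfg \<Rightarrow> nat list \<Rightarrow> nat list \<Rightarrow> bool" where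
  "light (a, ds, ws, m) l u \<longleftrightarrow> dot ds u + (let b = bonus ws u (last l) in if m \<le> b then m else b) < 1264000"

text \<open>List access with default 0 beyond the end: a word that asks for a period outside the
  range makes the strict comparison in \<open>dominated\<close> fail.\<close>

fun entry :: "nat list \<Rightarrow> nat \<Rightarrow> nat" where
  "entry [] n = 0"
| "entry (x # xs) n = (if n = 0 then x else entry xs (n - 1))"

text \<open>Tests the hypothesis of \<open>sched_cnt\<close> at the lower corner. The comparison
  \<open>a \<le> p\<close> guards the truncated difference \<open>p - a\<close>.\<close>

fun dominated :: "nat \<Rightarrow> nat list \<Rightarrow> nat \<Rightarrow> nat list \<Rightarrow> bool" where
  "dominated i [] a l = True"
| "dominated i (p # ps) a l = (if a \<le> p then if i < entry l (p - a) then dominated (i + 1) ps a l else False else False)"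

text \<open>Counting functions are nondecreasing, so an upper bound at one position holds at all
  earlier ones as well; dually, \<open>lift_from\<close> passes a lower bound on to all later
  positions.\<close>

fun cap :: "nat \<Rightarrow> nat \<Rightarrow> nat list \<Rightarrow> nat list" where
  "cap p k [] = []"
| "cap p k (x # xs) = (if x \<le> k then x else k) # (if p = 0 then xs else cap (p - 1) k xs)"

fun lift_from :: "nat \<Rightarrow> nat \<Rightarrow> nat list \<Rightarrow> nat list" where
  "lift_from p k [] = []"
| "lift_from p k (x # xs) = (if p = 0 then (if k \<le> x then x else k) # lift_from 0 k xs else x # lift_from (p - 1) k xs)"

text \<open>\<open>L\<close> discards a light box, \<open>W s\<close> appeals to a word for the periods \<open>s\<close>, \<open>H\<close> stands for a box that an earlier
  lemma solves, and \<open>B p k\<close> splits a box into \<open>cnt V (a + p) < k\<close> and \<open>cnt V (a + p) \<ge> k\<close>. A chain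
  \<open>C w\<close> of such splits, whose first parts are all light, lists \<open>p\<close> and \<open>k\<close> as letters in turn.\<close>

datatype tree = L | W string | H | B nat nat tree tree | C string tree

text \<open>The leaves \<open>W\<close> and \<open>H\<close> reduce to the propositions
  \<open>valid\<close> and \<open>solved\<close>, which facts proved before discharge. In a chain
  the same letter \<open>k\<close> serves twice: \<open>index k\<close> is the upper bound of the
  light part and \<open>period k\<close>, one more, the lower bound of the rest.\<close>

function (sequential) check :: "cfg \<Rightarrow> tree \<Rightarrow> nat list \<Rightarrow> nat list \<Rightarrow> bool" where
  "check cf L l u = light cf l u"
| "check cf (W p) l u = (valid p \<and> dominated 0 (map period p) (fst cf) l)"
| "check cf H l u = solved cf l u"
| "check cf (B p k s t) l u = (check cf s l (cap p (k - 1) u) \<and> check cf t (lift_from p k l) u)"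
| "check cf (C [] t) l u = check cf t l u"
| "check cf (C [p] t) l u = False"
| "check cf (C (p # k # w) t) l u =
    (light cf l (cap (index p) (index k) u) \<and> check cf (C w t) (lift_from (index p) (period k) l) u)"
  by pat_completeness auto

termination
  by (relation "measures [\<lambda>(cf, t, l, u). size t, \<lambda>(cf, t, l, u). case t of C w _ \<Rightarrow> length w | _ \<Rightarrow> 0]") auto

text \<open>The weights are determined by their differences \<open>ds\<close>, but they are stored
  too, so that \<open>light\<close> can read them off instead of summing anew at each leaf.\<close>

fun wf_cfg :: "cfg \<Rightarrow> bool" where
  "wf_cfg (a, ds, ws, m) \<longleftrightarrow> ws = suffix_sums ds"

section \<open>Soundness of the search trees\<close>

lemma cnt_mono: "c \<le> d \<Longrightarrow> cnt V c \<le> cnt V d"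
  unfolding cnt_def by (induction V) auto

lemma length_cap [simp]: "length (cap p k xs) = length xs"
  by (induction p k xs rule: cap.induct) auto

lemma length_lift_from [simp]: "length (lift_from p k xs) = length xs"
  by (induction p k xs rule: lift_from.induct) auto

lemma nth_cap: "i < length xs \<Longrightarrow> cap p k xs ! i = (if i \<le> p then min k (xs ! i) else xs ! i)"
  by (induction p k xs arbitrary: i rule: cap.induct) (auto simp: nth_Cons' min_def)

lemma nth_lift_from: "i < length xs \<Longrightarrow> lift_from p k xs ! i = (if p \<le> i then max k (xs ! i) else xs ! i)"
  by (induction p k xs arbitrary: i rule: lift_from.induct) (auto simp: nth_Cons' max_def)

lemma length_suffix_sums [simp]: "length (suffix_sums ds) = length ds"
  by (induction ds) auto

lemma nth_suffix_sums: "i < length ds \<Longrightarrow> suffix_sums ds ! i = sum_list (drop i ds)"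
  by (induction ds arbitrary: i) (auto simp: nth_Cons' drop_Cons')

text \<open>Summation by parts: the weight of \<open>v\<close> is the sum of the differences from
  position \<open>v - a\<close> on, and these are the positions whose cumulative count includes
  \<open>v\<close>.\<close>

lemma dot_cnt:
  assumes "\<forall>v\<in>#V. a \<le> v \<and> v < a + length ds"
  shows "(\<Sum>v\<in>#V. suffix_sums ds ! (v - a)) = (\<Sum>i<length ds. ds ! i * cnt V (a + i))"
  using assms
proof (induction V)
  case empty
  then show ?case
    by (simp add: cnt_def)
next
  case (add v V)
  have v: "a \<le> v" "v - a < length ds"
    using add.prems by auto
  have "(\<Sum>i<length ds. ds ! i * cnt (add_mset v V) (a + i)) =
    (\<Sum>i<length ds. ds ! i * cnt V (a + i) + (if v - a \<le> i then ds ! i else 0))"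
    using v by (intro sum.cong) (auto simp: cnt_def algebra_simps)
  also have "\<dots> = (\<Sum>i<length ds. ds ! i * cnt V (a + i)) + (\<Sum>i<length ds. if v - a \<le> i then ds ! i else 0)"
    by (rule sum.distrib)
  also have "(\<Sum>i<length ds. if v - a \<le> i then ds ! i else 0) = (\<Sum>i\<in>{v - a..<length ds}. ds ! i)"
    by (rule sum.mono_neutral_cong_right) auto
  also have "\<dots> = sum_list (drop (v - a) ds)"
    using v by (simp add: sum_list_sum_nth sum.atLeastLessThan_shift_0[of _ "v - a"])
  finally show ?case
    using add v by (simp add: nth_suffix_sums)
qed

lemma dot_mono:
  assumes "\<And>i. i < length u \<Longrightarrow> f i \<le> u ! i" "length u = length ds"
  shows "(\<Sum>i<length ds. ds ! i * f i) \<le> dot ds u"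
  using assms
proof (induction ds u arbitrary: f rule: dot.induct)
  case (1 x xs y ys)
  have 2: "(\<Sum>i<length xs. xs ! i * f (Suc i)) \<le> dot xs ys"
    using 1(2)[of "Suc _"] 1(3) by (intro 1(1)) auto
  have "x * f 0 \<le> x * y"
    using 1(2)[of 0] by simp
  from add_mono[OF this 2] show ?case
    by (simp add: sum.lessThan_Suc_shift del: sum.lessThan_Suc)
qed auto

text \<open>Weights do not increase with the period, so the first position with upper bound at least
  \<open>k\<close> carries the largest weight among all such positions.\<close>

lemma bonus_ge:
  assumes "j < length u" "length ws = length u" "k \<le> u ! j" "\<And>i i'. i \<le> i' \<Longrightarrow> i' < length ws \<Longrightarrow> ws ! i' \<le> ws ! i"
  shows "ws ! j \<le> bonus ws u k"
  using assms
proof (induction ws u k arbitrary: j rule: bonus.induct)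
  case (1 w ws x xs k)
  show ?case
  proof (cases "k \<le> x")
    case True
    then show ?thesis
      using 1(5)[of 0 j] 1(2,3) by simp
  next
    case False
    then obtain j' where j: "j = Suc j'"
      using 1(4) by (cases j) auto
    have "ws ! j' \<le> bonus ws xs k"
    proof (rule 1(1)[OF False])
      show "ws ! i' \<le> ws ! i" if "i \<le> i'" "i' < length ws" for i i'
        using 1(5)[of "Suc i" "Suc i'"] that by simp
    qed (use 1 j in auto)
    then show ?thesis
      using j False by simp
  qed
qed auto

lemma light_solved:
  assumes "wf_cfg cf" "light cf l u" "length l = length (fst (snd cf))" "length u = length l"
  shows "solved cf l u"
  unfolding solved_def
proof (intro allI impI)
  fix V
  assume V: "heavy cf V" "in_box (fst cf) l u V"
  obtain a ds ws m where cf: "cf = (a, ds, ws, m)"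
    by (cases cf)
  have ws: "ws = suffix_sums ds"
    using assms(1) cf by simp
  have len: "length l = length ds" "length u = length ds"
    using assms(3,4) cf by auto
  have V': "V \<noteq> {#}" "\<forall>v\<in>#V. a \<le> v \<and> v < a + length ds"
    using V(1) cf by auto
  have dot: "(\<Sum>v\<in>#V. ws ! (v - a)) \<le> dot ds u"
    unfolding ws dot_cnt[OF V'(2)] using V(2) cf len by (intro dot_mono) (auto simp: in_box_def)
  define M where "M = Max_mset V"
  have MV: "M \<in># V"
    using V'(1) unfolding M_def by simp
  then have M: "a \<le> M" "M - a < length ds"
    using V'(2) by fastforce+
  have "ds \<noteq> []"
    using M by auto
  have all: "cnt V c = size V" if "M \<le> c" for c
  proof -
    have "filter_mset (\<lambda>v. v \<le> c) V = V"
      using that V'(1) by (intro filter_mset_eq_conv[THEN iffD2]) (auto simp: M_def)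
    then show ?thesis
      by (simp add: cnt_def)
  qed
  \<comment> \<open>From the largest period \<open>M\<close> on, the count is the size of
    \<open>V\<close>. This size is at least \<open>last l\<close> and at most the entry of
    \<open>u\<close> at \<open>M\<close>, so \<open>M\<close> is one of the positions considered by
    \<open>bonus\<close>.\<close>
  have "last l = l ! (length ds - 1)"
    using len \<open>ds \<noteq> []\<close> by (metis last_conv_nth length_0_conv)
  also have "\<dots> \<le> cnt V (a + (length ds - 1))"
    using V(2) len \<open>ds \<noteq> []\<close> cf by (auto simp: in_box_def)
  also have "\<dots> = cnt V (a + (M - a))"
    using M by (simp add: all)
  also have "\<dots> \<le> u ! (M - a)"
    using V(2) len M cf by (auto simp: in_box_def)
  finally have "ws ! (M - a) \<le> bonus ws u (last l)"
  proof (rule bonus_ge[rotated 2])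
    show "ws ! i' \<le> ws ! i" if "i \<le> i'" "i' < length ws" for i i'
    proof -
      have "drop i' ds = drop (i' - i) (drop i ds)"
        using that by simp
      then have "sum_list (drop i' ds) \<le> sum_list (drop i ds)"
        by (metis append_take_drop_id le_add2 sum_list_append)
      then show ?thesis
        using that by (simp add: ws nth_suffix_sums)
    qed
  qed (use M len ws in auto)
  then have "min m (ws ! (M - a)) \<le> min m (bonus ws u (last l))"
    by simp
  \<comment> \<open>The upper bound contradicts heaviness: a light box has no heavy member.\<close>
  then show "sched V"
    using dot V(1) assms(2) cf by (simp add: M_def Let_def min_def split: if_splits)
qed

lemma entry_eq: "entry l n = (if n < length l then l ! n else 0)"
  by (induction l n rule: entry.induct) (auto simp: nth_Cons')

lemma dominated_nth:
  "dominated i ps a l \<Longrightarrow> j < length ps \<Longrightarrow> a \<le> ps ! j \<and> ps ! j - a < length l \<and> i + j < l ! (ps ! j - a)"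
proof (induction i ps a l arbitrary: j rule: dominated.induct)
  case (2 i p ps a l)
  then show ?case
    by (cases j) (auto simp: entry_eq split: if_splits)
qed simp

text \<open>The count at \<open>fst cf + p\<close> is either below \<open>k\<close> or not, and
  monotonicity spreads the bound. For \<open>k = 0\<close> the first case cannot occur, so the
  truncated \<open>k - 1\<close> is harmless.\<close>

lemma split_solved:
  assumes "solved cf l (cap p (k - 1) u)" "solved cf (lift_from p k l) u"
  shows "solved cf l u"
  unfolding solved_def
proof (intro allI impI)
  fix V
  assume V: "heavy cf V" "in_box (fst cf) l u V"
  show "sched V"
  proof (cases "cnt V (fst cf + p) < k")
    case True
    have "cnt V (fst cf + i) \<le> k - 1" if "i \<le> p" for i
      using True cnt_mono[of "fst cf + i" "fst cf + p" V] that by linarith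
    then have "in_box (fst cf) l (cap p (k - 1) u) V"
      using V(2) by (auto simp: in_box_def nth_cap)
    then show ?thesis
      using assms(1) V(1) by (simp add: solved_def)
  next
    case False
    have "k \<le> cnt V (fst cf + i)" if "p \<le> i" for i
      using False cnt_mono[of "fst cf + p" "fst cf + i" V] that by linarith
    then have "in_box (fst cf) (lift_from p k l) u V"
      using V(2) by (auto simp: in_box_def nth_lift_from)
    then show ?thesis
      using assms(2) V(1) by (simp add: solved_def)
  qed
qed

lemma check_solved:
  assumes "wf_cfg cf" "check cf t l u" "length l = length (fst (snd cf))" "length u = length l"
  shows "solved cf l u"
  using assms
proof (induction cf t l u rule: check.induct)
  case (1 cf l u)
  then show ?case
    using light_solved by simp
next
  case (2 cf p l u)
  \<comment> \<open>The lower corner alone guarantees enough short periods for the word, uniformly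
    over the box.\<close>
  have "sched V" if "in_box (fst cf) l u V" for V
  proof (rule sched_cnt)
    show "lsched (map period p)"
      using 2 by (simp add: valid_def)
    show "i < cnt V (map period p ! i)" if "i < length (map period p)" for i
      using dominated_nth[of 0 "map period p" "fst cf" l i] that 2 \<open>in_box (fst cf) l u V\<close>
      unfolding in_box_def by (metis add_0 check.simps(2) le_add_diff_inverse less_le_trans)
  qed
  then show ?case
    by (simp add: solved_def)
next
  case (4 cf p k s t l u)
  then show ?case
    by (intro split_solved[of cf l p k u]) auto
next
  case (7 cf p k w t l u)
  then have "solved cf l (cap (index p) (index k) u)"
    by (intro light_solved) auto
  moreover have "solved cf (lift_from (index p) (period k) l) u"
    using 7 by auto
  \<comment> \<open>Identifies a link of a chain with a split at \<open>period k\<close>.\<close>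
  moreover have "index k = period k - 1"
    by (simp add: index_def period_def)
  ultimately show ?case
    using split_solved[of cf l "index p" "period k" u] by simp
qed simp_all

lemma in_box_Nil: "in_box a [] [] V"
  by (simp add: in_box_def)

lemma in_box_Cons:
  "in_box a (x # l) (y # u) V \<longleftrightarrow> x \<le> cnt V a \<and> cnt V a \<le> y \<and> in_box (Suc a) l u V"
  unfolding in_box_def by (auto simp: All_less_Suc2)

lemma cnt_image_real:
  "cnt (image_mset f R) c = size (filter_mset (\<lambda>r. f r \<le> c) R)"
  by (simp add: cnt_def filter_mset_image_mset)

text \<open>The bridge from an instance to the search. Merging \<open>A\<close> down to
  \<open>\<theta>\<close> and rounding up gives \<open>V\<close>; the assumptions on
  \<open>ws\<close> and \<open>m\<close> say that they are, in millionths, upper bounds for the true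
  reciprocals and for \<open>2 / \<theta>\<close>, so \<open>V\<close> is heavy. The box is only
  required to contain those \<open>V\<close> that are unschedulable and agree with \<open>A\<close>
  up to \<open>\<theta> / 2\<close>.\<close>

lemma sched_of_solved:
  fixes \<theta> :: nat
  assumes cf: "cf = (lo, ds, ws, m)" "wf_cfg cf" "solved cf l u"
    and bounds: "lo + length ds = \<theta> + 1" "2 * lo \<le> \<theta> + 2" "2 \<le> lo"
    and ws: "list_all (\<lambda>v. 1000000 \<le> ws ! (v - lo) * (if 2 * v \<le> \<theta> then v else v - 1)) [lo..<\<theta> + 1]"
    and m: "2000000 \<le> m * \<theta>"
    and A: "\<forall>a\<in>#A. lo \<le> a" "1.264 \<le> ndens A"
    and box: "\<And>V. (\<And>c. 2 * c \<le> \<theta> \<Longrightarrow> cnt V c = cnt A c) \<Longrightarrow> \<not> sched V \<Longrightarrow> in_box lo l u V"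
  shows "sched A"
proof -
  define R where "R = image_mset real A"
  have R: "\<forall>r\<in>#R. 0 < r" "1.264 \<le> rdens R"
    using A bounds(3) by (fastforce simp: R_def rdens_def ndens_def image_mset.compositionality comp_def)+
  have th: "2 \<le> \<theta>"
    using bounds by simp
  have weights: "1000000 \<le> ws ! (v - lo) * (if 2 * v \<le> \<theta> then v else v - 1)" if "lo \<le> v" "v \<le> \<theta>" for v
    using ws that unfolding list_all_iff by (elim ballE[of _ _ v]) auto
  have th': "0 < real \<theta>" "2 / real \<theta> < 1.264"
    using th by (auto simp: field_simps)
  obtain R' where R': "rsched R' \<Longrightarrow> rsched R" "\<forall>r\<in>#R'. 0 < r \<and> r \<le> real \<theta>" "R' \<noteq> {#}"
    "filter_mset (\<lambda>r. r \<le> real \<theta> / 2) R' = filter_mset (\<lambda>r. r \<le> real \<theta> / 2) R"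
    "1.264 \<le> rdens R' + min (1 / Max_mset R') (2 / real \<theta>)"
    using fold_down[OF th' R] by blast
  let ?f = "\<lambda>r. nat \<lceil>r\<rceil>"
  define V where "V = image_mset ?f R'"
  \<comment> \<open>Merging has not touched these members, so they are still integer periods of
    \<open>A\<close>, and their weights need not allow for rounding.\<close>
  have small: "\<exists>a. r = real a \<and> lo \<le> a" if "r \<in># R'" "r \<le> real \<theta> / 2" for r
  proof -
    have "r \<in># filter_mset (\<lambda>r. r \<le> real \<theta> / 2) R"
      using that R'(4) by (metis filter_mset_eq_conv mset_subset_eqD set_mset_filter mem_Collect_eq)
    then show ?thesis
      using A(1) by (auto simp: R_def)
  qed
  have wt: "lo \<le> ?f r \<and> ?f r \<le> \<theta> \<and> 1 / r \<le> real (ws ! (?f r - lo)) / 1000000" if r: "r \<in># R'" for r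
  proof (cases "r \<le> real \<theta> / 2")
    case True
    then obtain a where a: "r = real a" "lo \<le> a"
      using small[OF r] by blast
    have "2 * a \<le> \<theta>"
      using True a(1) by linarith
    then have "1000000 \<le> ws ! (a - lo) * a"
      using weights[OF a(2)] by simp
    then have "1000000 \<le> real (ws ! (a - lo)) * real a"
      by (metis of_nat_le_iff of_nat_mult of_nat_numeral)
    moreover have "0 < real a"
      using a(2) bounds(3) by simp
    ultimately show ?thesis
      using a \<open>2 * a \<le> \<theta>\<close> by (simp add: field_simps)
  next
    case False
    define v where "v = ?f r"
    have r': "0 < r" "r \<le> real \<theta>"
      using R'(2) r by auto
    have v: "real v - 1 < r" "r \<le> real v" "v \<le> \<theta>"
      using r' unfolding v_def by linarith+
    \<comment> \<open>By \<open>2 * lo \<le> \<theta> + 2\<close> we have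
      \<open>\<theta> / 2 \<ge> lo - 1\<close>, so an integer above \<open>\<theta> / 2\<close> is
      at least \<open>lo\<close>.\<close>
    have "lo \<le> v" "\<not> 2 * v \<le> \<theta>"
      using False v(2) bounds(2) by linarith+
    then have "1000000 \<le> ws ! (v - lo) * (v - 1)"
      using weights[of v] v(3) by simp
    then have "1000000 \<le> real (ws ! (v - lo)) * real (v - 1)"
      by (metis of_nat_le_iff of_nat_mult of_nat_numeral)
    also have "\<dots> \<le> real (ws ! (v - lo)) * r"
      using v(1) \<open>lo \<le> v\<close> bounds(3) by (intro mult_left_mono) (auto simp: of_nat_diff)
    finally have "1 / r \<le> real (ws ! (v - lo)) / 1000000"
      using r'(1) by (simp add: field_simps)
    then show ?thesis
      using \<open>lo \<le> v\<close> v(3) by (simp add: v_def)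
  qed
  have "sched V"
  proof (rule ccontr)
    \<comment> \<open>Unschedulability of \<open>V\<close> itself is what makes the upper bounds of
      the box available.\<close>
    assume ns: "\<not> sched V"
    have "cnt V c = cnt A c" if c: "2 * c \<le> \<theta>" for c
    proof -
      have iff: "?f r \<le> c \<longleftrightarrow> r \<le> real c" for r
        by linarith
      have *: "filter_mset (\<lambda>r. r \<le> real c) Q = filter_mset (\<lambda>r. r \<le> real c) (filter_mset (\<lambda>r. r \<le> real \<theta> / 2) Q)" for Q
      proof -
        have "r \<le> real \<theta> / 2" if "r \<le> real c" for r
          using that c by linarith
        then show ?thesis
          by (simp add: filter_filter_mset) (metis (mono_tags, lifting) filter_mset_cong)
      qed
      have "cnt V c = size (filter_mset (\<lambda>r. r \<le> real c) R')"
        unfolding V_def cnt_image_real iff ..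
      also have "\<dots> = size (filter_mset (\<lambda>r. r \<le> real c) R)"
        using *[of R'] *[of R] R'(4) by simp
      also have "\<dots> = cnt A c"
        by (simp add: R_def cnt_def filter_mset_image_mset)
      finally show ?thesis .
    qed
    then have ib: "in_box lo l u V"
      using box ns by blast
    have ne: "V \<noteq> {#}"
      using R'(3) by (simp add: V_def)
    define M where "M = Max_mset R'"
    have M: "M \<in># R'"
      using R'(3) unfolding M_def by simp
    have MV: "Max_mset V = ?f M"
    proof (rule Max_eqI)
      show "y \<le> ?f M" if "y \<in> set_mset V" for y
        using that unfolding V_def M_def by (auto intro!: nat_mono ceiling_mono)
      show "?f M \<in> set_mset V"
        using M by (simp add: V_def)
    qed simp
    \<comment> \<open>The maximum of \<open>V\<close> is the rounded maximum of \<open>R'\<close>.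
      Hence its reciprocal is covered by the weight at that position and the cap
      \<open>2 / \<theta>\<close> by \<open>m\<close>, as in \<open>heavy\<close>.\<close>
    have "min (1 / M) (2 / real \<theta>) \<le> real (min m (ws ! (?f M - lo))) / 1000000"
    proof -
      have "2000000 \<le> real m * real \<theta>"
        using m by (metis of_nat_le_iff of_nat_mult of_nat_numeral)
      then have "2 / real \<theta> \<le> real m / 1000000"
        using th'(1) by (simp add: field_simps)
      then show ?thesis
        using wt[OF M] by (simp add: min_def)
    qed
    moreover have "rdens R' \<le> (\<Sum>r\<in>#R'. real (ws ! (?f r - lo)) / 1000000)"
      unfolding rdens_def by (rule sum_mset_mono) (use wt in blast)
    moreover have "(\<Sum>r\<in>#R'. real (ws ! (?f r - lo)) / 1000000) = real (\<Sum>v\<in>#V. ws ! (v - lo)) / 1000000"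
    proof -
      have eq: "real (\<Sum>r\<in>#Q. ws ! (?f r - lo)) / 1000000 = (\<Sum>r\<in>#Q. real (ws ! (?f r - lo)) / 1000000)" for Q
        by (induction Q) (simp_all add: add_divide_distrib)
      show ?thesis
        unfolding V_def image_mset.compositionality comp_def by (rule eq[symmetric])
    qed
    ultimately have "1.264 \<le> real (\<Sum>v\<in>#V. ws ! (v - lo)) / 1000000 + real (min m (ws ! (Max_mset V - lo))) / 1000000"
      using R'(5)[folded M_def] unfolding MV by linarith
    then have "real 1264000 \<le> real ((\<Sum>v\<in>#V. ws ! (v - lo)) + min m (ws ! (Max_mset V - lo)))"
      by simp
    then have "1264000 \<le> (\<Sum>v\<in>#V. ws ! (v - lo)) + min m (ws ! (Max_mset V - lo))"
      by (simp only: of_nat_le_iff)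
    moreover have "\<forall>v\<in>#V. lo \<le> v \<and> v < lo + length ds"
    proof
      fix v assume "v \<in># V"
      then obtain r where "r \<in># R'" "v = ?f r"
        by (auto simp: V_def)
      then show "lo \<le> v \<and> v < lo + length ds"
        using wt[of r] bounds(1) by linarith
    qed
    ultimately have "heavy cf V"
      using ne by (simp add: cf(1))
    then show False
      using cf(1,3) ib ns by (simp add: solved_def)
  qed
  then have "rsched R"
    using R'(1) by (simp add: rsched_def V_def)
  then show ?thesis
    by (simp add: rsched_def R_def image_mset.compositionality comp_def)
qed

section \<open>The search trees\<close>

text \<open>Unary values serve the word simulation, which recurses over \<open>Suc\<close>. They are
  not default simplification rules: the trees compute with the numerals given by
  \<open>period_numeral\<close> and \<open>index_numeral\<close>.\<close>

lemma period_unary: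
  "period CHR ''c'' = Suc (Suc (Suc 0))"
  "period CHR ''d'' = Suc (Suc (Suc (Suc 0)))"
  "period CHR ''e'' = Suc (Suc (Suc (Suc (Suc 0))))"
  "period CHR ''f'' = Suc (Suc (Suc (Suc (Suc (Suc 0)))))"
  "period CHR ''g'' = Suc (Suc (Suc (Suc (Suc (Suc (Suc 0))))))"
  "period CHR ''h'' = Suc (Suc (Suc (Suc (Suc (Suc (Suc (Suc 0)))))))"
  "period CHR ''i'' = Suc (Suc (Suc (Suc (Suc (Suc (Suc (Suc (Suc 0))))))))"
  "period CHR ''j'' = Suc (Suc (Suc (Suc (Suc (Suc (Suc (Suc (Suc (Suc 0)))))))))"
  "period CHR ''k'' = Suc (Suc (Suc (Suc (Suc (Suc (Suc (Suc (Suc (Suc (Suc 0))))))))))"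
  "period CHR ''l'' = Suc (Suc (Suc (Suc (Suc (Suc (Suc (Suc (Suc (Suc (Suc (Suc 0)))))))))))"
  "period CHR ''m'' = Suc (Suc (Suc (Suc (Suc (Suc (Suc (Suc (Suc (Suc (Suc (Suc (Suc 0))))))))))))"
  "period CHR ''n'' = Suc (Suc (Suc (Suc (Suc (Suc (Suc (Suc (Suc (Suc (Suc (Suc (Suc (Suc 0)))))))))))))"
  "period CHR ''o'' = Suc (Suc (Suc (Suc (Suc (Suc (Suc (Suc (Suc (Suc (Suc (Suc (Suc (Suc (Suc 0))))))))))))))"
  "period CHR ''p'' = Suc (Suc (Suc (Suc (Suc (Suc (Suc (Suc (Suc (Suc (Suc (Suc (Suc (Suc (Suc (Suc 0)))))))))))))))"
  "period CHR ''q'' = Suc (Suc (Suc (Suc (Suc (Suc (Suc (Suc (Suc (Suc (Suc (Suc (Suc (Suc (Suc (Suc (Suc 0))))))))))))))))"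
  "period CHR ''r'' = Suc (Suc (Suc (Suc (Suc (Suc (Suc (Suc (Suc (Suc (Suc (Suc (Suc (Suc (Suc (Suc (Suc (Suc 0)))))))))))))))))"
  "period CHR ''s'' = Suc (Suc (Suc (Suc (Suc (Suc (Suc (Suc (Suc (Suc (Suc (Suc (Suc (Suc (Suc (Suc (Suc (Suc (Suc 0))))))))))))))))))"
  "period CHR ''t'' = Suc (Suc (Suc (Suc (Suc (Suc (Suc (Suc (Suc (Suc (Suc (Suc (Suc (Suc (Suc (Suc (Suc (Suc (Suc (Suc 0)))))))))))))))))))"
  by (simp_all add: period_def)
lemma index_unary:
  "index CHR ''a'' = 0"
  "index CHR ''b'' = Suc 0"
  "index CHR ''c'' = Suc (Suc 0)"
  "index CHR ''d'' = Suc (Suc (Suc 0))"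
  "index CHR ''e'' = Suc (Suc (Suc (Suc 0)))"
  "index CHR ''f'' = Suc (Suc (Suc (Suc (Suc 0))))"
  "index CHR ''g'' = Suc (Suc (Suc (Suc (Suc (Suc 0)))))"
  "index CHR ''h'' = Suc (Suc (Suc (Suc (Suc (Suc (Suc 0))))))"
  "index CHR ''i'' = Suc (Suc (Suc (Suc (Suc (Suc (Suc (Suc 0)))))))"
  "index CHR ''j'' = Suc (Suc (Suc (Suc (Suc (Suc (Suc (Suc (Suc 0))))))))"
  "index CHR ''k'' = Suc (Suc (Suc (Suc (Suc (Suc (Suc (Suc (Suc (Suc 0)))))))))"
  "index CHR ''l'' = Suc (Suc (Suc (Suc (Suc (Suc (Suc (Suc (Suc (Suc (Suc 0))))))))))"
  "index CHR ''m'' = Suc (Suc (Suc (Suc (Suc (Suc (Suc (Suc (Suc (Suc (Suc (Suc 0)))))))))))"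
  "index CHR ''n'' = Suc (Suc (Suc (Suc (Suc (Suc (Suc (Suc (Suc (Suc (Suc (Suc (Suc 0))))))))))))"
  "index CHR ''o'' = Suc (Suc (Suc (Suc (Suc (Suc (Suc (Suc (Suc (Suc (Suc (Suc (Suc (Suc 0)))))))))))))"
  "index CHR ''p'' = Suc (Suc (Suc (Suc (Suc (Suc (Suc (Suc (Suc (Suc (Suc (Suc (Suc (Suc (Suc 0))))))))))))))"
  "index CHR ''q'' = Suc (Suc (Suc (Suc (Suc (Suc (Suc (Suc (Suc (Suc (Suc (Suc (Suc (Suc (Suc (Suc 0)))))))))))))))"
  "index CHR ''r'' = Suc (Suc (Suc (Suc (Suc (Suc (Suc (Suc (Suc (Suc (Suc (Suc (Suc (Suc (Suc (Suc (Suc 0))))))))))))))))"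
  "index CHR ''s'' = Suc (Suc (Suc (Suc (Suc (Suc (Suc (Suc (Suc (Suc (Suc (Suc (Suc (Suc (Suc (Suc (Suc (Suc 0)))))))))))))))))"
  "index CHR ''t'' = Suc (Suc (Suc (Suc (Suc (Suc (Suc (Suc (Suc (Suc (Suc (Suc (Suc (Suc (Suc (Suc (Suc (Suc (Suc 0))))))))))))))))))"
  by (simp_all add: index_def)
lemma period_numeral [simp]:
  "period CHR ''a'' = 1"
  "period CHR ''b'' = 2"
  "period CHR ''c'' = 3"
  "period CHR ''d'' = 4"
  "period CHR ''e'' = 5"
  "period CHR ''f'' = 6"
  "period CHR ''g'' = 7"
  "period CHR ''h'' = 8"
  "period CHR ''i'' = 9"
  "period CHR ''j'' = 10"
  "period CHR ''k'' = 11"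
  "period CHR ''l'' = 12"
  "period CHR ''m'' = 13"
  "period CHR ''n'' = 14"
  "period CHR ''o'' = 15"
  "period CHR ''p'' = 16"
  "period CHR ''q'' = 17"
  "period CHR ''r'' = 18"
  "period CHR ''s'' = 19"
  "period CHR ''t'' = 20"
  by (simp_all add: period_def)

lemma index_numeral [simp]:
  "index CHR ''a'' = 0"
  "index CHR ''b'' = 1"
  "index CHR ''c'' = 2"
  "index CHR ''d'' = 3"
  "index CHR ''e'' = 4"
  "index CHR ''f'' = 5"
  "index CHR ''g'' = 6"
  "index CHR ''h'' = 7"
  "index CHR ''i'' = 8"
  "index CHR ''j'' = 9"
  "index CHR ''k'' = 10"
  "index CHR ''l'' = 11"
  "index CHR ''m'' = 12"
  "index CHR ''n'' = 13"
  "index CHR ''o'' = 14"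
  "index CHR ''p'' = 15"
  "index CHR ''q'' = 16"
  "index CHR ''r'' = 17"
  "index CHR ''s'' = 18"
  "index CHR ''t'' = 19"
  by (simp_all add: index_def)

text \<open>A closed set of rewrite rules on constructors and unary numbers, enough to evaluate
  every certificate without arithmetic procedures.\<close>

lemmas cert_simps =
  list.pred_inject cert_ok.simps list.map append.simps run.simps ready.simps decs.simps pick.simps
  if_True if_False simp_thms(21) snd_conv list.distinct not_False_eq_True period_unary index_unary

text \<open>The weight of \<open>v\<close> is \<open>1000000 / v\<close>, rounded up, for \<open>2 * v \<le> \<theta>\<close>. Larger \<open>v\<close> may arise by rounding up a real
  period greater than \<open>v - 1\<close>, so they get the weight \<open>1000000 / (v - 1)\<close>, rounded up.\<close>

definition small_cfg :: cfg where
  "small_cfg = (3, [83334, 50000, 33333, 23809, 17858, 0, 13888, 11112, 9090, 7576, 6410, 5495, 4762, 66667],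
    [333334, 250000, 200000, 166667, 142858, 125000, 125000, 111112, 100000, 90910, 83334, 76924, 71429, 66667], 125000)"

text \<open>The configuration stays folded inside \<open>solved\<close>, where earlier lemmas have
  to match; its numbers are exposed only when \<open>light\<close> is evaluated.\<close>

lemma small_cfg_simps [simp]:
  "fst small_cfg = 3" "length (fst (snd small_cfg)) = 14" "wf_cfg small_cfg"
  "light small_cfg l u \<longleftrightarrow> light (3, [83334, 50000, 33333, 23809, 17858, 0, 13888, 11112, 9090, 7576, 6410, 5495, 4762, 66667],
    [333334, 250000, 200000, 166667, 142858, 125000, 125000, 111112, 100000, 90910, 83334, 76924, 71429, 66667], 125000) l u"
  by (simp_all add: small_cfg_def)

text \<open>The first pair shows how to read the tables: \<open>cddii\<close> means periods 3, 4, 4,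
  9, 9. In the cyclic word \<open>abcadbace\<close> of length 9 the task \<open>a\<close> runs on
  days 0, 3, 6, the tasks \<open>b\<close> and \<open>c\<close> run at gaps 4 and 5, and
  \<open>d\<close> and \<open>e\<close> run once.\<close>

lemma small_words_1: "list_all cert_ok [
    (''cddii'', ''abcadbace''), (''cddipp'', ''abcadbaceabcadbacf''), (''cdeepp'', ''bcadbaceabdacbadf''),
    (''cdegip'', ''abcadbaceabdacbafe''), (''cdejjpp'', ''dfabcaebacdabgacbaefabcadbaceabgac''),
    (''cdfhmpp'', ''bcafbadcabgaebacdabfacbadeabcagbadcabfaebacdabgacbade''), (''cdfmmmm'', ''bacdabeacbafg''),
    (''cdfmpppp'', ''bcaebafcabgadbachabeacbafdabcagbahcabeadbacfabgacbahd''), (''cdiiii'', ''abcadbaef''),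
    (''cdiiipp'', ''abcadbaefabcadbaeg''), (''cdiipppp'', ''abcadbaefabcadbagh''),
    (''cdikkkk'', ''abdaebafcabgadbaecabfagbadcabeafbagc''),
    (''cdimmmpp'', ''abcadbageabcafbahdabcaebagfabcadbaheabcafbagdabcaebahf''),
    (''cdjklllp'', ''aheabdafbacgabeadbafcabg''), (''cdkkkkpp'', ''acbadgabeafbachabdaebafgabcadbaehabf''),
    (''cdkkppppp'', ''eabcafbagdabhacbaieabdafbacgabhadbai''),
    (''cdmmmpppp'', ''bacfabdagbaheabcaibadfabgaebachabdaibafeabcagbadhabiae''), (''ceeegp'', ''bcadfabcaedabcade''),
    (''ceejjj'', ''badcabeacf''), (''ceggpppp'', ''cdaebafcabdaghab''), (''cegpppppp'', ''dcaebafgabcahiab''),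
    (''cejjjjj'', ''cdaebafgab''), (''cepppppppp'', ''cdaebafgabhaijab''), (''cffff'', ''abcade''),
    (''cfffll'', ''abcadeabcadf''), (''cfffppp'', ''abcadeabcadfabcadg''), (''cffiipp'', ''abdaceabfacdabeacg''),
    (''cffllll'', ''abcadeabcafg''), (''cffllppp'', ''abcadfabcaegabcadhabcaefabcadgabcaeh''),
    (''cffooooo'', ''abdaceabfacgabhacdabeacfabgach''), (''cffpppppp'', ''abcadeabcafgabcahi''),
    (''cfgglll'', ''abeacfabdagcabeadfabcagd''), (''cfghiip'', ''abdaceabfadcabeagf''),
    (''cfgklloo'', ''dabgaecabfahdabcaegabfacdabhaecabfadgabcaehabfac''), (''cfiiippp'', ''abcafdabeagcabdahe''),
    (''cfiillpp'', ''abcaedabgafcabdaehabcafdabgaecabdafh''), (''cfiippppp'', ''abeafcabdaghabcaid''),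
    (''cfijjkkp'', ''abcadfabeagcabdafhabcaegabdafcabeagh''), (''cfllllll'', ''abcadeabfagh''),
    (''cfllllppp'', ''abcadgabeafhabcadiabeafgabcadhabeafi'')]"
  by (simp only: cert_simps)

lemmas [simp] = certs_valid [OF small_words_1, simplified]

lemma small_words_2: "list_all cert_ok [
    (''cfllooooo'', ''abeacfabgadhabiaceabfadgabhaciabeadfabgachabiadeabfacgabhadi''),
    (''cfllpppppp'', ''abcaefabdaghabcaijabdaefabcaghabdaij''), (''cfmmmmmmm'', ''cadeabfaghabi''),
    (''cggggg'', ''bcadeaf''), (''cgggjjj'', ''beacdafbagcadeabfacdag''), (''cgggjkpp'', ''bacfadgabcaedafbachade''),
    (''cgggoooo'', ''abcadeafbacdagh''),
    (''cggkkkkn'', ''bdaceafbagcadhabeacfagbadcaehabfacgadbaecafhabgacdaebafcagh''),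
    (''cggkllppp'', ''ebagcafhabdaceaibafcadgabeachafbadcai''), (''cggoooooo'', ''abcadeafbacgahi''),
    (''cgjjjnnnn'', ''cfadgabeahcaibadfaegabcahdaibaefacgabdaheaib''), (''cgjkllllp'', ''aebacdafgabhaecadbafgaih''),
    (''cgjlnnnnpp'', ''ceaibadfagcabhaejadbacfaigabhadcaebajfagiabcadhaebafjacgabdahiaebacfagdabjah''),
    (''cgoooooooo'', ''abcadeafbaghaij''), (''chhhppppp'', ''ebafcagdabhaciad''),
    (''chhppppppp'', ''deafbagcahiabjac''), (''chppppppppp'', ''cadeafbaghaijabk''), (''ciiiiii'', ''abcadeafg''),
    (''ciiiimmm'', ''fabcagdaehabcafdaegabcahdae''), (''ciiiipppp'', ''abcadeafgabcadeahi''),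
    (''ciiillppp'', ''abeacgadfabhaceadiabfacgadeabhacfadi''), (''ciiipppppp'', ''abcadeafgabcadhaij''),
    (''ciilmmpppp'', ''abcadgaheabcafiadjabcaegahfabcadiajeabcafgadhabcaeiajf''),
    (''cijjjppppp'', ''acfadgaebahcaidajbaefacgadbaheaicajbadfaegacbahdaieajb''),
    (''cijjkkllp'', ''abeacgafdabhaecaigabfadhaecabgafdaih''),
    (''cillllpppp'', ''abcagdaheabfaicajdabeagfahcabdaieajf''),
    (''cimmmmmmpp'', ''abcadiaefabgahjacdabeafiaghabcadjaefabgahiacdabeafjagh''), (''cjjjjjjj'', ''bcadeafgah''),
    (''cjjjjjjpp'', ''abcadeafgahbacdaefagi''), (''cjjjjjnoo'', ''bahcadeaifabgacdaehafbaicadeagf''),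
    (''cjjjjooopp'', ''bacfaidaegabcahjadeafbacgaidaehabcafjadeagbaciahdaefabcagjadeah''),
    (''cjjkkkoopp'', ''dabeaifagcadbaejafhaciadbaegafcajh''), (''cjjoppppppp'', ''eafbaghadcaijabkaefacgahbadiajcak''),
    (''cllllllll'', ''abcadeafgahi''), (''cllllllppp'', ''abcadhaefagiabcadjaefaghabcadiaefagj''),
    (''cllllpppppp'', ''abcafgadeahiabcajkadeafgabcahiadeajk''), (''cmmmmmmmmm'', ''bcadeafgahiaj''),
    (''cmmmmmppppp'', ''bagcahdaieajfabkacgadhaeiafbajcakdageahfabiacjadkaegafbahcaidajeakf''),
    (''coooooooooo'', ''abcadeafgahiajk''), (''cppppppppppp'', ''bacdaefaghaijakl'')]"
  by (simp only: cert_simps)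

lemmas [simp] = certs_valid [OF small_words_2, simplified]

lemma small_words_3: "list_all cert_ok [
    (''dddhpp'', ''abcdabceabcdabcf''), (''dddpppp'', ''abcdabceabcfabcg''), (''ddffll'', ''acbdaebcadbf''),
    (''ddffppp'', ''acbdaebcadbfacbdagbcadbeacbdafbcadbg''), (''ddfllll'', ''acbdaebcafbg''),
    (''ddfllppp'', ''acbdafbcaebgacbdahbcaebfacbdagbcaebh''), (''ddhhhpp'', ''abcdabefabcdabeg''),
    (''ddhhlll'', ''abceabdfabcgabdeabcfabdg''), (''ddhhpppp'', ''abcdabefabcdabgh''),
    (''ddhpppppp'', ''abcdabefabcgabhi''), (''ddiiopppp'', ''fabcgabedabhcabifabdgabceabhdabi''),
    (''ddjjjjj'', ''acbdaebfagbcadbeafbg''), (''ddjjjjpp'', ''acbdaebfagbcadbeafbh''),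
    (''ddllllll'', ''abcdabefabgh''), (''ddlllpppp'', ''abcfabdgabehabciabdfabegabchabdiabefabcgabdhabei''),
    (''ddpppppppp'', ''abcdabefabghabij''), (''deeffl'', ''adbcaefdabce''), (''deegpppp'', ''abcdaebcafdbacgh''),
    (''deekkkpp'', ''abcdaebcafgbacdhabceafbcadgbacehabcfadbcaegbacfh''), (''deepppppp'', ''bcadebacfgabchai''),
    (''defiijlp'', ''adbeachbafdcabegacbfadhbacegabfc''), (''degghhp'', ''abcdaebfacdbaegf''),
    (''degghppp'', ''abcdaebfacdbaegh''), (''degijkkk'', ''bcfaedbacghabfeacbdagh''),
    (''degjllmop'', ''acgbadehabcfaibdacebaghfabcdaibeacgbadfhabceaibdacfbagheabcdaibf''),
    (''dehhjjpp'', ''abceadbgafcbadehabcfadbgaecbadfh''), (''dehhppppp'', ''beafcbadghabciad''),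
    (''dehjjjjp'', ''abcdaebfagcbadheabcfagbdaecbafhg''), (''dejjjjppp'', ''acgbadehabfcaibdaegbafchabdeaibf''),
    (''dejjjkkpp'', ''afhbacdiabegafbcadhbaegiabcdafbeaghbacdiabefagbcadhbaefiabcdagbe''),
    (''dejjpppppp'', ''bcaefbadghabciajbdaefbacghabdiaj''),
    (''dekkkkkkp'', ''abcdaebfaghbacdiabefagbhacdbaefiabghacbdaefbaghi''),
    (''demmmmmppp'', ''bcahdbaeifabgjacbdahebafigabcjadbeahfbagicabdjaebfahgbacidabejafbgahcbadieabfjag''),
    (''deppppppppp'', ''acbdaefbaghiabjk''), (''dfffhpp'', ''abecadfbacedabgcadebacfdabecadgbacedabfcadebacgd''),
    (''dffflll'', ''abecadfbacgd''), (''dfffpppp'', ''abecadfbacgdabhcadebacfdabgcadhbacedabfcadgbachd''),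
    (''dffhhll'', ''abdcafebacdgabecafdbaceg''), (''dffhllpp'', ''abdcaegbacdfabhcaedbacgfabdcaehbacdfabgcaedbachf''),
    (''dfflllll'', ''adebacfgabhc'')]"
  by (simp only: cert_simps)

lemmas [simp] = certs_valid [OF small_words_3, simplified]

lemma small_words_4: "list_all cert_ok [
    (''dffllpppp'', ''abfcadgbacheabicadfbacgeabhcadibacfeabgcadhbacie''),
    (''dffnnopppp'', ''gbafdcabheacibajgcabdfachbaeicabjgacfbadhcabeiacj''),
    (''dfgkmmmppp'', ''acdbaehfabcgadibacejabfhacdbagieabcfadjbacghabeiacdbafjgabceadhbacfiabgj''),
    (''dfhhllll'', ''abceafdbagchabdeafcbagdh''),
    (''dfhhllppp'', ''abceagdbafchabdeaicbafdgabceahdbafciabdeagcbafdhabceaidbafcgabdeahcbafdi''),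
    (''dfhllllpp'', ''abcdaehbafcgabidaecbafhgabcdaeibafcgabhdaecbafig''),
    (''dfiiiill'', ''bacgdabefahcbadgeabfcahdbaegfabcdahebafgcabdeahf''), (''dfiiiippp'', ''bcgadebafhcabdeaif''),
    (''dfiiillnn'', ''chadfbaegcabdiahebacfdabgeai''),
    (''dfiijkkkp'', ''bafgcabidaehbacfgabdeahcbafgdabecahibadfgabceahd''),
    (''dfimnoopppp'', ''hcaijbaefdabcgakhbaijcabdeafgbackhabidajcbaefgabkcadhbaijeabcfagdbak''),
    (''dflllllll'', ''abcdaefbaghi''), (''dfllllpppp'', ''abgcadhbaeifabjcadgbaehfabicadjbaegfabhcadibaejf''),
    (''dflllnnnnn'', ''bafcgabdhaiebajcfabdgahebaicjabdfagebahciabdjafebagchabdiaje''),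
    (''dfmmmmmmmm'', ''cbadefabghaij''), (''dgiiiklll'', ''bcagdfabehacidabgeafchabdiaegcabfdahei''),
    (''dhhhhhpp'', ''abcdaefgabcdaefh''), (''dhhhhlll'', ''abcfadegabchadefabcgadeh''),
    (''dhhhhpppp'', ''abcdaefgabcdaehi''), (''dhhhlllpp'', ''abceadhfabcgadieabcfadhgabceadifabcgadheabcfadig''),
    (''dhhhpppppp'', ''abcdaefgabcdahij''), (''dhhjjjjj'', ''adbeafcgahbdaecfagbhadceafbgahcdaebfagch''),
    (''dhhjjppppp'', ''abcfadghabceaijdabcfaeghabcdaije''), (''dhhllllll'', ''abdeacfgabhiacdeabfgachi''),
    (''dhhlllpppp'', ''abcdagheabcfaijdabceaghfabcdaijeabcfaghdabceaijf''), (''dhhpppppppp'', ''abcdaefgabchaijk''),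
    (''dhiiippppp'', ''cafdgaebhacidajbeafcgadbhaeicajbdafegacbhadieajb''),
    (''dhikkllnno'', ''ahbdaejcafbgaidhacbeafjgadbcaiehafbgacdjaebiafcg''),
    (''dhjjjjjpp'', ''acbdaehfagbcadieafbgachdaebfagicadbeafhgacbdaeifagbcadheafbgacidaebfaghcadbeafig''),
    (''dhjjppppppp'', ''abefacghabdiajkcabefadghabciajkd''),
    (''dhllllllpp'', ''abcdaiefabghajcdabefaighabcdajefabghaicdabefajgh''),
    (''dhlllpppppp'', ''abcfagdhabeiajckabdfagehabciajdkabefagchabdiajek''),
    (''dhmmmmmpppp'', ''hcabdiaejfabgkachdabeiafjgabckadheabfiagjcabdkaehfabgiacjdabekafhgabciadjeabfkag''),
    (''dhpppppppppp'', ''abcdaefgabhiajkl''), (''diiiiiii'', ''bcadefagh''),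
    (''diiiiimmn'', ''agbcaideafhbacgdaefiabchadef''), (''diiiijjjp'', ''afbcagdeahifabcgadeh''),
    (''diiiijjmm'', ''afbcahdeagibacfdaehgabciadefagbcahdeafibacgdaehfabciadeg''),
    (''diiikklnop'', ''aebjagcdahfbaeicagdjabfhacedagbiafcjadebaghcafdi''),
    (''diiimmmmnn'', ''bcaefdaigbachjadefabciagdhaj'')]"
  by (simp only: cert_simps)

lemmas [simp] = certs_valid [OF small_words_4, simplified]

lemma small_words_5: "list_all cert_ok [
    (''diiimnnpppp'', ''bachfadieabcgajdkafbcaehdagibacjfadekabcgahdiafbcaejdagk''),
    (''diikkkklnn'', ''adbiahceafgbajdcaheiabfgacdjahbeafcgaidbahecafgj''),
    (''diikkllllp'', ''bfjagcdahbiaefcagdbahjiacefabgdahciae''),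
    (''diimmmmmnpp'', ''djaebiafckaghbadecaifjabghacdeakbiafcgajhbadecaifkabghac''),
    (''diimmmnnnnn'', ''gahbdaefcaijbakghacedabfiajck''), (''dijjmnnnnoo'', ''fcadjkaebgachdaifbajkcadegabhi''),
    (''djjjjjlll'', ''abgcadheafibacgdaehfabicadgeafhbacidaegfabhcadieafgbachdaeif''),
    (''djjjjjpppp'', ''abgcadheafibacjdaegfabhcadieafjbacgdaehfabicadjeafgbachdaeifabjcadgeafhbacidaejf''),
    (''djjjjlllpp'', ''abfcadgeaihbacfdaegjabhcadfeaigbachdaefjabgcadheaifbacgdaehj''),
    (''djjjjpppppp'', ''abfcadgeahibacjdaefkabgcadieahjbacfdaegkabicadjeahfbacgdaeikabjcadfeahgbacidaejk''),
    (''djjkllnnnpp'', ''bagecadhjabfiacegadkbahfcaiejabdgacfhakebadicagfjabehacdkaif''),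
    (''djjmmmmmmmp'', ''dbaefcaghiabjdacefakgbahicajdeabfgachiakj''),
    (''djjnoopppppp'', ''aghbaefdacijabklaghcafebadijackl''), (''dlllllllll'', ''abcdaefgahij''),
    (''dllllllpppp'', ''abchadeiafgjabckadehafgiabcjadekafghabciadejafgk''),
    (''dlllpppppppp'', ''abefacghadijabklacefadghabijackladefabghacijadkl''),
    (''dlmnnnnnnnpp'', ''kdaelfagbhaicjadkeafbgahlcaijdaebfagkhacliajbdaefgahckaibjadleafgcahbiaj''),
    (''dmmmmmmmmmm'', ''bcadefaghiajk''), (''dpppppppppppp'', ''abcdaefgahijaklm''),
    (''eeeejpp'', ''abcdeabcdfabcdeabcdg''), (''eeeepppp'', ''eabcdfabcdgabcdh''),
    (''eeefiio'', ''abcdeabcfdabcegabcdfabcedabcfg''), (''eeeggg'', ''abdceabfcdabecf''),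
    (''eeegppppp'', ''edabcfgabcdhabci''), (''eeejjjj'', ''abcdeabcfg''), (''eeejjjpp'', ''abcdeabcfgabcdeabcfh''),
    (''eeejjooo'', ''abcdfabcegabcdhabcefabcdgabceh''),
    (''eeejooopp'', ''abcdeabchfabcdgabcieabcdfabchgabcdeabcifabcdgabcheabcdfabcig''),
    (''eeelllll'', ''dabecfabgchabdceabfcgabhc''), (''eeeppppppp'', ''deabcfgabchiabcj''),
    (''eeffllmm'', ''aecfbdagcbhadebcafdbgachbd''), (''eefgggo'', ''adgbeacfbdaecbf''),
    (''eefiijjp'', ''abcdeabfcgabdecabfhg''), (''eefjjjppp'', ''abdceabgfcabdheabcfi''),
    (''eefjllllp'', ''abcdeabfcgabhdcabeifabcdgabhceabfdcabgih''), (''eeggjjoo'', ''cabgedabcfhabdecabgfdabcehabdf''),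
    (''eeggjjppp'', ''acegbadfcbhaedbcafibd''),
    (''eeggjnopp'', ''cabdhfabcedabgicabdefabchdabgecabdfiabcedabghcabdefabcidabge''),
    (''eeggooooo'', ''abefcabdghabcid''), (''eeghhhpp'', ''dagcbeafdbcahebf'')]"
  by (simp only: cert_simps)

lemmas [simp] = certs_valid [OF small_words_5, simplified]

lemma small_words_6: "list_all cert_ok [
    (''eeghpppppp'', ''eabcfdabghcabdij''),
    (''eegjjopppp'', ''dgabcehabidcabfejabcdgabhecabfdiabcejabgdcabfehabcdiabjecabf''),
    (''eegooooooo'', ''abdecabfghabcij''), (''eehhhpppp'', ''cfadbegacbhdaebi''),
    (''eehpppppppp'', ''dcabefgabchiabjk''), (''eejjjjjj'', ''abcdeabfgh''), (''eejjjjjpp'', ''abcdeabfghabcdeabfgi''),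
    (''eejjjjooo'', ''abcdgabefhabcdiabefgabcdhabefi''), (''eejjjllll'', ''abcdfabgehabcdiabfegabcdhabiefabcdgabhei''),
    (''eejjjllppp'', ''abchdabiefabcgdabjehabcfdabgeiabcjdabfeg''),
    (''eejjjooopp'', ''abcdfabeigabcdhabejfabcdgabeihabcdfabejgabcdhabeifabcdgabejh''),
    (''eejjoooooo'', ''abcefabdghabcijabdefabcghabdij''),
    (''eejjopppppp'', ''fcgabhedabicjabkfdabgchabeidabjckabfgdabhceabijdabk''),
    (''eejkkknnnp'', ''abcdgabehfabcidabjegabcfhabdieabcgfabjdhabceiabfgdabcheabjfi''),
    (''eekkkkkkk'', ''cdabefgabhi''), (''eekkkkkppp'', ''abhcdabiefabgjcabdheabfgiabcdjabefg''),
    (''eekkkpppppp'', ''fabgchabideabjkcabfgdabehiabcjkabde''),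
    (''eekllnnnppp'', ''fiabdgjabhceabfkdabgicabehjabdfkabcgeabhidabfcjabegkabdhcabfieabgjdabchkabe''),
    (''eeooooooooo'', ''abcdeabfghabijk''), (''eepppppppppp'', ''cabdefabghiabjkl''),
    (''effikkllp'', ''bcdgaebcfahdbcageibacdfhabcgeadbcfahi''),
    (''effjjmmmpp'', ''dbfiacgbeadchbajfceabdgcahbieacdbfagcjbaedchabficaebdgachbjaec''),
    (''efgggkppp'', ''cbfdaegbcadhebacfdiabecgadbfeachbdaei''),
    (''efggiimnp'', ''eciadbfhacebdagfcbadehiabcdfaebgcadhbfacedbagicfabdehacbfdag''),
    (''efggikkop'', ''cibeadfcbaghdeabcfiadbecaghbdacefbadg''),
    (''efggjnoppp'', ''egbachdfabeciadbjgacebdahfcbadeigabcdjafbecadhbgacidbaefcjabdhgacbedafibcadj''),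
    (''efggmnnnpp'', ''bcadfgbacideabhcjadbfgacebdaihcbadfgjabcdeahbicadfbgacedbajhciabdfgacbedahj''),
    (''efgjjkmnpp'', ''acdfiabgceahbdjacfbeagicbadhfeabcjgadbicaefbhacdgbaejcfabdhiacbegafdbcajheb''),
    (''efgkllnnnn'', ''gbcaehibacdfjabgceahbdiacfbjaegcbadhifabcejagbdcafhbiacejbadgcfabhieacbdjaf''),
    (''efglnnnnppp'', ''abceiafbjcadgbhackebaficdabgjhacbekadfbcagihbacjdeabfckagbhiacdbeajfcbaghkd''),
    (''efikkllllp'', ''bcadfgbaehciabdjfagbchaeibdafcgbaheji''), (''efjjjjjppp'', ''cbadhefabgciadbefajg''),
    (''efjjjjppppp'', ''cbdaghebafcidabjekaf''),
    (''efjjjllmoo'', ''fibcadgjbaehfcabdigaebjcafdbhaegibacdfjabehgacbdiafebjacgdbahe''),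
    (''efklmmmmmmp'', ''ekfbagchiabdjeafbcgahibdaj''), (''egggijjj'', ''abfecadgbhacfdeabgchadfbeacgdh''),
    (''eggiiioopp'', ''abcdeafibcagdehabcfjadebcagfihabcedafjbcagedhabcfiaedbcagfjh''),
    (''eggjjjjoo'', ''dabecfahgbdaceifabgcdahebfacgi''), (''eggjjjjopp'', ''abdceahfbgacdieabfcgahdbeacfjg''),
    (''eggjjooooo'', ''fabdcgahebiacdjfabecgahdbiacej'')]"
  by (simp only: cert_simps)

lemmas [simp] = certs_valid [OF small_words_6, simplified]

lemma small_words_7: "list_all cert_ok [
    (''eggkkkoooo'', ''abdcgaehbfacidjabecgafhbdaciejabfcgadhbeacifj''),
    (''eggkknooopp'', ''dabcefagjbcadhieabcfkagdbcaehijabcdfagebcakhi''),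
    (''eggkmmnnnop'', ''dabcgeahkbcadijfabcgeahdbcaifjkabcdgaehbcaifj''),
    (''egiiiijjo'', ''abcdgaefbhacdigabefhacdbgaefih''),
    (''egiijkkmno'', ''ebhacdfiabegjacdbfaheigabcdjafebhacdgiabefjacdbgaheifabcdjag''),
    (''egiikknnopp'', ''jbeacdgiabfhkacdbeajgfiabcdhaekbfacdgiabehjacdbfakgeiabcdhaf''),
    (''egiikmmnnnp'', ''afgbcadhieabjcfadgbkaechiabdjfacebgadhikabcejadfbgachieabdjk''),
    (''egijjjjlnp'', ''abdheacjbfagdieabchfagdbeacijfabdgeachbfaidgeabcjfahdbeacgif''),
    (''egijjjnnoo'', ''dabcieagfbdachjeabfidacgbeahfj''),
    (''egijjnooopp'', ''abcfdajgbeachidabfkeacgbdajhieabcfdakgbeachidabfjeacgbdakhie''),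
    (''egjjjkkkkp'', ''fjaghbcadeifabghcadebi''),
    (''egjjjnnoopp'', ''abfjcahdbeaigkcabdfeahjbcaidgeabfkcahdbeaigjcabdfeahkbcaidge''),
    (''egjjnnooooo'', ''bcaghidabefcajkbdaghicabfedajk''),
    (''egkkkkkkoo'', ''bcadiefabghjacdbeafighabcdjaefbgahicdabefjagh''),
    (''egkkkklmnnp'', ''cabdeiafgbhacjdeabfigakcbdaehfjabgciadebfahkj''),
    (''egkkkmnnnoo'', ''bcafjgdabhekacibfadjgeabchkaidbfaejcgabhdkaie''),
    (''egkmmnnnnoop'', ''abcfgadhbeajickabfgdahebcajlikabfgdachbeajilk''),
    (''egllllloooo'', ''hbcadijeabfgkachbdaeijfabgckadhbeafijgabcdkaehbfagijcabdekafhbgacijdabefkag''),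
    (''eglllnnnoppp'', ''cabjdfagkbeachilabdfjaegbcahkidablefacgbjadhikabecfalgbdahjieabcfkadgblaehi''),
    (''ehhhhppppp'', ''bacfgdaebhcaidje''), (''ehhhppppppp'', ''bacefgadbhcaijkd''),
    (''ehhjjkllpp'', ''bafidgacbehajfdcabgeiahcdbafjegacbdhaifecabgdjahce''),
    (''ehhjjpppppp'', ''bacfdgahbecaijdkabcefaghdbaciejakbdcafgehabcdiajke''),
    (''ehhppppppppp'', ''debcafghiabcjkal''),
    (''ehjjpppppppp'', ''baefcgahbdiajkclabedfaghcbaijdkalbceafgdhabicjakld''),
    (''ehppppppppppp'', ''cdeafgbhaijklabm''),
    (''eiijkkknnno'', ''abhekadcfiagbjeadchfabgikadcejafbghadcieabfjgadchkabefiadgcj''),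
    (''eiijllmmmmm'', ''geahdijabckfagdehaibcjakdfgeahbciajdkfabc''),
    (''eikkkkllmmm'', ''icajbgdaehfkabcijadgefabhckaidjeabgfcahkdiabejfacghdabkeiafcjgabdheakf''),
    (''ejjjjjjjj'', ''bcadefgahi''), (''ejjjjjjjpp'', ''abcdeafghiabcdeafghj''),
    (''ejjjjjjooo'', ''abcdhaefgiabcdjaefghabcdiaefgj''),
    (''ejjjjjmmmm'', ''bgachdeaifbjacgdeahfbiacjdeagfbhacideajf''),
    (''ejjjjjmpppp'', ''habcidajefgabckdahefiabcgdajefkabchdagefiabcjdakefgabchdaiefjabcgdakef''),
    (''ejjjjlllll'', ''fagbchadiejafbcgadheiajbcfadgehaibcjadfegahbciadje''),
    (''ejjjjlllnnp'', ''abcikadfegabchjadiefabcgkadhejabcfiadgehabcjkadfegabchiadjefabcgkadheiabcfjadgeh''),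
    (''ejjjjlmmmpp'', ''bafcjgadehbaicfkadegbahcjiadefbagckhadei''),
    (''ejjjjmpppppp'', ''gbachifadejbacklgadefbachijadekbacfgladehbacijkadefbaclghadeibacfjkadel''),
    (''ejjjjoooooo'', ''abcfgadehiabcjkadefgabchiadejk''),
    (''ejjjjooopppp'', ''abcdfaeijgabcdhaeklfabcdgaeijhabcdfaeklgabcdhaeijfabcdgaeklh'')]"
  by (simp only: cert_simps)

lemmas [simp] = certs_valid [OF small_words_7, simplified]

lemma small_words_8: "list_all cert_ok [
    (''ejjjkkkkppp'', ''bicaefjgadhbcakefiadgbcahjefadkbcaghieadfbcajghkadebcafighadjbcaefkgadh''),
    (''ejjjklllmno'', ''ifabgckahdejabfcgaidheabkcfagdjiabhceafdgkabjchaed''),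
    (''ejjjoooooopp'', ''abcefadkghabcijadlefabcghadkijabcefadlghabcijadkefabcghadlij''),
    (''ejjkkkkmmoo'', ''adjehabfkcagdieabhfcajgdkabeicafhgdabjecaifkgabdhcaejfiabgdcahekfabigc''),
    (''ejjkklllllo'', ''abfdgachieabjkfadgchabiejafdcgabhkiaejfdabgchaiekj''),
    (''ejjkkmmmnopp'', ''jfabcidakgehabcjfadileabcghakdjfabceiaghdlabcjeafkidabcghael''),
    (''ejjkkmmnnnpp'', ''akbhfaclidaebgjachfkadbeiacgjlahbdeacfikagbjdacehlafbigacdej''),
    (''ejjkppppppppp'', ''dbaefghacijbadklmacefbagdhiacjkbamldeacfgbahijdacmkbalefgacdhbaijmkacl''),
    (''ejjmmpppppppp'', ''fgabhijakcdeablmfagchiabdejakclmabfghadceiabjklamcfdabeghaicjkabdlmaec''),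
    (''ejjooooooooo'', ''abdefacghiabjklacdefabghiacjkl''),
    (''ejjoooooopppp'', ''abcdeajkfgabchialmdeabcfgajkhiabcdealmfgabchiajkdeabcfgalmhi''),
    (''ejkkkkklnoo'', ''bcdajefkagbhcadiefajbgkacdheafbigajcdkaebfhagicdajbefahgkcadbieafjghacbdkaefigah''),
    (''ejkkllnnoooo'', ''abgicaejfdabhklacgeiabdfjahcklabedgaficjabhkdaelfcabgijadhekabcflagdijabechafkdl''),
    (''ejkkmmmnnnnn'', ''heacijdabkfgalcheabdijakgcfabldhaeijcabkgdaflheabcijakdgfabl''),
    (''ejklnnopppppp'', ''habijcakedgabflmachijabdkeafcglabmhdaijckabfegadlm''),
    (''ejknnnnnnoppp'', ''dakeflagbhcajidmaebfkacghlajbidaecfmagbhkajicdalbefaghmcajbi''),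
    (''ejlmmmmmppppp'', ''adbieafgjkacbhdalemfagbciahdkjaebfgacmlh''),
    (''ejmmmmmmmmpp'', ''acdkeafgbhaijlcadebfagkhiajcbdaeflgahibj''),
    (''ejooooooooopp'', ''abcdealfghabijkamcdeabfghalijkabcdeamfghabijkalcdeabfghamijk''),
    (''ekkkkkkkkk'', ''bcadefgahij''),
    (''ekkkkkkkopp'', ''bcdjaefgiahbcdakefgajhbcadiefagkhbacdjeafgihabcdkaefgjahbcdaiefgakh''),
    (''ekkkkknppppp'', ''bchiadegjafbckaldehaifbcajgdeaklf''),
    (''ekkkooppppppp'', ''bcghaidefajbckalmdgahibcaefjdaklm''),
    (''ekmnnnnnnnoop'', ''abdefaklgcahbijadefmaklbgachijadefbaklgcahijm''),
    (''ellllmmmmmmp'', ''fabcghadeijakfbcaghdeaijlk''),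
    (''emmmmmmmmpppp'', ''bacdjeafgkhaiblcademfaghjiabckdaeflgahim''), (''eoooooooooooo'', ''bacdefaghijaklm''),
    (''eppppppppppppp'', ''bcdeafghiajklman''), (''fffffll'', ''abcdefabcdeg''),
    (''fffffppp'', ''abcdefabcdegabcdeh''), (''ffffipppp'', ''abecdfabgcdeabhcdi''), (''ffffllll'', ''abcdefabcdgh''),
    (''ffffllppp'', ''abcedgabcfdhabcediabcfdgabcedhabcfdi''),
    (''fffhpppppp'', ''adbecfagbdchaibjcdaebfcgadbhciajbdceafbgcdahbicj''),
    (''fffiiill'', ''abdcgeabfchdabecgfabdcheabfcgdabechf''), (''fffiiippp'', ''abdcgeabfchdabecif''),
    (''fffiillpp'', ''abdcfeabhcgdabecfiabdcgeabhcfdabecgi''), (''fffllllll'', ''abcdefabcghi''),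
    (''ffflllpppp'', ''adbgceahbfciadbjceagbfchadbiceajbfcgadbhceaibfcj''),
    (''fffpppppppp'', ''adbecfagbhciajbkcdaebfcgahbicjakbdceafbgchaibjck'')]"
  by (simp only: cert_simps)

lemmas [simp] = certs_valid [OF small_words_8, simplified]

lemma small_words_9: "list_all cert_ok [
    (''ffggjnnnpp'', ''ceafbdicagbedhacbjfdaebcgiadbhceafbdjcagbedhacbfidaebcjgadbh''),
    (''ffgjnnnoopp'', ''cdaebfjcahbdigacbekfadbchjaibgcdaebfkcahbdigacbjefadbchkaibg''),
    (''ffhhllpppp'', ''acbdegahbcfdaibjecadbgfhacbdeiajbcfdagbhecadbifj''),
    (''ffhlllllpp'', ''acbdeiafbcghajbdecafbighacbdejafbcghaibdecafbjgh''),
    (''ffhllpppppp'', ''acbfdgahbceiajbkdcafbgehacbidjakbcefagbhdcaibjek''), (''ffiiiiipp'', ''acdbefaghbcdaefbgi''),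
    (''ffiiiipppp'', ''acdbegafhbcdaeibfj''), (''ffiiillll'', ''abcfgdabehicabdfgeabchidabefgcabdhie''),
    (''ffiiillppp'', ''abcfhdabegicabdfjeabcghdabeficabdgje''), (''ffiiipppppp'', ''abcfgdabehicabdjke''),
    (''ffiillllpp'', ''abcefdabighcabdefjabcghdabiefcabdghj''),
    (''ffiillppppp'', ''abcegdabhficabdejkabcfgdabheicabdfjk''),
    (''ffijjjjppp'', ''adbehfacbgidaebfcjagbdheacbfigadbecjafbghdacbeifagbdcjaebfhgacbdieafbgcj''),
    (''ffikkkkkkp'', ''abcdefabghicabdefjabcghiabdefcabghij''),
    (''ffimmmpppppp'', ''abcgdhabiejcabfkldabcgehabifjcabdkleabcgfhabidjcabeklf''),
    (''ffjjjjjll'', ''acbdheafbgicadbehfagbcidaebfhgacbdieafbghcadbeifagbchdaebfig''),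
    (''ffjjjjllpp'', ''acbdgeafbihcadbegfajbchdaebfgiacbdheafbjgcadbehfaibcgdaebfhj''),
    (''ffjjjmmmmpp'', ''ajbfgcadbehiakbcfdaebgjhacbdieafbkgcadbehiajbcfdaebgkhacbdie''),
    (''ffllllllll'', ''abcdefabghij''), (''fflllllpppp'', ''acbhdeaibfgjacbkdeahbfgiacbjdeakbfghacbideajbfgk''),
    (''ffllllooooo'', ''abgcdhabiefjabkcdgabhefiabjcdkabgefhabicdjabkefgabhcdiabjefk''),
    (''ffllpppppppp'', ''aebfcgahbidjakblceafbgdhaibjckalbedfagbhciajbkdl''),
    (''fflnnnnnnnpp'', ''daebfkgahbicjadbelfagbhciajbdkeafbgchaibjl''),
    (''fflnnpppppppp'', ''afbghdaibcjkaeblmfadbcghaibejkalbcdmafbgheaibcjkadblmfaebchgaibdkjalbcem''),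
    (''ffmmmmmmmmm'', ''cdeabfghiabjk''), (''fggglllll'', ''aebfcgadhbicaedfbgachdibaecfdgabhcid''),
    (''fggglllppp'', ''ebfchadgbicaedfbjacgdhbaecfdiabgcjda''),
    (''fggiikkkk'', ''fabghcdaebifcagdbehacifbdaecghbaidce''),
    (''fggiinopppp'', ''abhicdaebjgcafdbekachibdaecfjbagdcek''),
    (''fggijjkkpp'', ''bdaecigbafdcheabjgcdafbhicaedbgfachj''),
    (''fggkklllmm'', ''bfcgaidbecahjfbgacdeibahcfjgabdceiahbfcgadjbecahifbgacdejbahcfigabdcejah''),
    (''fgglllmnppp'', ''aibdceagjbfcahkdbeacgifbajcdheabkcfgaibdceahjbfcagkdbeacihfbajcdgeabkcfh''),
    (''fggllopppppp'', ''gahdbicaefjbkacdlgbaechifabdcjkaeblc''),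
    (''fgiijkknppp'', ''iaejfbcadhgkbaecfdiabgjhcadbefkagcbd''),
    (''fgiiklmmppp'', ''cadbfijagcbdeahkfbcadgiebajcfdhabkegcadbfijahcbdeakgfbcadhiebajcfdgabkeh''),
    (''fgiimnpppppp'', ''cbdeaghibcadfjkbaecldgabhifcadbejkalcbdgafhibcadjekbalcfdgabhiecadbjkfal''),
    (''fgijlnnnoppp'', ''dejafbghcadibekalcjbdafghebacidklabjfceadbghiackbl''),
    (''fgikkkllnpp'', ''djaecbgkahfdbcaiejgbahcfdkabeigcahbf''),
    (''fgiklmnooppp'', ''cbefahdjbcagklebadcfihabjgecadblfkaicbegadhjbcaflkebadcgihabfjecadblkgai''),
    (''fgillllmmmp'', ''cbdhaeifbcagjkdbaecfhiabgjdcaebfkhaicbdgaejfbcahikdbaecfgjabhidcaebfgkaj'')]"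
  by (simp only: cert_simps)

lemmas [simp] = certs_valid [OF small_words_9, simplified]

lemma small_words_10: "list_all cert_ok [
    (''fgjkkkkknop'', ''adefbcaijghbadecfkabghijacbdefaghbkcaidebfagjchbadeifkabcghjadbefiacgbhk''),
    (''fgkllmmnnppp'', ''ahdbfjaecgbkaidhlbaecfgjabdikhaebcflagdbjiaechbfakdglbaecijhabdfgkaebcli''),
    (''fglnnnnpppppp'', ''adhibcaejfkbagldmcabiehfajbgkcadlbmeaifhbcagjdkbaelmfcabighdajbekcaflbmg''),
    (''fhhhllllpp'', ''abecfdaigbhcadejfbacgdhiabecfdajgbhcadeifbacgdhj''),
    (''fhhhlnnnoop'', ''ibacfdgkabechdajibfcadekgbachdjiabecfdakgbhcadej''),
    (''fhhllllpppp'', ''abdcehaifbgcajdkebacfhgiabdcejakfbgcahdiebacfjgk''),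
    (''fhhlnnnooppp'', ''bacejhiabfcdkalgbecajhidbacfkglabecdjahibfcakgld''),
    (''fhlllllllpp'', ''abcdejafgbhiakcdebafgjhiabcdekafgbhiajcdebafgkhi''),
    (''fhllllpppppp'', ''abcgdhaiebfjakcldbagehfiabcjdkalebfgahcidbajekfl''),
    (''fiiiiiill'', ''abchdeafgibcadehfgabcideafghbcadeifg''), (''fiiiiiippp'', ''abchdeafgibcadejfg''),
    (''fiiiiillpp'', ''abcgdeafihbcadegfjabchdeafigbcadehfj''), (''fiiiiippppp'', ''gabchdeafijbcadekf''),
    (''fiiiikkkkp'', ''fbcadgjheabcidfagehbcadijfeabcgdhaie''),
    (''fiiiillpppp'', ''abcfdhaeigbcadjfekabcgdhaeifbcadjgek''), (''fiiiippppppp'', ''abcfdgaehibcadjkel''),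
    (''fiiijjjmmm'', ''bhacdeifabgjcdaehfbiacdgjeabfhcdagiebjacdfhgabeicdafjg''),
    (''fiiijlmmmop'', ''bgacdfhjabeicdagkfbhacdeijabgfcdaehkbiacdgfeabjhcdaike''),
    (''fiiikklmmop'', ''bcahefdjabcgikadefbcahjgdiabcefkadhgbcaiefdjabcghkadefbcaijgdhabcefkadig''),
    (''fiiillllll'', ''abefcgadhibjacefdgabhicjadefbgachidj''),
    (''fiiillllppp'', ''abefciadghbjacefdkabghciadefbjacghdk''),
    (''fiiillpppppp'', ''abcedgahifbcadjeklabcfdgahiebcadjfkl''),
    (''fiiimmnnpppp'', ''abigcdaejkbfacdhlgabeicdafjkbhacdgleabficdahjkbgacdlefabihcdagjkbeacdflh''),
    (''fiiippppppppp'', ''eafghbcadijklabcmd''), (''fiijjjjjjp'', ''djefgabchidaefgbcahi''),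
    (''fiijjjjpppp'', ''bcadheifabcgjdaekfbcaghdieabcfjgadkebcafhgidabcejfagkdbcaehfigabcdjeafkg''),
    (''fiijjjlmmpp'', ''bgadcjheabfikcadgebhafcjidabekgcafhdbiaecjgfabdhkcaeif''),
    (''fiijjkpppppp'', ''bcadghieabcfjdaklebcagfdhiabcejkadflbcaeghidabcfkeajldbcagfeihabcdkjaefl''),
    (''fiijlmmmpppp'', ''abficeadgjbhackfldabegciahjdbfacekglabdhciafejbgacdkhl''),
    (''fiillllllpp'', ''abdecfajghbiacdekfabghciajdebfacghki''),
    (''fiillllppppp'', ''abdechaifgbjacdeklabfgchaidebjacfgkl''),
    (''fiilmmopppppp'', ''ahiejbacfkldagbmceahifjbacdkglaebmcfahdijbaceglkafbdcm''),
    (''fiimmmmmmppp'', ''bcadejfgabchikaldebcafgjhiabcdekalfgbcahijdeabcfgkalhi''),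
    (''fiinnnnpppppp'', ''ahidbcaejklfabcgmdahiebcafjklgabcdmeahifbcagkjldabcemfahigbcadkjleabcfmg''),
    (''fijjkkkopppp'', ''aefcijabdkghacefbladigjcabefkdahgcblaefdijabcgkhadefblacgijdabefkcaghdbl''),
    (''fijjklmmnopp'', ''kcabflgdaejcbhaifdkgabceljadfhbiacegkdabflhcaeidbjagfckhabdeilacfgbjadeh''),
    (''fijlmmmpppppp'', ''abehidacfjbgaklemcabdfihagjcbeakdlfmabcgihaedjbfacklgm''),
    (''fikmmnnnnpppp'', ''fbdacgjkhabeilfacdmbgahjekiabcfdlagmhbeacijkfabdglhacembiafjdkgabchelaim''),
    (''filmmmnnnoopp'', ''bjagldemabchfiakjgbdaeclmhabfikgadcebjahlfmiabcgdeakjhbfaiclmgabdekhafci''),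
    (''fjjjjjjlppp'', ''ibacjdefaghbkcadefigabhcjdaefgkbachdieafgbjcadhekfagbcidaehfjgabcdkeafhg'')]"
  by (simp only: cert_simps)

lemmas [simp] = certs_valid [OF small_words_10, simplified]

lemma small_words_11: "list_all cert_ok [
    (''fjjjjjllll'', ''abgchdaeifjbacgdheafibjcadgehfabicjdaegfhbacidjeafgbhcadiejf''),
    (''fjjjjjllnpp'', ''bgcjdaeifhbacgdkeafjbhcadiegfabkchdaejfgbacidheafk''),
    (''fjjjjllllpp'', ''abfcgdaehjibacfdgeakhbicadfegjabhcidaefkgbachdieajfbgcadheik''),
    (''fjjjjmnnnopp'', ''gbajkchdaefbliacgdjeabhfkcadiegbajlchdaefbikacgdjeabhflcadie''),
    (''fjjjkkllmnn'', ''jgbakechdafibgjacedhkabfigcadejhbafkcgdaiebhjacfdgkabiehcadf''),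
    (''fjjjklmmmnpp'', ''bgcaejkhdabfcigaeldjbacfhkiadebgcajflhdabecigakfdjbacehliadf''),
    (''fjjjlmmmmmop'', ''kalfbgcadhiejabkcfdaglhebacidjkafgbecadhiljabkcedafghibacjde''),
    (''fjjjnnooopppp'', ''bgcahjkedabicflagmdhbacejkiadfbgcahmledabicfjagkdhbacemliadf''),
    (''fjjnnnnnnoopp'', ''bacdelfajkbgcahimdeabfcjkalghibacedfmajkbgcahiledabfcjkamghi''),
    (''fjkkkklmmmnp'', ''baklcdeafhbgiajcdekabfhglacdeibajfkghacdbeiafjlgkabdcehafijg''),
    (''fjmmmmmmmoppp'', ''ckdealbfjgahicmdabekflaghicbadjemfakgbhiacdlejabfgmhai''),
    (''fjoooooooppppp'', ''jcbkladefghabimnjackldbaefghiamn''), (''fllllllllll'', ''bcadefghaijk''),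
    (''flllllllpppp'', ''abcideajfghkabcldeaifghjabckdealfghiabcjdeakfghl''),
    (''flllllnnnnnn'', ''gabchdiajekflabcgdhaiejfkabcldgaheifjabckdlagehfiabcjdkalegfhabcidjakelf''),
    (''fllllpppppppp'', ''afbgchaidjekalbmcfagdheiajbkclamdfegahbicjakdlem''),
    (''flmmmmmppppppp'', ''hcidajkefgablmcnadhiefabgkjcaldmneabfghiakcjdlabefgman''),
    (''flnnnnnnpppppp'', ''icjadkelfabmghnacidjeabfklgahmcndabejfiagkhlcabdmenafjgihabckdlaemfngabh''),
    (''fmmmmmmmmmmm'', ''bacdefgahijkl''),
    (''fmmmmmmmpppppp'', ''ibcdjaekfglahmbcdaiejfgakhlbcadmenfagihjbacdkelafgmhn''),
    (''ggggggnn'', ''abcdefgabcdefh''), (''ggggggppp'', ''abcdefgabcdefhabcdefi''),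
    (''gggggjjpp'', ''abhcdefabgcdeiabfcdeg''), (''gggggppppp'', ''fabcdgehabcdiejabcdfegabcdheiabcdje''),
    (''ggggijjmn'', ''fiagbcdheafbcdgiaebcdfhagbcdeiafbcdghaebcd''),
    (''ggggkkkopp'', ''abecdifabgcdheabjcdfgabicdehabfcdgj''),
    (''ggggnnppppp'', ''egahbcdfiajbcdekagbcdfhaibcdejakbcdfgahbcdeiajbcdfkagbcdehaibcdfjakbcd''),
    (''gggiiiinn'', ''adhebcfagidbceafhgbcdaeifbcg''),
    (''gggiiimnpp'', ''dabecgifabdcehjabfcdgeabicfhdabecgjfabdcehiabfcdgeabjcfh''),
    (''gggiijklmp'', ''abdceijabfcdheabgcifdabechjgabdcefiabhcdgeabfcjidabechgf''),
    (''gggjjjnnnn'', ''abdcgehabfcidjabecgfhabdciejabfcgdhabecifj''),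
    (''gggjjnnnnpp'', ''abdcfegabjchdiabecfkgabdcheiabjcfdgabechki''),
    (''gggkkkknnnp'', ''khadbcefiagbcjdhaebcfgiakbcdejafbcghiadbcefjagbckdiaebcfhgajbcdeiafbcg''),
    (''gggkllllppp'', ''iaebfjcdagbhkceafbdicgahbjecfadbkgch''), (''gggnnnnnnnn'', ''abcdefgabchijk''),
    (''gggnnnnppppp'', ''abcdheiabcjfkgabcdlehabcifjgabcdkelabchfigabcdjekabclfhgabcdiejabckflg''),
    (''gghhhjjjn'', ''abcfdgeabhcidfabegchdabfeicgabdhefcabgdieh''),
    (''ggiiiiilmp'', ''hcdeajbfgicadbehfgacbdiejafbgcdhaebfigcadbehfjagbcdeiafbg''),
    (''ggiiiimnnn'', ''acbdhgeafbcidjaebfhcgadbeifj''),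
    (''ggiiiinpppp'', ''abchdgeabficjdabekfgcabdheifabcjdgeabfkchdabeifgcabdjekf'')]"
  by (simp only: cert_simps)

lemmas [simp] = certs_valid [OF small_words_11, simplified]

lemma small_words_12: "list_all cert_ok [
    (''ggiiijjmnn'', ''cafibdheacgbfjdaeibcghadfbejcagibdheafcbgjdaeibcfhadgbej''),
    (''ggiiinnnnpp'', ''cabdfjgeabchdikabefcgdabjheicabdfkgeabchdijabefcgdabkhei''),
    (''ggiiinpppppp'', ''cabdghieabcfdjkabelcgdabhfeicabdkjleabcfdghabeickdabjfel''),
    (''ggiijllmmmp'', ''facbdhieagbcjdfakbehciadbgjfeacbdhikagbcejdafbhicgadbejk''),
    (''ggiijmnppppp'', ''eacbfhdiajbcegkadbflchaebdigjacbfedkalbchgiadbefcjakbdlg''),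
    (''ggiimmmnpppp'', ''iabcedfjabkgchdabelficabdgjhkabcedflabgichdabejfkcabdglh''),
    (''ggijjjjjjp'', ''daefjbghacidbefaghcbi''),
    (''ggijklllmmn'', ''cafkbdigacebhjfadkbcieaghbdjcafkbeigacdbhjfaekbcdiaghbje''),
    (''ggijmmmmmppp'', ''jefcabghidkabcefljabdgchiabefkdcabgjhliabcdefkabghcidabl''),
    (''ggikkkmnoooo'', ''digjeabcfhkdablecgiabfdhjcabekglfabcdhieabjfcgkabdehlcabfigjdabechkfabl''),
    (''ggimnnnnnnpp'', ''ecfgabkdhicabjelfgabcdhikabjecfgabdlhicabjekfgabcdhilabj''),
    (''ggjjjjllnnp'', ''acdbegiahfbcdjaekbgfiacdbhejafgbcdiaehbfkj''), (''ggjjjkkkkk'', ''fgacdebhiajfgbdcaehibj''),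
    (''ggjjjmmnnnn'', ''abcfgdhabeijckabdfgehabcijdkabegfchabdijek''),
    (''ggjjjnnnnppp'', ''abcfjdgabehkciabdflegabchjdiabefkcgabdhlei''),
    (''ggjjnnnnnnpp'', ''ecfabkghdiabcjelfabdghciabkjedfabcghliabdj''),
    (''ggjkkkmmnoop'', ''idabegljfabcdhieabgfkclabdehijabfcgkdabehlifabcdgjeabhfkc''),
    (''ggkkkkkkkpp'', ''cadejbfgahicbdeakfgbhi''),
    (''ggkkkkkmnnn'', ''iacbdjheafbgkciadbejfhagbckdiaebfjghacbdkeiafbgjchadbekfiagbcjdhaebfkg''),
    (''ggkklmmmmmmp'', ''fabghilcabdjekfabgchidabejkflabcdghiabejkfcabdlghiabeckjd''),
    (''ggnnnnnnnnnn'', ''abcdefgabhijkl''),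
    (''ggnnnnnnppppp'', ''abcdefiabjgkhlabcdefmabigjhkabcdeflabmgihjabcdefkablgmhiabcdefjabkglhm''),
    (''ggooooooooooo'', ''cdabefghiabjklm''), (''ghiikkllloo'', ''cjgaebfdhcaikbgedacfhbjiadgcebfahkdi''),
    (''giiiiiimnn'', ''abicdheafgbjcdaeifgbhacdejfg''),
    (''giiiiijjln'', ''abcdjgeafhbcdiaegfjbcadheifgabcdjehafgbcdiaehfjbcadgeifh''),
    (''giiiijjkkk'', ''bfchgdaeibjcfadgehbiacfdjegabhcidfaegbjchadfeibgacjdhefabgcidjaefbhcgadiej''),
    (''giiiinnnnnn'', ''afgbchiadejkbcafgdehiabcjkde''),
    (''giiiinnnpppp'', ''abfcgdiaehbjckadfegblachdiejabfcgdkaehblciadfegbjachdkel''),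
    (''giiijjjjjl'', ''jbcedfaghibcjadefghbacidjefabghcdiaefbjgcadhiebfacgdjhiabecfdgahi''),
    (''giiijjjllmp'', ''bkacefgjdabhciefadgbjckaefdibhagcjedfabikcghadebfjcagidh''),
    (''giiijjkkkpp'', ''becgjhadfbiceagkdhbfaceijdgabfchekadibgcfaehdjbiacfgedkabhcifjadebgchafidk''),
    (''giiijjklllp'', ''gbachdiefabgcjdkaefbhcgaidjebfachgdkiabecfjdaghbiceadfjk''),
    (''giiijjlmmmn'', ''gahebcikadfjgbcaehdifkabcjedgafhbcikadejfbcaghdiekabcfjd''),
    (''giiijkkkkmp'', ''bfjcadeghbiacfdjekabgchdiafebjcgadhikbeacfdgjhabecidfagkbhceadijfbgacedhki''),
    (''giiijkkmmmm'', ''fbehcaigdjbfacekhdgabifcejadkgbhcafedijbagckhdfabeicgjadk''),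
    (''giiijmmmmppp'', ''bjacekfgdabhcieladjbfcgaehdkbiaclfedgabhcjikadebfcgahldi''),
    (''giiikkkkllp'', ''ibacefgdhabjcikeadfbgchajidebfacghkdj''),
    (''giiikkkooppp'', ''jbhcidaekfbgcadljhebacfdgikabecldfag''),
    (''giiikklmpppp'', ''bacedgijabfchdeakgblcfadiehbjacgdfklaebchdiafgjbecadkhlf'')]"
  by (simp only: cert_simps)

lemmas [simp] = certs_valid [OF small_words_12, simplified]

lemma small_words_13: "list_all cert_ok [
    (''giiiloppppppp'', ''gbachijdkabeclfmdagbhcieadjkbfcalmde''),
    (''giiimmnnnnpp'', ''abgcedhafkbicjadgelbhacfdikjabgcedhaflbicjadgekbhacfdilj''),
    (''giijjjkllmm'', ''abhdjecgafbikdhacjebgfadikchbaegfdjcaikbehfacdgjbieafhcdkbgaeifcjhbadgekcfi''),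
    (''giijjllmmnpp'', ''jfabchkdgaeibcjfadhlebcagikdjfabcehlgadibcjeafkhdbcageil''),
    (''giijjmnnnooo'', ''dgahfbcjeadklibcagehdfjabcklei''),
    (''giikkkllpppp'', ''bidaefjcgbahkdlecabfgijhacdbekfaglch''),
    (''giikklopppppp'', ''bahijgdcabefklmacdbhieafjcgbdakmelcf''),
    (''giikknnpppppp'', ''abfcdhiajebgckadflmbeachigdjabfceklamdbgchaefijbdacklgem''),
    (''giiklmmmmmnp'', ''bfglahdcibjaekfgcdabhiljeackbdfgahicebjadklfcgabheidjack''),
    (''giiklmmnppppp'', ''dhabicfjkaedbgchalmfibdacegjkhabfcdmlaegbichadfjkbeacgml''),
    (''giimnnnnnpppp'', ''ebjfkacgldbhaiecmfjabgdkchaieblfmacgdjbhaieckflabgdmchai''),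
    (''giinnnnnnnnn'', ''daefbghiacjklbdaefcghiabjklc''),
    (''gijjjkllnoop'', ''jcdaiglbheacdkfjbagehcdlabfikegacdhbjfaleicdgahbfke''),
    (''gijkkmmnppppp'', ''iajhbdfkacelgbmadhicfeabjgkdlachbemfaidgcbjaehklfdabcgme''),
    (''gikkkkmmmnpp'', ''gkacdhjbeafilgcdabhejfkaicbdglaefhjbcadikgefabhcjdlaiebf''),
    (''gikklllmmmmm'', ''hiajckebdafglhicabjdkefaglbchiadjkebgacflhdiabjkgceafdbl''),
    (''gikkmmnnnpppp'', ''acgejbdahkflciabgdemjahcbfkiadgelbcahmfjdiabgceklahdbfmi''),
    (''ginnnnnnnnnpp'', ''abcdelfaghbijkamcdebfaghlijkabcdemfaghbijkalcdebfaghmijk''),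
    (''ginnoooooooopp'', ''aefbghcadmijbkalefnghabcdijmaklbefgahcdnbiajklmefabghcdnaijbkleafmghbcadijnkl''),
    (''gjjjjjjmnnn'', ''ibcjadekfghabcidejafgkbhcadeifgjabckdehafg''),
    (''gjjjjklllnop'', ''bcgldeafjhbciadegkflabhcdeiagjfbkcadheilgabcfdjeahik''),
    (''gjjjjllmmnnp'', ''jabfgcdkaehibljacdfegkabhicdjafegblkacdhie''), (''gjjjkkkkkkp'', ''efabcdghiajefbcdaghikj''),
    (''gjjjmmnnnnnn'', ''gabhicjkadefblgachidjkabfeclgadhibjkacfedl''),
    (''gjjjnnnnnnppp'', ''eabkfcghadlibjeacmfdghabkicjeadlfbghacmidj''),
    (''gjjmmnnnnnnpp'', ''fbghacdleijabkfcghadmebijackflghabdecijamk''),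
    (''gjkkkkkkkmn'', ''cadbejfgahickdbaefgjhiacdbkefaghijcdabefkghaicdbjeafghki''),
    (''gkkkkkmmppppp'', ''bcadigjefakbchdlamefgibacdhjkeaflbgcdamheifjabcdglkaefhm''),
    (''gkkkkknnnnnn'', ''bgcahdiejfabkclgdaehfibjackdlegafhbicjadkelfgabhcidjaefkl''),
    (''gkkkkknnnoppp'', ''bcjgkdaeflhbcaimdjefagbchkladefijbacgmhdeafkbiclajdegfhabcmikdaefjgbcahldiefam''),
    (''gkkkkmnnnnnpp'', ''bgaclhidfaebjkcgamdhiebafcljkdagebhicamfdjke''),
    (''gkkkmmmmnnoop'', ''baecfikdagmbjhcaefdilkabgcjhmadefiblacgkjdhaebficmagdljh''),
    (''gnnnnnnnnnnnn'', ''bacdefghaijklm''),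
    (''gnnnnnnnnppppp'', ''abcdefjakglhmiabcdefnajgkhliabcdefmangjhkiabcdeflamgnhjiabcdefkalgmhni''),
    (''gooooooooooooo'', ''bcdefgahijklman''), (''hhhhhhhpp'', ''abcdefghabcdefgi''),
    (''hhhhhhpppp'', ''abcdefghabcdefij''), (''hhhhhlllpp'', ''abcfdeigabchdejfabcgdeihabcfdejgabchdeifabcgdejh''),
    (''hhhhhpppppp'', ''abcdefghabcdeijk''), (''hhhhllllll'', ''abefcdghabijcdefabghcdij'')]"
  by (simp only: cert_simps)

lemmas [simp] = certs_valid [OF small_words_13, simplified]

lemma small_words_14: "list_all cert_ok [
    (''hhhhlllpppp'', ''abcedhifabcgdjkeabcfdhigabcedjkfabcgdhieabcfdjkg''), (''hhhhpppppppp'', ''abcdefghabcdijkl''),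
    (''hhhjjppppppp'', ''abcdfgheabcijdklabcefghdabcijekl''),
    (''hhhllllllpp'', ''abdecjfgabhickdeabfgcjhiabdeckfgabhicjdeabfgckhi''),
    (''hhhlllpppppp'', ''abcdghieabcfjkldabceghifabcdjkleabcfghidabcejklf''),
    (''hhhpppppppppp'', ''abcdefghabcijklm''),
    (''hhjjjjjpppp'', ''acbdheifagbcjdkeafbghcidaebfjgkcadbehfigacbdjekfagbchdieafbgjckdaebfhgicadbejfkg''),
    (''hhjjjllooopp'', ''cdhiabefklcdabgjehifabcdklegabjfcdhiabegklcdabfjehigabcdklefabjg''),
    (''hhjjkkkppppp'', ''haebfijcdagbkelfhacbdgijeafbckdlg''),
    (''hhjjppppppppp'', ''eabfgchijabdklmceabfgdhijabcklmd''),
    (''hhllllllpppp'', ''abcdijefabghklcdabefijghabcdklefabghijcdabefklgh''),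
    (''hhlllpppppppp'', ''abcfghdiabejklcmabdfgheiabcjkldmabefghciabdjklem''),
    (''hhmmmmmpppppp'', ''hicabdjeklfabgmchidabejfklgabcmdhieabfjgklcabdmehifabgjckldabemfhigabcjdkleabfmg''),
    (''hhpppppppppppp'', ''abcdefghabijklmn''),
    (''hiiiijjjjk'', ''bafcghdieajbcfgdhaeibjcfdagehibcjdafeghbciajdefgbcahidjefbagchdiej''),
    (''hiiiijjnnpp'', ''abjcfdkeagbhcidfaejbgckdafeibhcgadjefbkcagdiehbfacjdgekbafcidheg''),
    (''hiiiimmmmmm'', ''bfgcdhiaebjkcdfagebhicdajke''),
    (''hiiiinnnnppp'', ''bjckdafegbhciadlejbkcafdgeibhacldjekbafcidgehablcjdkeaibfcgdhael''),
    (''hiiijjjlmmo'', ''eafibgcdjaehfbkcdagiejbfcadhgkebiacdfjghbaecdkfigabhcdejfagbkcdh''),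
    (''hiiijjkklmo'', ''aebgchkdafibecgjadhfbkceaidgjbfcahedkibgacfjdehbaicgfdkeabhcjidf''),
    (''hiiijllnnoop'', ''bjcaefdgkbhaciedjfbagclkdehabfcigdjaebkchfdaglbecijadkfbgceahdli''),
    (''hiiijlnnoooo'', ''baeicgjdfabkeclhdaibfgcejadkbhlcfaedibgjcakhdebflacigdjbeakcfhdl''),
    (''hiiijmmmmnpp'', ''afbgckdjaehbicfdalgebjchadifkbecagdjhlbiacedfkgbajchdeil''),
    (''hiiikkkkkln'', ''eajfbgchdaiekbjcfadghibecajdfkgbhacidejfbagchdki''),
    (''hiiikkkmmppp'', ''jebchafdkigbcaeldfhjbacgidekfabchldgjaebcfidkaghbceldafijbcghadekfbciagdl''),
    (''hiiilmnpppppp'', ''gbhcijdafkbeclgadmhbicfaedjkbgcalmdfebiachjdgkbaecfldmiabhcgedjafbkclmdae''),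
    (''hiiimmmmmnnp'', ''aebfcgdjakhbicedafglbjckadhiebfcagdjlkbhacidefgbajckdhli''),
    (''hiiinnnnppppp'', ''bijceafdkbghcalmdibefacjgdhbkalcmedfbagichjdkabelcfmdagbhicjkadebflcgahdm''),
    (''hiijjjjjnpp'', ''bdcjeafgibhcdaekfgbjcahdeifbgackhdejbafcgihdeabkcfgjhadbecifgahk''),
    (''hiijjjjkkop'', ''dkehfabgcjdieafbhcgkdaeibfchgadjebicfaghdkbecafigjdbhacefkgibadchefjgabic''),
    (''hiijjjjkllp'', ''dkeifabgcjdheafbicgkdaehbfcjgadiebhcfagjdkbecafhgidbjacefkghbadciefjgabhc''),
    (''hiijjjkkkln'', ''daegjbchfadiekbcgafjdhebcaigfkdjbacehifgdabcjekhfaibcgdejafhbcik''),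
    (''hiijjkkkkkp'', ''bfcdagehibjcadfkegbhacidjfebagchkdijabecfghdaibjcekfadhbgcieajfdbhcgaeikj''),
    (''hiijjkklmnop'', ''bkdaefcgibhadjecfkbagldhceiabfjgdckaebhiflcagdbejkhacfibdegalchj''),
    (''hiijjklnoooo'', ''dbijfaeckhbdgalfceibjadkgcfebahldicjgabekfdchalbgeijcadfbkhegacl''),
    (''hiijkklmmmnp'', ''bkchdaefibgcjadlhebfcakgdijbeacfhldgbaicejfkdabgchleiadbfcjgkaehbdcfialgj''),
    (''hiijnoooooopp'', ''flabeghcdiambjkfcladgbehicamjdbkflacgehbdiamcjkfbladgcehibamjdck''),
    (''hiikkkllmnoo'', ''dkejbfagchldibaefckgjhabdlcefiagbhkcdjaefblgchai''),
    (''hiikkmnnnnopp'', ''bdcgklhafbecdijamgbkcehadflbicjaegkdbhcafmiej''),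
    (''hiillmmmmpppp'', ''bcfagdjkhbcaeilmfdbacghjekiabcdfmlgaebchijdafkbcegmalhdbcifaejgkbcdahmlie'')]"
  by (simp only: cert_simps)

lemmas [simp] = certs_valid [OF small_words_14, simplified]

lemma small_words_15: "list_all cert_ok [
    (''hiinnnnnnnnnp'', ''mdbefcgahijbklcadefmbghacijklbdaecfghmbaijckldeabfgchmiajbklcdeafgbhicjakl''),
    (''hijjjlllmmpp'', ''kiajbcfdleaghbicjdaekfbghcadiejblfacgdhe''),
    (''hijmmmmmmmppp'', ''acdeklfgabhcijmdaebfgclhaijbkdecafgmbhij''),
    (''hikkkkkllnno'', ''hjbcdaeikfgbhalcdejibafghkcdeabilfgjhacbdekifagl''),
    (''hikkkmmmmpppp'', ''cabdfjkgeahbcidlmafebgjchadikbefmacgldbhiaejfckbdagmheil''),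
    (''hillllnnnnoop'', ''cdkgehaibfljcdamebgkhfaicdblejamgfkbcdaheiljbfam''),
    (''himmmmmnnnnnn'', ''hcdbijkalefgbmhacdijkblaefgm''),
    (''hjjjjjjkkkp'', ''bckdehfaigbjcdeafhkgbicadefjhgbacidefkjagbchdefaijg''),
    (''hjjjjjpppppp'', ''abgchdieafjbkcldaegfhbicadjekflbacgdheifabjckdleafgbhcidaejfkblcadgehfibacjdkelf''),
    (''hjjjjkklmmpp'', ''bkcadfgheibacjdlfgeabhcidkjaefbgchdailej''),
    (''hjjjkknoopppp'', ''ejkbachgfdleabicmjkfadebhcglaifdm''),
    (''hjjjklllmmmp'', ''abfgheicadjbklfgachdibejakfcgdhbaieljckd''),
    (''hjjjkllmmnnn'', ''bfcjhgdaekbicfladgjebhcakfdilgbacejhdfkabgcieldajfbhcgkadeil''),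
    (''hjjjmmnoooopp'', ''behacldijmbafkcedghablijcfdaekbgmhcadlfibejackdghmbaflcedijabkghcfdaelbmijcadgkf''),
    (''hjjkkkllmmmm'', ''abdciejfakgbhcdlaifejbkcadghlfibacekdjghabfcieldakgbhcfjaidelbkcafghjdibacekflgh''),
    (''hjjkkknoooppp'', ''kahgbcldeafmijbckadehfglbacimdejf''),
    (''hjjkllnnnnnpp'', ''bgcehalfidbjcakegmhfbacdijlekabfcgdhmaiebjcfkadglhbecaifjdkm''),
    (''hjjllmmmmmppp'', ''fbkglcadehibjfacgmkdebahicjflgabdemchiaj''),
    (''hjjmmmmnnoooo'', ''dabejhkfcaglbidmeacjfkbhgaldcemibafjkgchdabelmifcagjbkdheaclfmbigajdcekhbaflmgci''),
    (''hjjooppppppppp'', ''fgabhijdecaklbmnfgachijbdeaklcmn''),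
    (''hjkkkkkkpppp'', ''cadiefbjgahckdlefabgihcjdaefbkglh''),
    (''hjkkkknnoooop'', ''cdimaefbjkgcadhlebfiamcjdgkbaeflhcidabjgefkmacdblhieafjgcbdkamelfhibacdjgekfablh''),
    (''hjkmmmnooopppp'', ''bhikladcembfjagnhicdbaekfmljgabcdhienafkbmcjgadlehbfiacnkmjdbaegfchilabndmjecafg''),
    (''hkkkklmmmmnop'', ''fabghlcidaejfbkmgacdheilbajfkcdgeahbimljcadefgbhkaicjdem''),
    (''hlllllllllpp'', ''abcdkefgahijlbcdaefgkhijabcdlefgahijkbcdaefglhij''),
    (''hllllllpppppp'', ''abchidejafgklbcmadehifgjabckldemafghibcjadeklfgm''),
    (''hlllpppppppppp'', ''abefgchiadjklbmnacefgdhiabjklcmnadefgbhiacjkldmn''),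
    (''hmmmmmmmmmmpp'', ''abcdelfgahijkmbcadefglhiajkbcmdeafghiljkabcdemfgahijklbcadefgmhiajkbcldeafghimjk''),
    (''hmmmmmmmmppppp'', ''jbcadefgkhlaimbcjdeafghnkilabcdejfgahminkbcadefgjhlaimbckdeafghnjilabcdekfgahmin''),
    (''hpppppppppppppp'', ''abcdefghaijklmno''), (''iiiiiiiipp'', ''abcdefghiabcdefghj''),
    (''iiiiiiipppp'', ''abcdefghiabcdefgjk''), (''iiiiiillll'', ''abgcdhefiabjcdgefhabicdjefgabhcdiefj''),
    (''iiiiiillppp'', ''abgcdiefhabjcdgefkabhcdiefgabjcdhefk''),
    (''iiiiiiooooo'', ''abgcdhefiabjcdkefgabhcdiefjabkcdgefhabicdjefk''),
    (''iiiiillllpp'', ''abfcdgejhabicdfekgabhcdiejfabgcdheki''),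
    (''iiiiillppppp'', ''abfcdheigabjcdfeklabgcdheifabjcdgekl''),
    (''iiiikllnnnno'', ''flabhicjdegabfkcldhiabegcfdjkablhcedgfabijckdelabgfchdijabekcgd''),
    (''iiiillllpppp'', ''abecifdjgabhckedlfabgcihdjeabfckgdlh''),
    (''iiijkmmmppppp'', ''abcfijdgeabchklmdfabcgeijhdabcflkegmabcdhijfeabcgdlkmh'')]"
  by (simp only: cert_simps)

lemmas [simp] = certs_valid [OF small_words_15, simplified]

lemma small_words_16: "list_all cert_ok [
    (''iiillllllll'', ''adebfgchiajkbdecfgahibjkcdeafgbhicjk''),
    (''iiillllllppp'', ''adebfjcghaikbdecflaghbijcdeafkbghcil''), (''iiimmmmmmmmm'', ''defaghbicjkladebfcghiajkblc''),
    (''iiioooooooooo'', ''adebfgchiajkblmcdeafgbhicjkalmbdecfgahibjkclm''),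
    (''iinnnnnnnnpppp'', ''cabdefklghabijcmndeabfghklijabcdemnfgabhijklcdabefgmnhiabjcdklefabghimnj''),
    (''ilnnnnnnnnnnpp'', ''cadefbgmhiajklcndbeafghimjklabcdenfghaijkblmcdaefghnibjaklcdmefgabhijnkl''),
    (''jjjjjjjjjpp'', ''abcdefghijabcdefghik''), (''jjjjjjjjooo'', ''abcdiefghjabcdkefghiabcdjefghk''),
    (''jjjjjllllll'', ''afbgchdiejakbfcgdheiajbkcfdgehaibjckdfegahbicjdkefagbhcidjek''),
    (''jjjjjnnnnnnn'', ''afbgchdiejakblcfdgehaibjckdlefagbhcidjekalbfcgdheiajbkcldfegahbicjdkel''),
    (''jjjjjpppppppp'', ''afbgchdiejakblcmdfegahbicjdkelambfcgdheiajbkcldmefagbhcidjekalbmcfdgehaibjckdlem''),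
    (''jjjjooooooooo'', ''abefgcdhijabklmcdefgabhijcdklm''), (''kkkkkkkkkppp'', ''ajbcdekfghialbcdejfghiakbcdelfghi'')]"
  by (simp only: cert_simps)

lemmas [simp] = certs_valid [OF small_words_16, simplified]

section \<open>Search over boxes with a period of at most 8\<close>

lemma small_1: "solved small_cfg [0, 0, 0, Suc 0, Suc 0, Suc 0, Suc 0, 2, 3, 4, 4, 4, 4, 9] [Suc 0, Suc 0, Suc 0, 4, 4, 4, 4, 9, 9, 9, 9, 9, 9, 9]"
  by (rule check_solved[where t = "B 0 1 (C ''lggbhcjeidkf'' (B 3 3 (C ''jghdielh'' (B 1 1 (C ''ji'' (B 4 4 (C ''hg'' (B 3 2 (C ''ecca'' (W
    ''eggjjjjoo'')) (W ''ffjjjjjll''))) (W ''fggglllll''))) (B 4 4 (B 7 9 (C ''ifkhmi'' (B 5 4 (B 3 2 (C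
    ''gchekiigjh'' (B 7 7 (C ''ebihji'' (B 4 3 (C ''hf'' (W ''djjjjjlll'')) (W ''dhhllllll''))) (B 4 2 (C ''ii'' (W
    ''djjjjjlll'')) (W ''dhjjjjjpp'')))) (B 4 3 (B 9 9 (C ''ihgdhe'' (W ''dfiijkkkp'')) (W ''dflllllll'')) (W
    ''dfhllllpp''))) (W ''dhhhlllpp''))) (W ''djjjjjlll'')) (W ''dhhhlllpp'')))) (B 1 1 (B 9 9 (C ''if'' (B 3 4 (C
    ''jhhfcagd'' (W ''effikkllp'')) (W ''ffffllppp''))) (W ''fffllllll'')) (W ''dffllpppp'')))) (B 3 3 (B 9 9 (B 4 4
    (B 7 8 (C ''ke'' (B 7 7 (C ''kfgbmg'' (B 8 6 (C ''ebhclgmh'' (B 5 4 (B 3 2 (C ''hdgc'' (B 9 8 (C ''li'' (B 4 3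
    (C ''he'' (W ''cgjjjnnnn'')) (W ''cggoooooo''))) (W ''cgjkllllp''))) (B 9 6 (C ''mi'' (W ''cfllooooo'')) (W
    ''cfllllppp''))) (W ''chhhppppp''))) (B 3 2 (B 4 3 (B 6 4 (C ''lhhckg'' (B 7 5 (C ''jheb'' (W ''cgjkllllp'')) (B
    9 8 (C ''li'' (B 4 2 (C ''hf'' (W ''cjjjjjnoo'')) (W ''cgjjjnnnn''))) (W ''cijjkkllp'')))) (W ''ciiillppp'')) (W
    ''cggkllppp'')) (W ''cfllllppp'')))) (W ''cjjjjjjpp''))) (W ''cjjjjjjj'')) (W ''chhhppppp'')) (W ''cllllllll''))
    (W ''cffpppppp''))"]) simp_all

lemma small_2: "solved small_cfg [0, 0, 0, 0, Suc 0, Suc 0, 5, 5, 5, 5, 6, 6, 7, 9] [0, Suc 0, Suc 0, 3, 5, 7, 8, 9, 9, 9, 9, 9, 9, 9]"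
  by (rule check_solved[where t = "B 7 7 (C ''da'' (B 1 1 (C ''eblhjfkg'' (B 4 4 (C ''dbki'' (B 9 9 (C ''dcgf'' (W ''fffiiippp'')) (W
    ''ffiiillll''))) (B 9 9 (C ''dbif'' (B 2 1 (C ''dcjg'' (W ''fffiillpp'')) (B 8 7 (B 4 5 (C ''gf'' (W
    ''efggiimnp'')) (W ''efgggkppp'')) (W ''efggikkop'')))) (W ''fggglllll'')))) (B 3 3 (B 4 5 (C ''kgjfmh'' (B 4 3
    (C ''liifjg'' (B 3 2 (C ''ji'' (B 7 6 (C ''eb'' (W ''dgiiiklll'')) (W ''djjjjjlll''))) (W ''dfiiillnn''))) (B 9
    9 (B 5 6 (B 5 5 (B 3 2 (C ''khifjg'' (B 4 4 (C ''gfli'' (W ''diiiiimmn'')) (W ''dhhhlllpp''))) (B 9 7 (B 4 4 (C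
    ''gf'' (W ''dfiiiippp'')) (W ''dfhhllppp'')) (W ''dfhllllpp''))) (W ''dhhhhpppp'')) (W ''dhhhhhpp'')) (W
    ''dhhllllll'')))) (W ''dhhhhpppp'')) (W ''dffllpppp'')))) (B 3 3 (B 4 5 (B 1 1 (C ''kh'' (B 2 1 (C ''ebli'' (B 4
    4 (C ''ihki'' (B 5 7 (B 3 2 (C ''iigfhh'' (B 5 6 (B 5 5 (B 3 1 (C ''ghec'' (W ''gggiiiinn'')) (B 6 7 (C ''ec''
    (W ''fggiikkkk'')) (W ''fiiiiiill''))) (W ''gghhhjjjn'')) (W ''gghhhjjjn''))) (B 6 7 (C ''ii'' (W
    ''ffjjjjjll'')) (W ''ffiiiiipp''))) (W ''hhhhhhhpp''))) (W ''ggggijjmn''))) (B 7 9 (B 4 3 (C ''lijh'' (B 5 7 (B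
    3 2 (C ''gfji'' (B 6 7 (C ''hheb'' (W ''egiiiijjo'')) (W ''fiiiiiill''))) (B 6 7 (C ''ji'' (W ''ffjjjjjll'')) (W
    ''ffiiiiipp''))) (W ''hhhhhhhpp''))) (B 12 9 (C ''ggdb'' (W ''ffiiiiipp'')) (W ''eggjjjjoo''))) (W
    ''ejjjjjjjj'')))) (B 4 2 (B 7 8 (C ''ki'' (W ''diiiijjmm'')) (W ''diiiijjjp'')) (W ''dhjjjjjpp''))) (W
    ''gggggjjpp'')) (W ''fffiillpp''))"]) simp_all

text \<open>The boxes of \<open>small_1\<close> and \<open>small_2\<close> are exactly those that
  reach the leaves \<open>H\<close> of this tree, and the lemmas close them as rewrite rules. For
  this purpose the entry 1 is written \<open>Suc 0\<close>, its simplification normal form.\<close>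

lemma small_3: "solved small_cfg [0, 0, 0, 0, Suc 0, Suc 0, Suc 0, 2, 2, 4, 4, 4, 4, 7] [Suc 0, Suc 0, Suc 0, 5, 6, 7, 8, 9, 9, 9, 9, 9, 9, 9]"
  by (rule check_solved[where t = "C ''ic'' (B 6 5 (C ''da'' (B 13 9 (C ''baebkfhcid'' (B 0 1 (C ''dcnhjh'' (W ''dfflllll'')) (B 3 4 (C ''nh'' (B 7
    8 (C ''kgjf'' (B 3 3 (C ''ifgchdlh'' (B 4 4 (C ''ig'' (B 4 3 (C ''dbhe'' (W ''cfijjkkp'')) (W ''cggkkkkn''))) (W
    ''cgggoooo''))) (W ''cffllppp''))) (W ''cjjjjjjj''))) (W ''cfffppp'')))) H)) (B 13 9 (C ''da'' (B 0 1 (C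
    ''jfeb'' (B 13 8 (C ''badchgee'' (W ''dffhhll'')) (B 3 5 (C ''lgif'' (B 1 1 (C ''igechflh'' (B 4 6 (C ''jh'' (B
    3 4 (C ''gf'' (B 3 3 (C ''cahhed'' (W ''egggijjj'')) (W ''fffiiill''))) (W ''ffffllll''))) (W ''ggggggnn''))) (B
    3 4 (B 4 6 (B 6 8 (C ''ec'' (B 7 8 (C ''jglh'' (B 5 7 (B 5 6 (B 3 3 (C ''edjh'' (B 3 2 (C ''ggee'' (W
    ''dhhhhlll'')) (W ''dfhhllll''))) (B 4 4 (C ''jh'' (W ''dfflllll'')) (W ''dffhllpp''))) (W ''dhhhhhpp'')) (W
    ''dhhhhhpp''))) (W ''dhhjjjjj''))) (W ''diiiiiii'')) (W ''dhhhhhpp'')) (W ''dffhllpp'')))) (W ''fffffppp''))))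
    (B 3 3 (B 10 8 (B 4 6 (C ''jf'' (B 6 7 (C ''eb'' (B 13 8 (C ''hged'' (W ''cgggjjj'')) (B 3 2 (C ''edif'' (W
    ''cgggjkpp'')) (W ''cfiiippp'')))) (W ''ciiiiii''))) (W ''cggggg'')) (W ''ciiiimmm'')) (W ''cffiipp'')))) (B 0 1
    (B 3 5 (B 3 4 (B 4 6 (C ''kfmg'' H) (W ''ggggggppp'')) (W ''ffffipppp'')) (W ''fffffppp'')) (W ''ciiiipppp''))))"]) (simp_all add: small_1 small_2)

lemma small_4: "solved small_cfg [0, 0, 2, 2, 2, 2, 2, 2, 2, 3, 3, 3, 3, 7] [Suc 0, 2, 3, 3, 3, 7, 7, 7, 8, 9, 9, 9, 9, 9]"
  by (rule check_solved[where t = "B 13 9 (C ''kdic'' (B 0 1 (C ''kfidhcje'' (B 13 8 (C ''baigecgdhf'' (B 1 2 (C ''ccgg'' (W ''eeejjjj'')) (B 3 3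
    (C ''gg'' (W ''ddjjjjj'')) (W ''ddfllll'')))) (C ''gc'' (B 1 2 (C ''ifkghd'' (B 1 1 (C ''dcge'' (B 7 7 (C
    ''ihcc'' (W ''eeelllll'')) (W ''eefiijjp''))) (B 2 3 (C ''gdhelhjg'' (B 5 7 (B 5 6 (B 6 6 (C ''ec'' (B 7 7 (C
    ''ih'' (W ''degijkkk'')) (W ''dehjjjjp''))) (B 3 3 (C ''jh'' (W ''dfiiiill'')) (W ''defiijlp''))) (W
    ''dhhhhhpp'')) (W ''dhhhhhpp''))) (W ''deekkkpp'')))) (B 3 3 (B 7 7 (B 7 6 (C ''jh'' (W ''ddllllll'')) (W
    ''ddjjjjpp'')) (W ''ddjjjjj'')) (W ''ddfllppp'')))))) (B 7 7 (B 9 8 (C ''me'' (B 13 8 (C ''gcjeidlf'' (B 1 2 (C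
    ''dc'' (B 6 5 (C ''ig'' (W ''cffllll'')) (W ''cffiipp''))) (B 6 5 (C ''ec'' (B 8 7 (C ''dc'' (B 10 7 (C ''cche''
    (W ''cdejjpp'')) (W ''cdfmmmm''))) (W ''cdikkkk''))) (W ''cdiiipp'')))) (B 6 6 (B 6 5 (C ''hc'' (B 3 3 (C
    ''idlfke'' (B 1 2 (C ''if'' (B 6 4 (C ''eckh'' (W ''cfgklloo'')) (W ''cfiillpp''))) (B 8 6 (B 6 4 (B 9 7 (C
    ''gckf'' (W ''cdimmmpp'')) (W ''cdjklllp'')) (W ''cdiipppp'')) (W ''cdkkkkpp'')))) (B 9 5 (B 1 2 (C ''kh'' (W
    ''cffooooo'')) (W ''cdfmpppp'')) (W ''cffllppp'')))) (W ''cfiiippp'')) (W ''cfiiippp'')))) (W ''cfllllll'')) (W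
    ''cejjjjj'')))) (B 7 7 (B 0 1 (C ''kdicle'' (B 1 2 (C ''hclfjdke'' (B 3 3 (C ''idiejflg'' (B 1 1 (C ''gdkhheif''
    (B 9 9 (C ''gehfli'' (W ''eejjjjooo'')) (W ''eejjjllll''))) (B 7 6 (B 8 8 (C ''gc'' (B 9 9 (C ''hdlhkg'' (B 4 3
    (C ''gdhe'' (B 8 7 (C ''kigejg'' (W ''dfiiillnn'')) (W ''dejjjkkpp''))) (W ''degjllmop''))) (W ''dflllllll'')))
    (W ''dekkkkkkp'')) (W ''dejjjjppp'')))) (B 7 6 (B 9 9 (B 1 1 (C ''kgidiemh'' (B 5 5 (B 2 3 (C ''gd'' (B 9 8 (C
    ''igge'' (W ''fffiillpp'')) (W ''eefjllllp''))) (B 7 4 (C ''ih'' (W ''eeelllll'')) (W ''eeejooopp''))) (W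
    ''eehhhpppp''))) (B 9 5 (C ''cc'' (W ''deepppppp'')) (W ''dffllpppp''))) (W ''fffllllll'')) (W ''eefjjjppp''))))
    (B 9 6 (B 4 3 (C ''gd'' (W ''ddiiopppp'')) (W ''ddhpppppp'')) (W ''ddlllpppp'')))) (B 9 6 (B 4 3 (B 6 4 (C
    ''kdle'' (B 10 9 (C ''icmf'' (B 1 2 (C ''hdmi'' (W ''cfllooooo'')) (B 10 5 (C ''id'' (W ''cdkkppppp'')) (W
    ''cdmmmpppp'')))) (W ''cfmmmmmmm''))) (W ''cfiippppp'')) (W ''cegpppppp'')) (W ''cfllllppp''))) (W
    ''eejjjjjpp''))"]) simp_all

text \<open>The last entries count all periods: this is the part of the search with five to nine
  periods. The root finds any smaller number light.\<close>

lemma small_5: "solved small_cfg [0, 0, 0, 0, Suc 0, Suc 0, Suc 0, 2, 2, 3, 3, 3, 3, 5] [Suc 0, 3, 4, 5, 6, 7, 8, 9, 9, 9, 9, 9, 9, 9]"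
  by (rule check_solved[where t = "B 13 7 (C ''bahddbec'' (B 2 3 (C ''genfjfed'' (B 0 1 (C ''bbde'' (W ''ddffll'')) (B 3 4 (C ''bbgf'' (W
    ''cdiiii'')) (W ''cfffll'')))) (B 4 6 (C ''le'' (B 0 1 (C ''nfheed'' (B 1 3 (C ''if'' (B 3 5 (C ''cdbb'' (W
    ''ddffll'')) (W ''deeffl''))) (W ''dddhpp''))) (B 7 6 (B 3 5 (B 13 6 (C ''bcge'' (W ''cddii'')) (C ''gd'' (B 1 3
    (C ''ieed'' (B 1 2 (C ''cdee'' (W ''ceeegp'')) (B 2 4 (C ''ge'' (W ''cdegip'')) (W ''cdeepp'')))) (W
    ''cddipp'')))) (W ''cffff'')) (W ''ceejjj'')))) (W ''eeeggg'')))) (B 1 3 (B 2 2 (C ''jd'' H) (B 8 9 (B 7 8 (B 4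
    4 H (B 12 9 (B 0 1 (B 13 8 (C ''ie'' (B 1 2 (C ''kfhe'' (B 2 4 (C ''ifgemg'' (B 1 1 (C ''dcig'' (B 3 5 (C ''gf''
    (B 4 6 (C ''ccdd'' (W ''eeefiio'')) (W ''eefgggo''))) (W ''fffffll''))) (B 3 5 (B 4 6 (C ''dcjg'' (B 3 4 (C
    ''hg'' (B 2 3 (C ''ee'' (W ''dffhhll'')) (W ''eeejjjj''))) (W ''dffflll''))) (W ''degghhp'')) (W ''dfffhpp''))))
    (W ''eeeejpp''))) (B 3 4 (B 9 7 (C ''ee'' (W ''ddhhhpp'')) (W ''ddhhlll'')) (W ''ddffppp'')))) (B 1 2 (B 2 4 (B
    3 5 (B 4 6 (C ''le'' (B 13 9 (C ''jelf'' (B 5 7 (B 7 6 (C ''mg'' (B 1 1 (C ''jgdckh'' (B 3 4 (C ''gecc'' (W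
    ''eeejjooo'')) (W ''eeffllmm''))) (B 2 3 (B 3 4 (C ''jg'' (B 3 3 (C ''ee'' (W ''degghppp'')) (W ''dffhllpp'')))
    (W ''dfffpppp'')) (W ''deegpppp'')))) (B 1 1 (B 2 3 (C ''mh'' (W ''eeggjjoo'')) (W ''eeejjjpp'')) (W
    ''dehhjjpp''))) (W ''eeghhhpp''))) (B 1 1 (B 2 3 (C ''jf'' (B 6 6 (B 3 4 (C ''jghe'' (W ''eeggjnopp'')) (W
    ''ffffllppp'')) (W ''eeggjjppp''))) (W ''eeegppppp'')) (W ''dehhppppp'')))) (W ''eeghhhpp'')) (W ''fffffppp''))
    (W ''eeeepppp'')) (W ''ddhhpppp''))) (B 13 8 (B 3 4 (B 6 6 (B 9 7 (C ''je'' (B 1 2 (C ''cc'' (B 6 5 (C ''hf'' (W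
    ''ceejjj'')) (W ''cffiipp''))) (B 3 3 (C ''ge'' (W ''cdiiipp'')) (W ''cdfhmpp'')))) (W ''cfgglll'')) (W
    ''cfghiip'')) (W ''cfffppp'')) (W ''ceggpppp''))) (W ''eeggooooo''))) (W ''eejjjjjj'')) (W ''eekkkkkkk''))) (W
    ''dddpppp''))"]) (simp_all add: small_3 small_4)

lemma small_6: "solved small_cfg [0, 0, 0, 0, 0, Suc 0, Suc 0, Suc 0, 3, 8, 8, 8, 8, 11] [0, 0, Suc 0, Suc 0, 3, 4, 4, 4, 10, 11, 11, 11, 11, 11]"
  by (rule check_solved[where t = "B 6 3 (C ''eali'' (B 2 1 (C ''kjhbidie'' (B 8 8 (C ''dakkjj'' (B 4 2 (C ''jk'' (W ''fllllllllll'')) (W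
    ''fhlllllllpp''))) (B 3 1 (C ''kk'' (B 4 2 (C ''ij'' (W ''gjkkkkkkkmn'')) (W ''ggkkkkkmnnn''))) (B 9 11 (B 4 2
    (C ''iilk'' (W ''gjkkkkkkkmn'')) (B 9 9 (C ''hc'' (W ''fgjkkkkknop'')) (W ''fhlllllllpp''))) (W
    ''fllllllllll''))))) (B 8 10 (B 8 9 (C ''hb'' (B 8 8 (B 9 11 (C ''ljidki'' (B 4 2 (C ''lk'' (B 8 7 (C ''gbhcie''
    (B 7 4 (C ''jj'' (W ''ejjkklllllo'')) (W ''ejjjklllmno''))) (W ''ejkkkkklnoo''))) (B 8 6 (C ''lk'' (W
    ''egllllloooo'')) (W ''egkkkklmnnp'')))) (W ''fllllllllll'')) (W ''ekkkkkkkopp''))) (W ''ekkkkkkkopp'')) (W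
    ''ekkkkkkkopp'')))) (B 9 11 (B 3 1 (C ''kiid'' (B 4 3 (C ''ljieif'' (B 5 4 (B 4 2 (C ''ihhdlkjikj'' (B 5 3 (B 4
    1 (C ''ijgd'' (W ''hiiikkkkkln'')) (B 8 9 (C ''gdjj'' (W ''giiikkkkllp'')) (W ''gjkkkkkkkmn''))) (W
    ''hhhllllllpp''))) (B 8 10 (B 8 9 (C ''hdlkkj'' (W ''ggijklllmmn'')) (W ''ggkkkkkkkpp'')) (W ''ggkkkkkkkpp'')))
    (W ''hhhhlllpppp''))) (W ''gggkllllppp''))) (B 9 9 (B 4 3 (B 6 4 (C ''idmj'' (B 2 1 (C ''kjeb'' (W
    ''fgillllmmmp'')) (B 8 8 (C ''li'' (B 5 3 (B 8 6 (C ''lk'' (B 4 2 (C ''kkhd'' (W ''eiijllmmmmm'')) (W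
    ''egllllloooo''))) (B 4 2 (C ''lk'' (B 8 7 (C ''kk'' (W ''eikkkkllmmm'')) (W ''ejkkkkklnoo''))) (W
    ''fgikkkllnpp''))) (W ''fhhllllpppp''))) (W ''ekkkkkkkopp'')))) (W ''fiiillllppp'')) (W ''fhhllllpppp'')) (W
    ''fiillllllpp''))) (W ''iiillllllll''))"]) simp_all

lemma small_7: "solved small_cfg [0, 0, 0, 0, 0, Suc 0, Suc 0, Suc 0, 2, 3, 4, 4, 8, 10] [0, 0, Suc 0, Suc 0, 4, 4, 4, 4, 10, 11, 11, 11, 11, 11]"
  by (rule check_solved[where t = "C ''keicjdlf'' (B 13 11 (C ''jgkigbeahcidjhmj'' (B 4 3 (C ''caigjj'' (B 6 4 (C ''ij'' (W ''ekkkkkkkkk'')) (W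
    ''fiiillllll''))) (B 2 1 (C ''iggdjj'' (B 3 1 (C ''ed'' (W ''hhhhllllll'')) (W ''fiiillllll''))) (B 8 7 (C
    ''gd'' (B 4 4 (C ''jj'' (W ''fiiillllll'')) (W ''fggglllppp''))) (W ''eggkkkoooo''))))) (B 4 4 (C ''kflg'' (B 9
    8 (C ''gbeahcmi'' (B 2 1 (C ''ebjfgcliidljkgkhmk'' (B 3 1 (C ''igec'' (W ''gggkkkknnnp'')) (B 4 3 (C ''gdie'' (W
    ''fgiiklmmppp'')) (W ''fgglllmnppp'')))) (B 5 4 (B 8 5 (C ''gclikgmj'' (B 4 3 (C ''hdlk'' (B 4 2 (C ''kkjf'' (W
    ''eiijllmmmmm'')) (W ''egjjnnooooo''))) (B 8 4 (C ''kk'' (W ''gggnnnnnnnn'')) (W ''eggkmmnnnop'')))) (B 4 3 (C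
    ''likgmj'' (B 6 4 (C ''jfkhljmk'' (B 4 2 (C ''gckj'' (B 8 7 (C ''hdkk'' (W ''eiijllmmmmm'')) (W
    ''ejjkkkkmmoo''))) (W ''egkkkmnnnoo''))) (B 4 2 (C ''jf'' (B 10 11 (C ''ifjg'' (B 10 9 (C ''lkig'' (W
    ''eiijkkknnno'')) (W ''fiiikklmmop''))) (W ''eiijllmmmmm''))) (B 11 10 (C ''if'' (W ''egiikknnopp'')) (W
    ''egiikmmnnnp''))))) (W ''eggkknooopp''))) (W ''ehhhppppppp'')))) H)) (W ''ggggnnppppp'')))"]) (simp_all add: small_6)

lemma small_8: "solved small_cfg [0, 0, 0, 2, 2, 2, 2, 2, 2, 3, 4, 4, 5, 10] [0, 0, 2, 3, 4, 4, 4, 4, 9, 9, 10, 11, 11, 11]"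
  by (rule check_solved[where t = "B 13 11 (C ''ickelfjdmg'' (B 4 3 (C ''khcaidjejfmi'' (B 5 4 (B 2 2 (C ''iggc'' (B 9 9 (C ''kjih'' (W
    ''egkkkkkkoo'')) (W ''efikkllllp''))) (B 8 7 (C ''gcki'' (B 8 6 (C ''hdlj'' (W ''eejjoooooo'')) (W
    ''eejkkknnnp''))) (W ''eekkkkkppp''))) (W ''ffhhllpppp''))) (B 9 9 (B 9 8 (C ''id'' (B 2 2 (C ''lhjekfkgmi'' (B
    2 1 (C ''eddc'' (W ''fffhpppppp'')) (B 4 4 (C ''jf'' (B 3 3 (C ''kj'' (W ''efgkllnnnn'')) (W ''ffflllpppp'')))
    (W ''efggmnnnpp'')))) (B 4 4 (B 12 10 (C ''jf'' (B 3 3 (C ''ig'' (W ''eekkkkkppp'')) (W ''ffflllpppp''))) (W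
    ''eegooooooo'')) (W ''eeghpppppp'')))) (W ''ffhlllllpp'')) (W ''ffhlllllpp'')))) (B 3 3 (B 9 9 (B 9 8 (B 9 7 (C
    ''iclemf'' (B 2 2 (C ''hcjdlf'' (B 4 4 (C ''lgkemh'' (B 2 1 (C ''hdli'' (B 4 3 (C ''ifgd'' (W ''ffiillppppp''))
    (W ''ffgjnnnoopp''))) (B 10 10 (C ''id'' (B 5 4 (B 4 3 (C ''kflhmi'' (B 6 4 (C ''mk'' (B 9 6 (C ''hd'' (W
    ''egjjnnooooo'')) (W ''ffllllooooo''))) (B 9 6 (C ''mk'' (W ''egjjnnooooo'')) (W ''ffiillppppp'')))) (B 11 8 (C
    ''je'' (W ''ffhllpppppp'')) (W ''efglnnnnppp''))) (W ''ehhhppppppp''))) (W ''efklmmmmmmp'')))) (W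
    ''ggggnnppppp''))) (B 4 3 (B 8 5 (B 12 11 (C ''lh'' (B 7 4 (C ''je'' (W ''eekllnnnppp'')) (W ''eejjopppppp'')))
    (W ''eeooooooooo'')) (W ''eekkkpppppp'')) (W ''eehpppppppp'')))) (W ''fflllllpppp'')) (W ''fflllllpppp'')) (W
    ''fflllllpppp'')) (W ''fffpppppppp''))"]) simp_all

lemma small_9: "solved small_cfg [0, 0, 0, 0, 0, Suc 0, Suc 0, 5, 8, 8, 8, 8, 8, 10] [0, 0, Suc 0, Suc 0, 3, 6, 7, 9, 10, 10, 10, 10, 10, 10]"
  by (rule check_solved[where t = "B 3 1 (C ''gbgcli'' (B 4 2 (C ''gdjihflj'' (B 5 6 (B 6 6 (C ''jjhgii'' (B 5 5 (B 5 4 (B 4 1 (C ''higeij'' (W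
    ''hiiiijjjjk'')) (B 7 9 (C ''geij'' (W ''giiiijjkkk'')) (W ''giiijjjjjl''))) (W ''hhhhllllll'')) (W
    ''hhhhhlllpp''))) (B 9 10 (C ''hhea'' (W ''giiiiijjln'')) (W ''iiiiiillll''))) (W ''hhhhhhpppp''))) (B 7 9 (B 8
    10 (C ''hf'' (B 5 6 (B 6 5 (C ''kjec'' (W ''gggjjjnnnn'')) (B 5 5 (B 6 7 (C ''ki'' (B 4 3 (C ''kj'' (B 7 7 (C
    ''gf'' (W ''ggiiiimnnn'')) (W ''ggiiijjmnn''))) (W ''gggiijklmp''))) (B 10 9 (C ''ec'' (W ''gggiiiinn'')) (W
    ''ggiiiiilmp''))) (W ''hhhhhlllpp''))) (W ''hhhhhhpppp''))) (W ''ggjjjkkkkk'')) (W ''ggijjjjjjp'')))) (B 6 7 (B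
    6 6 (B 5 5 (B 6 3 (C ''jilj'' (B 2 1 (C ''hgjj'' (W ''fjjjjjllll'')) (B 7 7 (C ''jj'' (W ''ejjjjlllll'')) (W
    ''ejjjjjjooo'')))) (B 7 9 (B 2 1 (C ''li'' (B 5 4 (B 10 10 (C ''ebgdhf'' (B 4 3 (C ''iige'' (W ''fiiiikkkkp''))
    (W ''fggijjkkpp''))) (B 4 3 (B 7 7 (C ''jj'' (B 6 4 (C ''hf'' (W ''fjjjjjllll'')) (W ''fiiillllll''))) (B 6 4 (C
    ''jj'' (W ''fjjjjjllll'')) (W ''fiiijjjmmm''))) (W ''fggkklllmm''))) (W ''fhhhllllpp''))) (B 4 3 (B 9 10 (B 7 8
    (C ''li'' (B 5 4 (B 5 3 (B 4 2 (C ''gdkimj'' (B 7 7 (C ''ge'' (B 8 9 (C ''hfkj'' (W ''ejjjjjmmmm'')) (W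
    ''fiiiikkkkp''))) (W ''ejjjjjjooo''))) (B 12 10 (C ''hg'' (W ''egijjjjlnp'')) (W ''egkkkkkkoo''))) (W
    ''ehhjjkllpp'')) (W ''ehhjjkllpp''))) (W ''ejjjjjjjpp'')) (W ''ejjjjlllll'')) (W ''ehhjjkllpp''))) (W
    ''fiijjjjjjp''))) (W ''hhhhhlllpp'')) (W ''fiiiiillpp'')) (W ''fiiiiillpp''))"]) simp_all

lemma small_10: "solved small_cfg [0, 0, 0, 0, 0, Suc 0, Suc 0, 5, 5, 5, 5, 6, 7, 11] [0, 0, Suc 0, Suc 0, 3, 5, 6, 7, 7, 7, 11, 11, 11, 11]"
  by (rule check_solved[where t = "B 3 1 (C ''gbgcjflgmh'' (B 4 2 (C ''hfligdljkgkhmk'' (B 6 6 (C ''eaigkjlk'' (W ''giiijjlmmmn'')) (W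
    ''iiiiiiooooo''))) (B 6 6 (B 7 7 (C ''li'' (B 4 3 (C ''ki'' (B 6 5 (C ''kk'' (W ''ggjjjmmnnnn'')) (W
    ''ggiiinnnnpp''))) (W ''gggjjnnnnpp''))) (W ''hhjjjjjpppp'')) (W ''ggiiiinpppp'')))) (B 6 6 (B 5 5 (B 6 3 (C
    ''jfkglhmi'' (B 2 1 (C ''eblk'' (W ''ggjjjmmnnnn'')) (B 7 6 (C ''mk'' (W ''ejjjjoooooo'')) (W
    ''ejjjjjmpppp'')))) (B 7 7 (B 2 1 (C ''mikflg'' (B 10 9 (C ''jf'' (B 4 3 (C ''gdifkglhmj'' (B 5 4 (B 4 2 (C
    ''lkge'' (W ''giiiinnnnnn'')) (B 8 7 (C ''geli'' (W ''ggiiinnnnpp'')) (W ''fgiijkknppp''))) (W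
    ''fhhhlnnnoop''))) (B 9 7 (B 11 9 (C ''ge'' (W ''fggiinopppp'')) (W ''gggjjnnnnpp'')) (W ''fhhllllpppp'')))) (B
    4 3 (C ''mj'' (B 5 4 (B 8 6 (C ''lk'' (B 4 2 (C ''ge'' (W ''giiiinnnnnn'')) (W ''ggjjjmmnnnn''))) (B 6 4 (C
    ''lk'' (B 4 2 (C ''ighf'' (W ''fiijjjlmmpp'')) (W ''ggjjjmmnnnn''))) (W ''fiiijlmmmop''))) (W ''fhhhlnnnoop'')))
    (W ''gggjjnnnnpp'')))) (B 4 3 (B 12 11 (C ''kflgmh'' (B 5 4 (B 5 3 (B 8 6 (C ''khgdli'' (B 4 2 (C ''kjjf'' (W
    ''ejjjjlmmmpp'')) (W ''egjjjnnoopp''))) (B 10 10 (B 10 9 (B 4 2 (C ''gdkg'' (B 7 6 (C ''igge'' (W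
    ''fiiiillpppp'')) (W ''ejjjjjmpppp''))) (B 12 9 (C ''gdjg'' (B 6 5 (C ''hf'' (W ''ejjjjjmpppp'')) (W
    ''fiiiillpppp''))) (W ''egjjjnnoopp''))) (W ''ejjjjlmmmpp'')) (W ''ejjjjlmmmpp''))) (W ''ehhjjpppppp'')) (W
    ''ehhhppppppp''))) (W ''ejjjjoooooo'')) (W ''ehhjjpppppp''))) (W ''fiijjjjpppp''))) (W ''hhhhhpppppp'')) (W
    ''fiiiiippppp''))"]) simp_all

lemma small_11: "solved small_cfg [0, 0, 0, 0, 0, Suc 0, Suc 0, 5, 5, 8, 8, 8, 9, 11] [0, 0, 0, 0, 2, 3, 5, 8, 10, 10, 11, 11, 11, 11]"
  by (rule check_solved[where t = "B 6 3 (C ''kiifigmj'' (B 4 2 (C ''ihlj'' (B 7 7 (C ''jjea'' (B 8 10 (C ''kkii'' (W ''gjkkkkkkkmn'')) (W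
    ''gjjjkkkkkkp''))) (B 8 10 (C ''mk'' (B 7 8 (C ''ealk'' (W ''gjjjjjjmnnn'')) (W ''jjjjjjjjooo''))) (W
    ''hjjjjjjkkkp'')))) (B 7 7 (B 8 9 (C ''lk'' (W ''ggjjjmmnnnn'')) (W ''ggkkkkkkkpp'')) (W ''hhjjjjjpppp'')))) (B
    8 10 (B 7 7 (C ''li'' (B 4 2 (C ''kimj'' (B 8 7 (C ''lkgdkj'' (B 4 1 (C ''hfgeji'' (W ''iiiiillllpp'')) (B 6 5
    (C ''hf'' (W ''giiijjlmmmn'')) (W ''giiiinnnnnn'')))) (B 4 1 (C ''ljmk'' (B 6 5 (C ''ihjikjlk'' (B 5 3 (B 6 4 (C
    ''hfiijj'' (W ''hiijjjkkkln'')) (B 7 6 (C ''iijj'' (W ''hiiikkkkkln'')) (W ''hiiijjkklmo''))) (W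
    ''hhhllllllpp''))) (B 9 9 (C ''kk'' (W ''hiiiimmmmmm'')) (W ''iiiiillllpp'')))) (B 6 5 (C ''lj'' (B 6 4 (C
    ''lkjikj'' (B 8 9 (C ''hfkk'' (W ''giijjjkllmm'')) (W ''gjkkkkkkkmn''))) (B 10 11 (C ''ji'' (B 5 3 (B 8 9 (C
    ''kjmk'' (B 5 2 (B 7 6 (C ''ihjj'' (W ''giiikkkkllp'')) (B 8 8 (C ''jj'' (W ''giiijjklllp'')) (W
    ''hiiijjkklmo''))) (W ''ghiikkllloo''))) (B 10 10 (C ''hf'' (W ''giiijjkkkpp'')) (W ''giiijkkkkmp''))) (W
    ''hhhllllllpp''))) (W ''giiijkkmmmm'')))) (B 9 9 (C ''lk'' (W ''giiiinnnnnn'')) (W ''iiiiillllpp'')))))) (B 6 5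
    (B 11 11 (B 8 9 (C ''iflj'' (B 7 6 (C ''jjgd'' (W ''ggiijllmmmp'')) (W ''ggjjjjllnnp''))) (W ''ggkkkkkkkpp''))
    (W ''ggjjjmmnnnn'')) (W ''ggiiinnnnpp'')))) (B 4 2 (C ''li'' (B 6 5 (B 7 8 (C ''kimj'' (B 5 2 (B 4 1 (C ''ljmk''
    (B 8 9 (C ''kj'' (B 6 4 (C ''jjih'' (W ''hiijjjjkllp'')) (W ''hiiijjjlmmo''))) (W ''hiijjjjkkop''))) (B 11 11 (B
    8 9 (C ''gdkjji'' (W ''giiijjjllmp'')) (W ''hiijjjjkkop'')) (W ''gjjjjjjmnnn''))) (W ''hhjjjjjpppp''))) (W
    ''hiijjjjjnpp'')) (W ''hiiiijjnnpp''))) (W ''hhjjjjjpppp''))) (W ''hiijjkkkkkp''))"]) simp_all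

lemma small_12: "solved small_cfg [0, 0, 0, 0, 0, Suc 0, Suc 0, 5, 5, 5, 5, 6, 6, 10] [0, 0, Suc 0, Suc 0, 4, 7, 7, 9, 10, 10, 11, 11, 11, 11]"
  by (rule check_solved[where t = "B 13 11 (C ''jfkg'' (B 8 8 (C ''eagbgc'' (B 5 7 (B 2 1 (C ''gdlhjgmi'' (B 4 3 (C ''hfkigelj'' (B 6 7 (C ''daji''
    (B 6 6 (C ''jj'' (W ''fiiillllll'')) (W ''fiiiiillpp''))) (W ''giiiiiimnn''))) (B 6 6 (C ''khlimj'' (B 3 1 (C
    ''hfkj'' (W ''gggjjjnnnn'')) (B 4 4 (C ''kjjh'' (W ''fggkklllmm'')) (W ''fggglllppp'')))) (W ''gggiiimnpp''))))
    (B 6 7 (B 9 10 (C ''mh'' (B 5 6 (B 4 3 (C ''ligdifjgkh'' (B 5 5 (B 6 6 (C ''kimj'' (B 7 7 (C ''ebge'' (B 7 6 (C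
    ''ig'' (W ''egiijkkmno'')) (W ''egijjjnnoo''))) (W ''ejjjjjjooo''))) (B 9 8 (C ''lj'' (B 4 2 (C ''hg'' (W
    ''ejjjjjjooo'')) (W ''egijjjnnoo''))) (W ''fiiiiillpp''))) (W ''ehhhhppppp''))) (B 6 6 (B 12 10 (B 7 7 (C
    ''edjg'' (W ''fggglllppp'')) (W ''eggjjjjopp'')) (W ''eggjjooooo'')) (W ''eggiiioopp''))) (W ''hhhhhhpppp'')))
    (W ''ejjjjlllll'')) (W ''fiiiiiippp''))) (W ''hhhhhhpppp''))) (B 4 4 (B 5 7 H (W ''hhhhhhpppp'')) (W
    ''ggggkkkopp'')))) (B 4 4 (B 6 7 (B 7 9 (C ''mg'' (B 9 8 (B 5 6 H (W ''hhhhhhpppp'')) (B 4 3 (B 6 6 (B 3 1 (C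
    ''mi'' (B 5 5 (B 5 4 H (W ''hhhhlllpppp'')) (W ''hhhhhlllpp''))) (B 9 9 (B 7 7 (B 6 5 (B 6 4 (B 2 1 (C ''gbli''
    (B 7 6 (C ''ljif'' (B 10 11 (C ''ebgc'' (W ''fgikkkllnpp'')) (W ''fjjjkkllmnn''))) (W ''fjjjjjllnpp''))) (B 11
    10 (C ''gb'' (B 7 6 (B 8 8 (C ''ebmi'' (W ''egjjjnnoopp'')) (W ''ejjjkkkkppp'')) (W ''ejjjjjmpppp''))) (W
    ''ejjjjlllnnp''))) (W ''fiiillllppp'')) (W ''fiiillllppp'')) (W ''fjjjjjjlppp'')) (W ''fjjjjllllpp''))) (W
    ''iiiiiillppp'')) (W ''gggkllllppp'')))) (W ''jjjjjjjjjpp'')) (W ''iiiiiiipppp'')) (W ''ggggnnppppp''))"]) (simp_all add: small_9 small_10 small_11)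

lemma small_13: "solved small_cfg [0, Suc 0, Suc 0, Suc 0, Suc 0, Suc 0, 3, 3, 3, 3, 3, 4, 4, 10] [0, Suc 0, 2, 3, 3, 5, 5, 5, 8, 9, 10, 11, 11, 11]"
  by (rule check_solved[where t = "B 13 11 (C ''lekd'' (B 3 2 (C ''idjekflgmh'' (B 5 5 (B 5 4 (B 7 5 (C ''jf'' (B 4 3 (C ''khlijg'' (B 5 3 (B 8 6
    (C ''gdkj'' (W ''diiimmmmnn'')) (B 6 4 (C ''lj'' (B 4 2 (C ''ih'' (W ''diikkkklnn'')) (W ''dhikkllnno''))) (W
    ''diiikklnop''))) (W ''dhhlllpppp''))) (W ''dhhlllpppp''))) (B 4 3 (B 8 8 (B 9 9 (B 9 8 (C ''kglhmi'' (B 5 3 (B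
    4 2 (C ''ljgdkh'' (W ''diiimmmmnn'')) (B 6 5 (C ''lj'' (B 9 7 (C ''kjgd'' (W ''diiimmmmnn'')) (W
    ''dhikkllnno''))) (W ''dhiiippppp''))) (W ''dhhjjppppp''))) (W ''djjjjlllpp'')) (W ''djjjjlllpp'')) (W
    ''djjjjlllpp'')) (W ''dhhjjppppp''))) (W ''dhhhpppppp'')) (W ''dhhhhpppp''))) (B 9 6 (B 6 5 (B 10 10 (C ''mf''
    (B 3 3 (C ''idmhkelf'' (B 2 2 (C ''kg'' (B 4 3 (C ''helj'' (W ''dflllnnnnn'')) (W ''dfgkmmmppp''))) (B 7 4 (C
    ''kg'' (W ''demmmmmppp'')) (W ''dejjpppppp'')))) (W ''dffnnopppp''))) (W ''dfmmmmmmmm'')) (W ''dhiiippppp'')) (W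
    ''dfllllpppp'')))) (B 4 3 (B 2 2 (B 7 5 (B 8 8 (C ''le'' (B 8 7 (B 9 9 (B 9 8 (C ''kd'' (B 9 7 (B 10 10 (B 10 9
    (C ''mf'' (B 5 4 (B 3 2 (C ''jdkelfmgmh'' (B 5 3 (B 7 4 (C ''mjje'' (B 4 2 (C ''lkkf'' (W ''diimmmnnnnn'')) (W
    ''dhlllpppppp''))) (B 4 2 (B 11 11 (C ''jekflg'' (B 6 4 (C ''lijf'' (W ''djjkllnnnpp'')) (W ''diiimnnpppp'')))
    (W ''dijjmnnnnoo'')) (W ''dhjjppppppp''))) (W ''dhhpppppppp''))) (B 12 7 (C ''if'' (W ''dfllllpppp'')) (W
    ''dfimnoopppp''))) (W ''ehhhppppppp''))) (W ''diimmmmmnpp'')) (W ''djjmmmmmmmp'')) (W ''dllllllpppp''))) (W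
    ''dllllllpppp'')) (W ''dllllllpppp'')) (W ''dllllllpppp''))) (W ''dllllllpppp'')) (W ''djjjjpppppp'')) (W
    ''deppppppppp'')) (W ''dhhpppppppp''))"]) simp_all

lemma small_14: "solved small_cfg [0, Suc 0, Suc 0, Suc 0, Suc 0, Suc 0, Suc 0, Suc 0, Suc 0, 2, 2, 3, 3, 10] [Suc 0, Suc 0, 2, 3, 3, 5, 5, 5, 9, 9, 10, 11, 11, 11]"
  by (rule check_solved[where t = "B 0 1 (C ''ibldkc'' (B 6 3 (C ''lekdmf'' (B 13 11 (C ''gbicjdjekflgmh'' (B 3 2 (C ''ifjh'' (B 4 2 (C ''he'' (W
    ''djjjjlllpp'')) (W ''dhllllllpp''))) (B 9 6 (C ''lj'' (W ''dflllnnnnn'')) (W ''dfllllpppp'')))) (B 2 2 (B 9 9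
    (B 9 8 (B 9 7 (B 7 5 (C ''hbjckelfmgmh'' (B 4 2 (C ''idlihc'' (B 9 6 (C ''kj'' (W ''djjmmmmmmmp'')) (W
    ''djjkllnnnpp''))) (B 9 5 (B 10 8 (C ''hd'' (W ''dhjjppppppp'')) (W ''dhmmmmmpppp'')) (W ''dhlllpppppp'')))) (W
    ''djjjjpppppp'')) (W ''dllllllpppp'')) (W ''dllllllpppp'')) (W ''dllllllpppp'')) (W ''deppppppppp'')))) (B 8 9 H
    (W ''diikkllllp'')))) (B 4 3 (B 2 2 (B 9 9 (B 6 5 (B 9 8 (B 9 7 (B 6 4 (B 12 11 (C ''ldkc'' (B 10 10 (C ''ib''
    (B 13 11 (C ''hblejckdmf'' (B 5 3 (B 4 2 (C ''idhcmh'' (B 7 5 (C ''lh'' (B 8 6 (C ''gb'' (B 9 6 (C ''kg'' (B 6 3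
    (C ''ki'' (W ''cimmmmmmpp'')) (W ''ciilmmpppp''))) (W ''cillllpppp''))) (W ''cjjkkkoopp''))) (W
    ''cjjjjooopp''))) (B 9 6 (B 7 5 (B 12 10 (C ''ic'' (B 10 9 (C ''hc'' (B 10 8 (C ''id'' (B 3 2 (C ''li'' (W
    ''cgjlnnnnpp'')) (W ''cfllpppppp''))) (W ''cimmmmmmpp''))) (W ''cimmmmmmpp''))) (W ''cgoooooooo'')) (W
    ''cijjjppppp'')) (W ''cillllpppp''))) (W ''chhppppppp''))) (B 7 3 (B 4 2 (B 10 6 (C ''je'' (W ''cllllpppppp''))
    (W ''cmmmmmppppp'')) (W ''chppppppppp'')) (W ''cjjoppppppp'')))) (W ''cmmmmmmmmm''))) (W ''coooooooooo'')) (W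
    ''ciiipppppp'')) (W ''cllllllppp'')) (W ''cllllllppp'')) (W ''ciiiipppp'')) (W ''cllllllppp'')) (W
    ''cepppppppp'')) (W ''chhppppppp''))"]) (simp_all add: small_13)

text \<open>Ten or eleven periods. The first split asks for a period up to 4;
  \<open>small_14\<close> has one, whereas \<open>small_7\<close>, \<open>small_8\<close> and
  \<open>small_12\<close> have none.\<close>

lemma small_15: "solved small_cfg [0, 0, 0, 0, 0, Suc 0, Suc 0, Suc 0, Suc 0, 2, 2, 3, 3, 10] [Suc 0, Suc 0, 2, 3, 4, 7, 7, 9, 10, 11, 11, 11, 11, 11]"
  by (rule check_solved[where t = "B 1 1 (C ''jckdibme'' (B 7 5 (B 3 2 (C ''mh'' H) (B 10 11 (B 9 10 H (W ''ffllllllll'')) (W ''ffmmmmmmmmm''))) (B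
    9 11 (B 3 2 (C ''lf'' H) (B 9 10 (B 6 7 (B 7 9 (B 6 6 (B 7 8 (B 10 11 (B 13 11 (C ''lf'' (B 9 7 (C ''gc'' (B 2 2
    (C ''mhkf'' (B 2 1 (C ''ecgdkgli'' (B 4 4 (C ''dcif'' (W ''ffflllpppp'')) (W ''ffggjnnnpp''))) (B 4 4 (C
    ''lhmi'' (B 5 5 (B 3 3 (C ''lj'' (B 4 3 (C ''hf'' (W ''egijjjnnoo'')) (W ''eggjjooooo''))) (B 9 6 (C ''kh'' (W
    ''effjjmmmpp'')) (W ''ffflllpppp''))) (W ''ehhhhppppp''))) (W ''efggjnoppp'')))) (B 4 3 (C ''mh'' (W
    ''eejjjooopp'')) (W ''eegjjopppp'')))) (B 2 2 (B 3 3 (B 4 4 (B 6 5 (C ''lh'' (B 2 1 (C ''iggc'' (B 7 7 (C ''ki''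
    (B 8 9 (C ''ecjh'' (W ''ffhlllllpp'')) (W ''ffikkkkkkp''))) (W ''ffijjjjppp''))) (B 7 7 (B 8 9 (B 10 10 (C
    ''gc'' (B 9 9 (C ''if'' (B 4 3 (C ''jhgd'' (W ''ffiillllpp'')) (W ''efgjjkmnpp''))) (W ''efikkllllp''))) (W
    ''efjjjllmoo'')) (W ''egjjjkkkkp'')) (W ''efjjjjjppp'')))) (W ''ffiiillppp'')) (W ''fggglllppp'')) (W
    ''ffflllpppp'')) (W ''eejjjllppp'')))) (B 9 7 (B 4 3 (B 2 2 (B 6 5 (C ''mh'' (B 10 10 (C ''lf'' (B 2 1 (C
    ''lijf'' (B 6 4 (C ''lk'' (W ''ffllllooooo'')) (W ''ffiillppppp''))) (B 11 9 (B 7 6 (C ''gcmi'' (W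
    ''egijjnooopp'')) (W ''efjjjjppppp'')) (W ''egjjjnnoopp'')))) (W ''ffjjjmmmmpp''))) (W ''ffiiipppppp'')) (W
    ''eekkkpppppp'')) (W ''ffhllpppppp'')) (W ''fflllllpppp''))) (W ''ggjjjmmnnnn'')) (W ''ffjjjjllpp'')) (W
    ''ffiiiipppp'')) (W ''ffjjjjjll'')) (W ''ffiiiiipp'')) (W ''ffllllllll''))) (W ''jjjjjllllll'')))) (B 6 7 (B 7 9
    (B 4 4 (B 6 6 (B 7 8 (B 10 11 (B 9 10 (B 7 7 (B 7 6 H (W ''djjjjjpppp'')) (W ''djjjjjpppp'')) (W
    ''dlllllllll'')) (W ''dmmmmmmmmmm'')) (W ''djjjjlllpp'')) (W ''djjjjjpppp'')) (W ''dhhhpppppp'')) (W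
    ''djjjjlllpp'')) (W ''djjjjjpppp''))"]) (simp_all add: small_7 small_8 small_12 small_14)

lemma small_16: "solved small_cfg [0, 0, 0, 0, 0, Suc 0, Suc 0, Suc 0, Suc 0, 2, 3, 4, 4, 12] [0, 0, 0, 2, 3, 4, 4, 4, 4, 4, 12, 13, 13, 13]"
  by (rule check_solved[where t = "B 13 13 (C ''gbeamhjckdlelf'' (B 5 4 (B 6 3 (C ''dalieb'' (B 11 12 (C ''khiddb'' (W ''ffllpppppppp'')) (W
    ''ggnnnnnnnnnn''))) (B 11 12 (B 3 2 (C ''mjjdlg'' (B 4 3 (C ''khda'' (B 10 9 (C ''gd'' (W ''fiiimmnnpppp'')) (W
    ''fiimmmmmmppp''))) (W ''gggnnnnppppp''))) (B 9 4 (C ''kh'' (W ''ffimmmpppppp'')) (W ''ffllpppppppp''))) (W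
    ''giinnnnnnnnn''))) (W ''hhhhpppppppp''))) (B 4 3 (C ''ib'' (B 10 12 (B 10 11 (C ''me'' (B 5 4 (B 4 2 (C
    ''mfkdlemgmh'' (B 7 3 (C ''lieamkke'' (B 11 13 (C ''hbjckfkg'' (B 5 2 (B 3 1 (C ''idgb'' (W ''gikkmmnnnpppp''))
    (B 6 2 (C ''ki'' (W ''fjmmmmmmmoppp'')) (W ''filmmmnnnoopp''))) (W ''hhmmmmmpppppp''))) (W ''gnnnnnnnnnnnn'')))
    (B 5 3 (B 11 9 (C ''eagbjd'' (B 3 1 (C ''hdkfgcmklg'' (W ''hjjjmmnoooopp'')) (B 6 4 (B 10 8 (C ''id'' (B 10 7 (C
    ''mkgc'' (B 11 7 (C ''kf'' (W ''fiilmmopppppp'')) (W ''fiinnnnpppppp''))) (W ''fijlmmmpppppp''))) (W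
    ''fijlmmmpppppp'')) (W ''fiiippppppppp'')))) (B 6 4 (B 3 1 (C ''mj'' (B 10 7 (C ''gbmljdlj'' (B 4 1 (C ''hdgc''
    (W ''hiijnoooooopp'')) (B 11 11 (C ''hd'' (W ''gjjjnnnnnnppp'')) (W ''ginnnnnnnnnpp'')))) (B 12 13 (C ''gb'' (B
    10 10 (C ''jd'' (B 5 2 (B 4 1 (C ''llhd'' (W ''hjjjmmnoooopp'')) (B 8 4 (C ''gc'' (W ''giimnnnnnpppp'')) (W
    ''gikkmmnnnpppp''))) (W ''hhmmmmmpppppp''))) (W ''hijmmmmmmmppp''))) (W ''hjjmmmmnnoooo'')))) (B 12 11 (B 6 3 (C
    ''kg'' (B 6 2 (C ''hd'' (W ''fjjjnnooopppp'')) (W ''fikmmnnnnpppp''))) (W ''giimnnnnnpppp'')) (W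
    ''fjjnnnnnnoopp''))) (W ''hiiinnnnppppp''))) (W ''hhhpppppppppp'')))) (B 11 9 (B 7 4 (B 11 8 (C ''dajc'' (B 11 7
    (C ''ickd'' (B 12 13 (C ''dble'' (W ''fflnnpppppppp'')) (W ''ggooooooooooo''))) (W ''fglnnnnpppppp''))) (W
    ''ggnnnnnnppppp'')) (W ''hhjjppppppppp'')) (W ''ggnnnnnnppppp''))) (W ''hhhhpppppppp''))) (W ''hmmmmmmmmmmpp''))
    (W ''hmmmmmmmmmmpp''))) (W ''hhhpppppppppp''))"]) simp_all

text \<open>Twelve to fourteen periods without a 3 and with at most one 4.\<close>

lemma small_17: "solved small_cfg [0, 0, 0, 0, 0, Suc 0, Suc 0, Suc 0, Suc 0, Suc 0, Suc 0, 2, 2, 12] [0, Suc 0, Suc 0, 2, 3, 4, 4, 4, 4, 4, 12, 13, 14, 14]"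
  by (rule check_solved[where t = "B 13 14 (C ''mckb'' (B 2 1 (C ''kcldjb'' H) (B 4 3 (B 12 13 (B 10 12 (B 13 13 (C ''ibkcld'' (B 1 1 (C ''hble''
    (B 10 11 (B 10 10 (C ''gbjckdmfmg'' (B 5 4 (B 5 3 (B 7 4 (C ''lfmhlgmi'' (B 3 2 (C ''icmkkelhli'' (B 4 2 (C
    ''gcll'' (W ''giinnnnnnnnn'')) (W ''egkmmnnnnoop''))) (B 11 10 (B 9 4 (C ''gckg'' (W ''ffimmmpppppp'')) (W
    ''ffllpppppppp'')) (W ''fflnnnnnnnpp'')))) (B 4 2 (C ''mj'' (W ''ejjjoooooopp'')) (W ''ehjjpppppppp''))) (W
    ''ehhppppppppp'')) (W ''hhhhpppppppp''))) (W ''ejmmmmmmmmpp'')) (W ''ejmmmmmmmmpp''))) (B 4 2 (B 9 4 (C ''lh''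
    (B 11 10 (C ''hc'' (W ''djjnoopppppp'')) (W ''dlmnnnnnnnpp''))) (W ''dlllpppppppp'')) (W ''dhpppppppppp'')))) (B
    1 1 (B 4 2 (B 7 4 (C ''kcldle'' (B 10 11 (C ''ib'' (B 10 10 (B 10 9 (B 11 12 (C ''jcmf'' (B 8 4 (C ''hb'' (B 10
    8 (B 11 11 (C ''ic'' (B 11 10 (C ''kdmglf'' (B 9 4 (C ''gbhc'' (B 10 5 (C ''mj'' (W ''ejjoooooopppp'')) (W
    ''ejjmmpppppppp''))) (W ''ejklnnopppppp''))) (W ''ejknnnnnnoppp''))) (W ''ejooooooooopp'')) (W
    ''ejlmmmmmppppp''))) (W ''ekkkooppppppp''))) (W ''ekmnnnnnnnoop'')) (W ''emmmmmmmmpppp'')) (W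
    ''emmmmmmmmpppp''))) (W ''hmmmmmmmmmmpp''))) (W ''ejjkppppppppp'')) (W ''ehppppppppppp'')) (W
    ''dpppppppppppp''))) (W ''fmmmmmmmmmmm'')) (W ''eoooooooooooo'')) (W ''ehhppppppppp'')))) (B 2 1 (B 4 2 (B 9 4
    (C ''lc'' (B 10 12 (B 10 11 (B 10 10 (C ''kb'' (B 10 9 (C ''mdme'' (B 7 3 (C ''mfldmglemh'' (B 5 2 (B 3 1 (C
    ''jb'' (B 11 13 (C ''ib'' (B 11 12 (C ''kclflgmimj'' (B 10 6 (C ''ea'' (B 11 9 (C ''mn'' (W ''gooooooooooooo''))
    (W ''gnnnnnnnnppppp''))) (B 4 1 (C ''hb'' (B 8 3 (C ''gblilj'' (W ''iinnnnnnnnpppp'')) (W ''hjkmmmnooopppp'')))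
    (B 11 9 (C ''hb'' (B 8 3 (C ''gbml'' (W ''ginnoooooooopp'')) (W ''hjkmmmnooopppp''))) (W ''gnnnnnnnnppppp'')))))
    (W ''ilnnnnnnnnnnpp''))) (W ''ilnnnnnnnnnnpp''))) (B 11 9 (B 10 8 (C ''ib'' (B 10 7 (C ''kc'' (B 11 8 (B 12 14
    (C ''hbmi'' (W ''fjoooooooppppp'')) (W ''gooooooooooooo'')) (W ''flnnnnnnpppppp''))) (W ''flmmmmmppppppp''))) (W
    ''fmmmmmmmpppppp'')) (W ''gnnnnnnnnppppp''))) (W ''hhpppppppppppp''))) (W ''hjjooppppppppp''))) (W
    ''hmmmmmmmmppppp''))) (W ''hmmmmmmmmppppp'')) (W ''hmmmmmmmmmmpp'')) (W ''hmmmmmmmmmmpp''))) (W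
    ''hlllpppppppppp'')) (W ''hhpppppppppppp'')) (W ''eppppppppppppp''))"]) (simp_all add: small_16)

lemma small_18: "solved small_cfg [0, 0, 0, 0, 0, Suc 0, Suc 0, Suc 0, 3, 5, 7, 8, 9, 12] [0, 0, 0, 0, 2, 2, 2, 5, 8, 9, 12, 12, 12, 12]"
  by (rule check_solved[where t = "B 8 6 (C ''hbkhlimj'' (B 4 2 (C ''lkidki'' (B 7 4 (C ''kleajggb'' (W ''gikklllmmmmm'')) (B 4 1 (C ''jgkkllie''
    (W ''hjjjkllmmnnn'')) (B 11 12 (C ''hejg'' (W ''gjjjjllmmnnp'')) (W ''gjjjmmnnnnnn''))))) (B 7 5 (B 11 12 (C
    ''jg'' (B 9 8 (C ''kkid'' (W ''ggkklmmmmmmp'')) (W ''hhllllllpppp''))) (W ''ggnnnnnnnnnn'')) (W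
    ''ggjjjnnnnppp'')))) (B 4 2 (C ''khlimj'' (B 7 3 (C ''lkjgkiml'' (B 4 1 (C ''gbkl'' (B 8 8 (C ''jiig'' (W
    ''hikkkkkllnno'')) (W ''hjkkkkkkpppp''))) (B 6 2 (C ''ll'' (W ''gkkkkknnnnnn'')) (W ''gikkkkmmmnpp'')))) (B 8 8
    (B 10 10 (C ''jgmk'' (B 4 1 (C ''hell'' (W ''jjjjjnnnnnnn'')) (B 11 12 (C ''hd'' (B 6 2 (C ''jihelj'' (W
    ''gjjjjklllnop'')) (B 7 5 (C ''jilj'' (W ''gikkkkmmmnpp'')) (B 9 8 (C ''lkki'' (W ''gikkkkmmmnpp'')) (W
    ''gijjjkllnoop''))))) (W ''gkkkkknnnnnn'')))) (B 4 1 (C ''lk'' (B 9 8 (C ''hdll'' (B 9 7 (C ''he'' (W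
    ''jjjjjnnnnnnn'')) (W ''hjjjkllmmnnn''))) (B 10 12 (C ''hd'' (B 10 11 (B 11 12 (C ''gbhe'' (W ''hijjjlllmmpp''))
    (W ''hjjjkllmmnnn'')) (W ''hjjjklllmmmp''))) (W ''hjjkkkllmmmm'')))) (B 6 2 (B 11 12 (C ''jhhd'' (B 10 11 (C
    ''heig'' (W ''hjjjjkklmmpp'')) (W ''hjjjklllmmmp''))) (W ''gkkkkknnnnnn'')) (W ''gikkkkmmmnpp'')))) (W
    ''hjkkkkkkpppp'')))) (B 9 8 (B 10 10 (C ''hcmk'' (B 10 9 (B 11 12 (C ''hd'' (B 11 10 (C ''ig'' (W
    ''hhjjkkkppppp'')) (W ''ggjjnnnnnnpp''))) (W ''ggnnnnnnnnnn'')) (W ''ggjkkkmmnoop''))) (W ''gikkkkmmmnpp'')) (W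
    ''hhllllllpppp'')))"]) simp_all

text \<open>Exactly twelve periods, at most two of them up to 9; \<open>small_18\<close> lies in the
  case without a period up to 6.\<close>

lemma small_19: "solved small_cfg [0, 0, 0, 0, 0, Suc 0, Suc 0, Suc 0, 2, 5, 5, 6, 7, 12] [0, 0, Suc 0, Suc 0, 2, 2, 2, 5, 8, 9, 12, 12, 12, 12]"
  by (rule check_solved[where t = "B 3 1 (C ''ickfkglhmi'' H) (B 8 8 (B 9 9 (B 10 12 (B 9 8 (B 2 1 (C ''hbickflgmhmi'' (B 7 4 (C ''kglhli'' (B 4 2
    (C ''ieljjf'' (B 11 12 (C ''kiif'' (B 6 2 (C ''kkjg'' (W ''fjkkkklmmmnp'')) (W ''gikkkkmmmnpp''))) (W
    ''flllllnnnnnn''))) (W ''fgkllmmnnppp''))) (B 10 11 (B 11 12 (B 4 2 (C ''iejf'' (B 10 10 (C ''kglhmj'' (B 5 2 (B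
    6 2 (C ''heli'' (W ''fjjjjmnnnopp'')) (B 8 7 (B 10 9 (C ''heli'' (W ''fjjjjmnnnopp'')) (W ''fijjklmmnopp'')) (W
    ''fijjkkkopppp''))) (W ''fhllllpppppp''))) (W ''fjjjklmmmnpp''))) (B 9 6 (C ''khli'' (W ''fgkllmmnnppp'')) (W
    ''fhllllpppppp''))) (W ''gjjjmmnnnnnn'')) (W ''fjjjlmmmmmop'')))) (B 8 7 (B 10 11 (B 7 3 (C ''kflg'' (B 8 6 (C
    ''mjhb'' (B 10 10 (C ''lh'' (B 4 2 (C ''idljml'' (B 9 6 (C ''kill'' (W ''ejkkmmmnnnnn'')) (W ''ejkkllnnoooo'')))
    (W ''eglllnnnoppp''))) (W ''ejmmmmmmmmpp''))) (W ''ekkkkknppppp''))) (B 12 12 (B 10 10 (B 11 9 (C ''idkf'' (B 7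
    5 (C ''gbjf'' (B 4 2 (C ''khif'' (W ''ekkkkknppppp'')) (W ''fhllllpppppp''))) (W ''ejjjjmpppppp''))) (B 4 2 (B 7
    5 (B 8 6 (C ''kgidmj'' (B 7 4 (C ''gbiekh'' (W ''ejjkkmmmnopp'')) (W ''ejjjoooooopp''))) (W ''ekkkkknppppp''))
    (W ''ejjjjooopppp'')) (W ''eglllnnnoppp''))) (W ''ejmmmmmmmmpp'')) (W ''ejjooooooooo''))) (W ''ellllmmmmmmp''))
    (W ''ekkkkknppppp''))) (W ''flllllllpppp'')) (W ''fmmmmmmmmmmm'')) (W ''flllllllpppp'')) (W ''flllllllpppp''))"]) (simp_all add: small_18)

lemma small_20: "solved small_cfg [0, 0, 0, 0, 0, Suc 0, 3, 3, 4, 5, 6, 7, 8, 12] [0, 0, 0, 0, Suc 0, 3, 5, 5, 7, 8, 11, 12, 12, 12]"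
  by (rule check_solved[where t = "B 7 5 (C ''mjkglh'' (B 8 6 (C ''ljkhmk'' (B 4 1 (C ''gdjgkjlk'' (W ''hiiimmmmmnnp'')) (B 6 4 (B 10 11 (C ''ll''
    (W ''giinnnnnnnnn'')) (W ''giiklmmmmmnp'')) (W ''giiimmnnnnpp'')))) (B 5 3 (B 10 9 (C ''mk'' (B 4 1 (C ''gdlj''
    (B 9 8 (C ''igll'' (W ''iiiikllnnnno'')) (W ''iiiillllpppp''))) (B 9 8 (C ''hdlj'' (B 6 4 (C ''ll'' (W
    ''giinnnnnnnnn'')) (W ''giiimmnnnnpp''))) (W ''giikkkllpppp'')))) (B 4 1 (C ''ljmk'' (B 6 4 (C ''jglkml'' (B 9 8
    (C ''hdkj'' (W ''hiijkklmmmnp'')) (W ''hiikkkllmnoo''))) (B 11 11 (C ''ig'' (W ''hiiikkkmmppp'')) (W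
    ''hiiimmmmmnnp'')))) (B 11 10 (C ''gdjg'' (W ''giiikklmpppp'')) (W ''gikkkkmmmnpp'')))) (W ''hhhlllpppppp''))))
    (B 11 12 (B 5 3 (B 10 9 (B 9 7 (C ''gdmjlhmk'' (B 4 1 (C ''ifml'' (W ''hiiijlnnoooo'')) (B 6 5 (C ''lj'' (W
    ''giiimmnnnnpp'')) (W ''giiiinnnpppp'')))) (B 6 5 (C ''mjlh'' (B 5 2 (B 4 1 (C ''gd'' (B 9 8 (C ''lk'' (W
    ''hiiijllnnoop'')) (W ''iiiillllpppp''))) (B 6 4 (C ''if'' (B 9 8 (C ''ml'' (W ''hiijjklnoooo'')) (W
    ''giikkkllpppp''))) (B 11 10 (B 8 7 (C ''ml'' (W ''hiiijlnnoooo'')) (W ''giiikkkooppp'')) (W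
    ''giiimmnnnnpp'')))) (W ''hhjjjllooopp''))) (W ''iiiiillppppp''))) (B 6 5 (B 4 1 (C ''jfmj'' (B 6 4 (C ''ifjg''
    (B 10 11 (C ''lj'' (B 12 12 (C ''iglkjh'' (W ''hiijjkklmnop'')) (W ''hiijjklnoooo''))) (W ''hiijkklmmmnp''))) (B
    11 10 (C ''ig'' (W ''hiiikkkmmppp'')) (W ''hiiijmmmmnpp'')))) (B 6 4 (C ''jf'' (B 10 11 (C ''mj'' (B 12 12 (C
    ''jg'' (B 11 10 (C ''igjh'' (W ''giikkkllpppp'')) (W ''giijjllmmnpp''))) (W ''giijjmnnnooo''))) (W
    ''giiklmmmmmnp''))) (W ''giiijmmmmppp''))) (W ''hiiiinnnnppp''))) (W ''hhhjjppppppp'')) (W ''jjjjjnnnnnnn''))"]) simp_all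

text \<open>Twelve periods again, now with at least three of them up to 9; \<open>small_20\<close>
  lies in the case without a period up to 6.\<close>

lemma small_21: "solved small_cfg [0, 0, 0, 0, 0, Suc 0, 3, 3, 3, 5, 5, 5, 5, 12] [0, 0, Suc 0, Suc 0, 3, 5, 5, 5, 7, 8, 11, 12, 12, 12]"
  by (rule check_solved[where t = "B 3 1 (C ''lfmg'' (B 5 5 (B 4 2 (C ''idkflgmh'' (B 5 4 H (W ''hhhhpppppppp''))) (B 6 5 (B 10 11 (B 9 8 (B 10 10
    (B 11 12 (C ''id'' (B 11 11 (C ''kf'' (B 11 10 (B 5 4 (B 8 6 (C ''hd'' (B 10 9 (C ''lg'' (B 4 3 (C ''hegd'' (W
    ''ggiijmnppppp'')) (W ''gggnnnnppppp''))) (W ''ggijmmmmmppp''))) (B 4 3 (C ''kghd'' (B 8 7 (B 10 9 (C ''mhmi''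
    (B 5 3 (B 6 4 (C ''mllh'' (W ''ggikkkmnoooo'')) (B 11 8 (C ''he'' (W ''ggiijmnppppp'')) (W ''ggiimmmnpppp'')))
    (W ''hhhlllpppppp''))) (W ''ggijmmmmmppp'')) (W ''hhjjkkkppppp''))) (W ''hhhlllpppppp''))) (W ''hhhhpppppppp''))
    (W ''ggimnnnnnnpp''))) (W ''ggimnnnnnnpp''))) (W ''giinnnnnnnnn'')) (W ''ggimnnnnnnpp'')) (W ''hhllllllpppp''))
    (W ''ggimnnnnnnpp'')) (W ''ggiiinpppppp''))) (W ''hhhhpppppppp''))) (B 9 7 (B 6 5 (B 10 11 (B 10 10 (C ''mf'' (B
    4 3 (B 10 9 (B 11 12 (B 2 1 (C ''idlfmgmh'' (B 5 4 (B 11 9 (C ''hdkf'' (B 4 2 (C ''gdjf'' (W ''fiiillpppppp''))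
    (B 9 6 (C ''gd'' (W ''fgiimnpppppp'')) (W ''fhllllpppppp'')))) (B 5 3 (B 4 2 (C ''hdie'' (B 10 8 (C ''kf'' (B 6
    4 (C ''ifhe'' (W ''fiijjkpppppp'')) (W ''fiiimmnnpppp''))) (W ''fiijlmmmpppp''))) (B 7 4 (C ''kf'' (W
    ''fgiklmnooppp'')) (W ''fgijlnnnoppp''))) (W ''fhhlnnnooppp''))) (W ''hhhhpppppppp''))) (B 12 12 (B 5 4 (B 11 8
    (C ''id'' (B 5 3 (B 4 2 (C ''kf'' (B 7 5 (C ''gdjf'' (W ''fiiillpppppp'')) (W ''ejjjjmpppppp''))) (B 7 4 (C
    ''if'' (W ''fhllllpppppp'')) (W ''ehjjpppppppp''))) (W ''ehhppppppppp''))) (B 7 5 (B 8 6 (B 5 3 (B 7 4 (C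
    ''kfmi'' (B 4 2 (C ''ieljkg'' (W ''ejjkkmmnnnpp'')) (W ''eglllnnnoppp''))) (B 12 10 (B 4 2 (C ''gdkf'' (W
    ''fiiimmnnpppp'')) (W ''ehjjpppppppp'')) (W ''ejjjoooooopp''))) (W ''ehhppppppppp'')) (W ''ekkkkknppppp'')) (W
    ''ejjjjooopppp''))) (W ''hhhhpppppppp'')) (W ''ejjooooooooo''))) (W ''giinnnnnnnnn'')) (W ''fiimmmmmmppp'')) (W
    ''fggllopppppp''))) (W ''fiimmmmmmppp'')) (W ''fiimmmmmmppp'')) (W ''fiiiippppppp'')) (W ''fiillllppppp''))"]) (simp_all add: small_20)

text \<open>Exactly thirteen periods, none up to 6.\<close>

lemma small_22: "solved small_cfg [0, 0, 0, 0, 0, Suc 0, Suc 0, Suc 0, 2, 5, 5, 6, 7, 13] [0, 0, 0, 0, Suc 0, 2, 4, 4, 6, 6, 10, 13, 13, 13]"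
  by (rule check_solved[where t = "B 7 3 (C ''mjlgkflhli'' (B 5 2 (B 8 4 (C ''ealk'' (B 6 2 (C ''lm'' (W ''gnnnnnnnnnnnn'')) (W
    ''ginnnnnnnnnpp''))) (B 4 1 (C ''mllj'' (B 6 2 (C ''khlliejf'' (B 10 10 (C ''hbif'' (W ''hjkkkknnoooop'')) (W
    ''hkkkklmmmmnop''))) (B 9 6 (C ''lmkg'' (W ''himmmmmnnnnnn'')) (W ''hillllnnnnoop'')))) (B 6 2 (B 8 6 (C ''lk''
    (B 8 5 (C ''khml'' (W ''gkkkmmmmnnoop'')) (W ''gkkkkmnnnnnpp''))) (W ''gkkkkknnnoppp'')) (W
    ''gikkmmnnnpppp'')))) (W ''hhlllpppppppp''))) (B 10 10 (B 6 3 (C ''mhlgmi'' (B 5 2 (B 11 10 (C ''idkf'' (B 4 1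
    (C ''mk'' (B 7 4 (C ''if'' (W ''hjjkkknoooppp'')) (W ''hjjjmmnoooopp''))) (B 10 8 (C ''mj'' (B 8 6 (C ''gbml''
    (B 7 4 (C ''li'' (W ''gikkmmnnnpppp'')) (W ''hjjjmmnoooopp''))) (W ''hjjkkknoooppp''))) (B 8 6 (B 6 2 (C
    ''hdmk'' (W ''hjjjmmnoooopp'')) (B 11 9 (B 8 5 (C ''mmhd'' (W ''hjjjmmnoooopp'')) (W ''gijkkmmnppppp'')) (W
    ''gikkmmnnnpppp''))) (W ''gkkkkkmmppppp''))))) (B 8 6 (B 4 1 (C ''mk'' (B 10 7 (C ''llid'' (B 9 6 (C ''gbhdmm''
    (W ''jjjjooooooooo'')) (W ''hjjkllnnnnnpp''))) (B 7 4 (B 12 13 (C ''iegbki'' (W ''hikkkmmmmpppp'')) (W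
    ''hjjmmmmnnoooo'')) (W ''hjjjmmnoooopp'')))) (B 11 11 (B 7 4 (C ''kg'' (B 12 13 (C ''iegb'' (W
    ''gikkmmnnnpppp'')) (W ''hjjmmmmnnoooo''))) (W ''gjjjnnnnnnppp'')) (W ''gjjmmnnnnnnpp''))) (W
    ''hjjkkknoooppp''))) (W ''hhlllpppppppp''))) (B 12 13 (B 10 9 (B 11 12 (B 5 2 (B 7 4 (C ''kfmhlgmi'' (B 8 5 (C
    ''eali'' (W ''giimnnnnnpppp'')) (B 4 1 (C ''limk'' (B 11 10 (C ''if'' (W ''hjjkkknoooppp'')) (W
    ''hiikkmnnnnopp''))) (W ''giikknnpppppp'')))) (B 11 11 (B 12 12 (B 12 11 (B 4 1 (C ''kflg'' (B 6 4 (C ''li'' (B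
    8 6 (C ''khie'' (W ''iiijkmmmppppp'')) (W ''hjjjkknoopppp''))) (W ''hiiilmnpppppp''))) (B 6 4 (B 8 6 (C ''lh''
    (B 10 7 (C ''lj'' (W ''giimnnnnnpppp'')) (W ''giiklmmnppppp''))) (W ''giikklopppppp'')) (W ''giiiloppppppp'')))
    (W ''hiijnoooooopp'')) (W ''hiijnoooooopp'')) (W ''hiijnoooooopp''))) (W ''hhlllpppppppp'')) (W
    ''hiinnnnnnnnnp'')) (W ''hiillmmmmpppp'')) (W ''iiioooooooooo''))) (W ''hjjllmmmmmppp''))"]) simp_all

text \<open>The root box. Its upper bounds are the pigeonhole bounds \<open>c - 1\<close>, except
  that there is at most one 3; its lower bounds record a period of at most 8.\<close>

lemma small_top: "solved small_cfg [0, 0, 0, 0, 0, Suc 0, Suc 0, Suc 0, Suc 0, Suc 0, Suc 0, Suc 0, Suc 0, Suc 0] [Suc 0, 3, 4, 5, 6, 7, 8, 9, 10, 11, 12, 13, 14, 15]"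
  by (rule check_solved[where t = "C ''nbncndne'' (B 13 15 (B 13 10 (C ''hbjcea'' H) (B 1 2 (B 2 4 (B 2 3 (B 3 5 (B 3 4 (B 4 6 (B 6 8 (B 4 5 (B 13
    12 (C ''jblc'' H) (B 0 1 (B 2 2 (C ''lb'' (B 3 3 (B 6 7 (B 4 4 (B 7 9 (B 6 6 (B 7 8 (B 7 7 (B 8 10 (B 8 9 (B 7 6
    (B 9 11 (B 9 10 (B 9 5 H (B 13 14 (B 1 1 (B 3 2 (B 13 13 (C ''ib'' (B 6 3 (C ''lfmg'' H) (B 8 8 (B 9 9 (B 10 12
    H (W ''iiimmmmmmmmm'')) (W ''iiillllllppp'')) (W ''hjkkkkkkpppp'')))) (B 3 1 (B 9 7 (B 4 2 (B 7 5 (C ''lfib'' (B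
    10 12 (B 10 11 (C ''mg'' (B 5 4 (B 5 3 H (W ''hhlllpppppppp'')) (W ''hhhhpppppppp''))) (W ''hmmmmmmmmmmpp'')) (W
    ''hmmmmmmmmmmpp''))) (W ''jjjjjpppppppp'')) (W ''hhlllpppppppp'')) (W ''hllllllpppppp'')) (W
    ''fllllpppppppp''))) (W ''ffllpppppppp'')) (W ''dlllpppppppp'')) (W ''hlllpppppppppp''))) (W ''hlllllllllpp''))
    (W ''hlllllllllpp'')) (W ''hjjjjjpppppp'')) (W ''kkkkkkkkkppp'')) (W ''hlllllllllpp'')) (W ''hjjjjjpppppp'')) (W
    ''hjkkkkkkpppp'')) (W ''hjjjjjpppppp'')) (W ''hjkkkkkkpppp'')) (W ''hhhhpppppppp'')) (W ''hjjjjjpppppp'')) (W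
    ''fffpppppppp''))) (W ''eepppppppppp'')) (W ''cppppppppppp''))) (W ''gggggppppp'')) (W ''iiiiiiiipp'')) (W
    ''hhhhhhpppp'')) (W ''fffhpppppp'')) (W ''fffffppp'')) (W ''eeeppppppp'')) (W ''fffhpppppp'')) (W
    ''ddpppppppp''))) (W ''hpppppppppppppp''))"]) (simp_all add: small_5 small_15 small_17 small_19 small_21 small_22)

text \<open>The same weights for the bound 20: 9 and 10 count with their own reciprocals,
  \<open>v\<close> from 11 on with that of \<open>v - 1\<close>. Therefore 10 and 11 have equal
  weights, which gives the difference 0. The cap 100000 is 2/20 in millionths.\<close>

definition large_cfg :: cfg where
  "large_cfg = (9, [11112, 0, 9090, 7576, 6410, 5495, 4762, 4167, 3676, 3268, 2924, 52632],
    [111112, 100000, 100000, 90910, 83334, 76924, 71429, 66667, 62500, 58824, 55556, 52632], 100000)"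

lemma large_cfg_simps [simp]:
  "fst large_cfg = 9" "length (fst (snd large_cfg)) = 12" "wf_cfg large_cfg"
  "light large_cfg l u \<longleftrightarrow> light (9, [11112, 0, 9090, 7576, 6410, 5495, 4762, 4167, 3676, 3268, 2924, 52632],
    [111112, 100000, 100000, 90910, 83334, 76924, 71429, 66667, 62500, 58824, 55556, 52632], 100000) l u"
  by (simp_all add: large_cfg_def)

section \<open>Cyclic schedules for periods from 9 to 20\<close>

lemma large_words_1: "list_all cert_ok [
    (''iiiiiiiittt'', ''abcdefghiabcdefghjabcdefghk''), (''iiiiiimmmttt'', ''abcgdjefhabcidkefgabchdlefi''),
    (''iiiiiittttttt'', ''abgcdhefiabjcdkeflabmcdgefhabicdjefkablcdmefgabhcdiefjabkcdlefm''),
    (''iiiiilllrrtt'', ''abfcdgeihabkcdfejgabhcdleifabgcdhejkabfcdgeihablcdfejgabhcdkeifabgcdhejl''),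
    (''iiiiimmmrrttt'', ''abcfikdegabchjldefabcgimdehabcfjkdegabchildefabcgjmdeh''),
    (''iiiiimppqqqqt'', ''abcdgemijabcdfehklabcdgeijfabcdheklmabcdfegijabcdheklf''),
    (''iiiiirrrrrtttt'', ''abfcdkeghablcdiejmabfcdneghabkcdiejlabfcdmeghabncdiejkabfcdleghabmcdiejn''),
    (''iiiikmqqqqrstt'', ''fabcdeghimabcdfkeljabcdghineabcdfkmjlabcdeghifabcdnkejmabcdfghieabcdlkjn''),
    (''iiiillllrrrr'', ''abecifdjgabhckedlfabgcihdjeabfckgdlh''),
    (''iiiilllrrrrtt'', ''abechfdigablcjedkfabgchmdieabfcjgdklabechfdigabmcjedkfabgchldieabfcjgdkm''),
    (''iiiillrrrrtttt'', ''abecgfdhkablciedjfabmcgndheabfcikdjlabecgfdhmabnciedjfabkcgldheabfcimdjn''),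
    (''iiiimmmmmrrtt'', ''aebfcdgljahbicdefkagbmcdhijaebfcdglkahbicdefjagbmcdhik''),
    (''iiiimmmmooprt'', ''iabkmecdfgabhjlcdieabfgkcdhmabjelcdfgabihkcdejabfglcdh''),
    (''iiiimppqqqqrrt'', ''eabcdhijknabcdelfmgabcdhijkeabcdflgmnabcdehijkabcdflgm''),
    (''iiiirrrrrrrtttt'', ''abecfldghabmcijdknabecfodghablcijdkmabecfndghabocijdklabecfmdghabncijdko''),
    (''iiikmmnnopqqtt'', ''adgbchjimaefbcdklgahnbcefdjaimbcghkladfbcejniaghbcdfklaembcjgdhaifbcenkl''),
    (''iiillllrrrrrr'', ''abdcheijfabgckdlmeabfchgijdabeckflmg''),
    (''iiilllrrrrrrtt'', ''abdcgehifabmcjdkleabfcgnhidabecjfklmabdcgehifabncjdkleabfcgmhidabecjfkln''),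
    (''iiillmpqqrttttt'', ''abklgdjcmabehfnicdabgokejcfabdhlimceabgfndjcoabekhilcdabfgmejcnabdhoifce''),
    (''iiillrrrrrrtttt'', ''abdcfeghlabmcidjkeabncfoghdabeciljkmabdcfeghnabocidjkeablcfmghdabecinjko''),
    (''iiilrrrrrrrrrtt'', ''abdcefghnabicjdklmabocefghdabicjnklmabdcefghoabicjdklmabncefghdabicjoklm''),
    (''iiimmmmmmqqqq'', ''abdejcfkgabhilcdemabfjgchkiabdelcfmgabhjicdekabflgchmi''),
    (''iiimmmmmmrrttt'', ''abcdejlfgabchikmdeabcfgjnhiabcdeklfgabchijmdeabcfgknhi''),
    (''iiimqqqqqqqqrrt'', ''abcdefghmabcijkldnabcefghomabcdijlknabcefghdmabcijlkon''),
    (''iiirrrrrrrrrtttt'', ''abdcemfghabncijkloabdcepfghabmcijklnabdceofghabpcijklmabdcenfghabocijklp''),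
    (''iikkkkkkmoqtt'', ''cdekflabgihcdejabfmgkhcdabeifjglhabcdemfigabhj''),
    (''iikkkkkmmpprt'', ''cjdkehafbglcidmaebfhgjckadbeiflghacbdjekfiagbchdlemafbgi''),
    (''iikkkkkrrrrttt'', ''acbhdielfagbcjkdmeafbghcindaebfjgkcladbehfigmcabdjekfng''),
    (''iikkkmnnttttttt'', ''gichdabejklfmcabdgehnoiabcfdjekgabhlcmdfeabno''),
    (''iikkknnnoorttt'', ''cialmfbdgejachnbikdfaegcbjlhmadiebckfnagjdbeh''),
    (''iikmnnnnnnssttt'', ''acbemkflgahbcdijneaobfgchmdaibjkelcfagbdhnioj''),
    (''iiknnnpqqqqttttt'', ''dablefmghiabcjdnkoeabfpcghilabdjemcfkabngohidcabefjplkmabcdghiefabnjcokp''),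
    (''iillllllllrr'', ''acdbefkghaijbcdlefaghbijkcdaefbghlij''),
    (''iilllllllrrtt'', ''acdbefjghailbcdkefaghbimjcdaefbghkilacdbefjghaimbcdkefaghbiljcdaefbghkim''),
    (''iillllllrrrrr'', ''acdbeijfgahkbcdlemafgbhijcdaekbfglhm''),
    (''iilllllrrrrrtt'', ''acdbehifgamjbcdkelafgbnhicdaejbfgkmlacdbehifganjbcdkelafgbmhicdaejbfgknl''),
    (''iillllmmmmnpq'', ''gcadhliebfkajcgdmbheafilkcbdjagehfmbicadkljebgfahcidmbkealfjgcbdhaiekmfbj''),
    (''iillllnnnooott'', ''cmgdajekbflhcaidgbenjfakchbdlmeaifgbcjkdahelbfin''),
    (''iillllrrrrrrrr'', ''abcghdijeabfklcmndabeghfijcabdklemnf''),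
    (''iillllrrrrrtttt'', ''acdbeghflamibcdjekafnboghcdaeibfljmkacdbeghfnaoibcdjekaflbmghcdaeibfnjok'')]"
  by (simp only: cert_simps)

lemmas [simp] = certs_valid [OF large_words_1, simplified]

lemma large_words_2: "list_all cert_ok [
    (''iilllrrrrrrrrtt'', ''abcfgdhieabnjkclmdabefgohicabdjkelmnabcfgdhieabojkclmdabefgnhicabdjkelmo''),
    (''iillmnnpppqqttt'', ''acbhdkmenafbgcijdlahboekfcgadbijmnleacbfdghkoaibecjldfagbmhnkceadbifjglo''),
    (''iillrrrrrrrrrrr'', ''abcefghidabjklcmnoabdefghicabjkldmno''),
    (''iillrrrrrrrrtttt'', ''abcefdghmabnijckldaboefpghcabdijmklnabcefdghoabpijckldabmefnghcabdijoklp''),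
    (''iilmmmmpqqqqrtt'', ''adenijcbhafgkldebmacoijfgbhadelcknbmafgijdebcahlokfgbm''),
    (''iilmnnnnnnnntt'', ''efaghimbjcdaklefbghiacjdnbkl''),
    (''iilmnqqqqqqqqrr'', ''abfghcidjabkenolmcabdfghijeabcknodlmabfgechijabdknolmcabefghdijabcknolem''),
    (''iilrrrrrrrrtttttt'', ''abcdelfgmabnhicjkoabpdeqfgcablhimjknabcdeofgpabqhicjklabmdenfgcabohipjkq''),
    (''iimmmmmmmmmttt'', ''cdeabfghlijkabcdemfghabijkn''),
    (''iimmmmmmqqqqrr'', ''acidbefjkaghmbcldnaefibghkjacdmbeflnaghibcdkjaefmbghln''),
    (''iimmmmmnppqqqtt'', ''abncdiekhabfgjlmcdabeihofgkabcdlnjemabfhgicdkabeljofmg''),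
    (''iimmmmpppqqqqrt'', ''nabgchidejabfklmocnabdeigfhjabcklmdenabifghcjoabdeklmf''),
    (''iinnnnnnppqqqrt'', ''kincdabefgolmhabjcdkiefabgnhlmocabdefjkgiabhnclmdeabfgjkihoabcdelmfgabjh''),
    (''iinnqqqqqqqqrrtt'', ''abcoefghiabmdjklcnabpefghidabmcojlknabefdghicabmpjlkonabdfceghiabmjlkpdn''),
    (''ikkkkmmnnnortt'', ''bhacmdfkleiabgcjdhnfaekbicgdmajhefblckadginej''),
    (''ikkkmmmnppqqrtt'', ''bcekfidganmbchljeadfgibckoahmdelfbcangjidhkeabcfmlgdoajh''),
    (''ikkkmmnnnnnott'', ''bgchimajedkbfclaghindebjacfkmlgdhabicejfnkadl''),
    (''ikkknnoosttttttt'', ''abgcidejkafhblcmdganeopbfchadjikglbeacmdfhnop''),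
    (''ikklmmmmopssttt'', ''kefbacgmjnidhabecflgkoadjbhceifagnmdblchajefiogbkacdhnmefjabgcidlho''),
    (''ikkmmmmmnoqrrst'', ''bdklcejfaghbindmcaeofjbghlacdkienbfaghcjmdolabeficghkadjbnmecfaghio''),
    (''ikkmmooppppppst'', ''hbcijdoafegkbclmahdijnebcafgkoldmhabceijnfgadkbclmehaoijfbcdgakelmn''),
    (''ikkmnnooooorttt'', ''gbhiacjmldekbafgchinojabdekcfmgahibljdceakfon''),
    (''ikknnoooostttttt'', ''daeklfbcghamindjebcafopghkliabcdemjfnaghbciop''),
    (''iklmmmnnoopqqqr'', ''gdcelmafnbkijhcagdeobflmanchkigbdaefjoclmhabgdnekfcaijbhlmgdaecnkbfijaho''),
    (''iklmmoooppprrstt'', ''bdeionfgachbljdekapmicbfghadejonkbcailfgdehpabcjmknoiadebfcghlajpkm''),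
    (''ikmmmmmmmmmstt'', ''cdbelfghaijkmbcdeafghnijbkacdelfghmabijkcdenafgbhlijkacdembfghaijkn''),
    (''ikmmmmooqrrrrrrr'', ''cjdikaghlmbefcadnopjibkaefcmdlghabnopef''),
    (''illllllllrrrr'', ''abcjdekfgahilbcmdeafgjhikbcadelfgmhi''),
    (''illlllllrrrrtt'', ''abcidejfgahmkbcldeafgihnjbcadekfglhmabcidejfgahnkbcldeafgihmjbcadekfglhn''),
    (''illllllrrrrrrr'', ''abchdijefagklbcmdnaefhgijbcadklefmgn''),
    (''illlllmmmmoptt'', ''bmgcdaefhnlibjacdkefghmabijcdlefaghnbkicdaefjlghbmacdiefkjnabghcdlefaijk''),
    (''illlllmmpqqsttt'', ''bcajdieflgmabchkdnefajgibcohdaefkmlgbcaidjefhnoabcgkdlefahjibcmgdaefknho''),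
    (''illlllrrrrrrrtt'', ''abcgdhiefanjkbcldmaefgohibcadjkeflnmabcgdhiefaojkbcldmaefgnhibcadjkeflom''),
    (''illllmmnoppqttt'', ''bmafgjcnldeabhkofgciadejbmlhnacfgdekbiaojhclfdeabgmkinchadefbjgloackideh''),
    (''illllmnnnoopqq'', ''bgajchmfndeabilgckjhadefbmnicaglkdehbfajcimngdeabhflckjiadegbmnhcaflkdei''),
    (''illllnnnnrrrrtt'', ''fanbgcjkhdaeilfbmcgaodhejkibacflgdmehanbicjkfdaeglhbmciaodfejkgbachlidme''),
    (''illllrrrrrrrrrr'', ''abcfghideajklbcmnoadefghibcajkldemno''),
    (''illllrrrrrrrtttt'', ''abcfdghemanijbckdlaeofpghbcadijemknlabcfdgheoapijbckdlaemfnghbcadijeokpl''),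
    (''illlmmmmopppqtt'', ''abcjdkneiafghbcldmajekofgbcadhilnemjabcfdghkoaeilbcmdfaghjnekbcadiflghmo''),
    (''illlmnpqqqqrtttt'', ''mhbflcadginoejbakcfdhplmaebigcjdfaknohbelcadigfpjmbaeckdhnloafbigcedjapk'')]"
  by (simp only: cert_simps)

lemmas [simp] = certs_valid [OF large_words_2, simplified]

lemma large_words_3: "list_all cert_ok [
    (''illlnnnnqqtttttt'', ''eaklfbmigcadhneojbfapcgdikhlabemfcjdganohbipecadfkgjlbhamcedinfoabgphcjd''),
    (''illlrrrrrrrrrrtt'', ''abcefghdoaijkbclmnadpefghbcaijkdolmnabcefghdpaijkbclmnadoefghbcaijkdplmn''),
    (''illmmmnpqqqqrttt'', ''gmabcijndehafkgbclomadeijfhbcagknpdelmabcfijghoadekbclfmangijdebcahfkolp''),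
    (''illmnqqqqrrtttttt'', ''abejclfgmadnhbkiceaopjqdfbgachlekinmabdjcfpgqaeohbkdcianljfmebgacdhpkqio''),
    (''illnnnqqqrttttttt'', ''bjkcdaelmgnhbfaciodjepqabkgcfhmladeibjncoafgqphdbeackimjflnabdgcehopaqfi''),
    (''illrrrrrrrrrrrrr'', ''abdefghciajklbmnopacdefghbiajklcmnop''),
    (''illrrrrrrrrrrtttt'', ''abcdefgnoahijbcklmapqdefgbcahijnoklmabcdefgpqahijbcklmanodefgbcahijpqklm''),
    (''ilmmmnopqqqqqrtt'', ''goaifcbjkpnadelmhgbfaciojdeknablmfchgpadeibjkonafclmdebhagipjkfcnabdelmh''),
    (''ilmnnnnqqqqqrttt'', ''abdhncijeakfobgldmachpeijbfagkdnclomabehfigjdackpblnemafghdcibjaokelpfgm''),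
    (''ilmnqqqqqqrrrrttt'', ''kldemfoabghicjpnadklbemfqacghijdbnapklecmfoabdghijqnacklbemdfapghicjbnaq''),
    (''ilnnnnnnnnpqqtt'', ''cadlebfmghainjckdbeaflghoimjabcdekfngahilbjmcdaefkgohbiajlcdmefnabghikjo''),
    (''ilnnnnnnpqqqtttt'', ''jckmdenabfgholicajdebpkfgahmncilbdaejfgkohpabcidlemfagjhbkncoadeiflgbhap''),
    (''immmmmmmmpqqqtt'', ''abcndejkfaghilbcmdaeofjghikabcdlenfmaghijbcdkaefloghim''),
    (''immmmmmoopppqqq'', ''jbhmicdkaefgnobljacdhmefigakbnocdljaefgmhbikacdnoefgl''),
    (''immmmmqqqqqqrrtt'', ''mabcgnodhiaefjkbclmadgpnefhiabckjdlomaefgnbcihadkjpefl''),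
    (''immmmnnnnnnnnt'', ''fghabcdeijklamfghbcdeaijklnm''),
    (''immmnnnnpppqqrtt'', ''eoabcijnfgkadhelbcmpaifgjdnheabocklmfgadihebncjapkfgdmlh''),
    (''imnnnnnppppqqqst'', ''hocaldefimgjabnkchpdeaflgobijmacndkefhgablpijcmdaenfgbokhalcidjemfabgnpk''),
    (''innnnpppqqqqqqqr'', ''iajkbclmndafgehpoibacjkdlmneafhgbpcoiadjkelmnfabchgpdoiaejklmbcnahdfgpeo''),
    (''innqqqqqqqrrrrrrt'', ''adbefklmcanoghijbpadefcklmqanobghijpacdefklmbanoghicjpadefbklmqanocghijp''),
    (''jjjjjtttttttttt'', ''abcdefghijabcdeklmno''),
    (''jjjjlmmmsttttt'', ''abiejfkcdgabhlmencdfabgijhkcdeabflmgncdh''),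
    (''jjjjooooooooo'', ''abefgcdhijabklmcdefgabhijcdklm''),
    (''jjjjooooootttt'', ''abcefdklghabcijdmnefabcghdklijabcefdmnghabcijdklefabcghdmnij''),
    (''jjjjoootttttttt'', ''abcdehijkfabcdglmnoeabcdfhijkgabcdelmnofabcdghijkeabcdflmnog''),
    (''jjjjppppttttttt'', ''aebicfdjkgalbhcmdenoafbicgdjkhalbecmdfnoagbichdjkealbfcmdgnoahbicedjkfalbgcmdhno''),
    (''jjjjtttttttttttt'', ''abcdefghijabcdklmnop''),
    (''jjjlllttttttttt'', ''adbgcehijfakbdclmenoafbgcdhijeakbfclmdnoaebgcfhijdakbeclmfno''),
    (''jjjooooooooott'', ''abdefcmghiabjklcndefabghicmjklabdefcnghiabjklcmdefabghicnjkl''),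
    (''jjjoootttttttttt'', ''abcdghijekabcflmnodpabceghijfkabcdlmnoepabcfghijdkabcelmnofp''),
    (''jjjpppppppptttt'', ''adbecflgmhaibjckndoeafbgchlimjakbdcenfogahbicjlkmdaebfcgnhoiajbkcdlemfagbhcinjok''),
    (''jjjtttttttttttttt'', ''abcdefghijabcklmnopq''),
    (''jjlllllltttttt'', ''acbdiejfkgahbcldmenfagbhicjdkeafbglhmcndaebfigjhkcadbelfmgnh''),
    (''jjlllttttttttttt'', ''acbfgdhijeakbclmndopaebfgchijdakbelmncopadbfgehijcakbdlmneop''),
    (''jjlmmmmmmmrstt'', ''adlefgmhbiacjndkefbgahilcjmdbeafgnhickbj''),
    (''jjmmmmmmrrssttt'', ''cmidkaefbgljhcnadobefmgkiahcbjdlefnagobh''),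
    (''jjmmmmsstttttttt'', ''icdjklabefghmncdabopiefjklabcdhgmnefabop''),
    (''jjoooooooootttt'', ''abcdelmfghabijknocdeabfghlmijkabcdenofghabijklmcdeabfghnoijk''),
    (''jjooooootttttttt'', ''abcdijkeflabghmnocdpabefijkghlabcdmnoefpabghijkcdlabefmnoghp''),
    (''jjoootttttttttttt'', ''abcfghidjkabelmnocpqabdfghiejkabclmnodpqabefghicjkabdlmnoepq'')]"
  by (simp only: cert_simps)

lemmas [simp] = certs_valid [OF large_words_3, simplified]

lemma large_words_4: "list_all cert_ok [
    (''jjpppppppptttttt'', ''acbdkelfmgahbinjocpdaebfkglhmiajbcndoepfagbhkiljmcadbenfogphaibjkcldmeafbgnhoipj''),
    (''jjppppttttttttttt'', ''acbghdijkealbfmnocpqadbgheijkfalbcmnodpqaebghfijkcalbdmnoepqafbghcijkdalbemnofpq''),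
    (''jjtttttttttttttttt'', ''abcdefghijabklmnopqr''),
    (''jlllllltttttttt'', ''abhcidjekfaglbmcndoeafhgibjckdaelfmgnbocadheifjgkbacldmenfog''),
    (''jlllttttttttttttt'', ''abefgchijdaklbmnocpqadefgbhijcakldmnobpqacefgdhijbaklcmnodpq''),
    (''jlmmmmmmmsssttt'', ''acmjdefgnoabhickldefagmbjhicnoadefgbklhi''),
    (''jmmmmmmmopppppt'', ''bcjdekaiflghmbcnadejofighkabcldenmfjaghibckdelafnmgho''),
    (''jmmmmmmqsssttttt'', ''labcdimnefhagjobcdkplaefigmnbcdajhoefkgp''),
    (''jmmmmmqqrsttttttt'', ''bklacdimghefjanbocdpqklaefhmbicdgajnoefpq''),
    (''jmmmmqqrssssssttt'', ''bcoijpadeklhfbcgaqmndeojipabchklgdefaqnm''),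
    (''jmmmnnnnnnnprst'', ''efaglhijmbcdakefngohijabcdmkeflgahijbcdnok''),
    (''joooooooooooott'', ''abcdenfghiajklmobcdeafghinjklmabcdeofghiajklmnbcdeafghiojklm''),
    (''joooooooootttttt'', ''abcdklefgmahijnobcdpaefgklhijmabcdnoefgpahijklbcdmaefgnohijp''),
    (''jooooootttttttttt'', ''abchijdeklafgmnobcpqadehijfgklabcmnodepqafghijbcklademnofgpq''),
    (''joootttttttttttttt'', ''abefghcijkadlmnobpqracefghdijkablmnocpqradefghbijkaclmnodpqr''),
    (''jpppppppptttttttt'', ''abjckdlemfagnhoipbqcadjekflgmhainbocpdqeafjgkhlimbacndoepfqgahjikblcmdaenfogphqi''),
    (''jppppttttttttttttt'', ''abfghcijkdalmenopbqracfghdijkealmbnopcqradfgheijkbalmcnopdqraefghbijkcalmdnopeqr''),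
    (''jtttttttttttttttttt'', ''abcdefghijaklmnopqrs''), (''kkkkkkkkkktt'', ''abcdefghijkabcdefghijl''),
    (''kkkkkkkkkppp'', ''ajbcdekfghialbcdejfghiakbcdelfghi''), (''kkkkkkkkktttt'', ''abcdefghijkabcdefghilm''),
    (''kkkkkkkkopptt'', ''abcdelifghjabcdekmfghiabcdejlfghkabcdeimfghjabcdeklfghiabcdejmfghk''),
    (''kkkkkkkktttttt'', ''abcdefghijkabcdefghlmn''),
    (''kkkkkkkmmttttt'', ''abcdefjghklabcdefigmnhabcdefjgilkabcdefhgmni''),
    (''kkkkkkkoopppp'', ''abcjdkefghiabcldmefgjkabcidhefglm''),
    (''kkkkkkkopptttt'', ''abcdklhefgiabcdjmnefghabcdiklefgjabcdhmnefgiabcdjklefghabcdimnefgj''),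
    (''kkkkkkktttttttt'', ''abcdefghijkabcdefglmno''),
    (''kkkkkklnopprrt'', ''jablimcdegfhabknjcdeifgabhlmcdekfjabgincdehflabkgjcdemfiabhngcdekf''),
    (''kkkkkknnnntttt'', ''abcgdkhlefiabcjdmgnefhabcidkjlefgabchdminefj''),
    (''kkkkkknooopptt'', ''akbcdemghfialbcdejknfgahbcdeilmfjakbcdeghnfialbcdejkmfgahbcdeilnfj''),
    (''kkkkkkooprstttt'', ''ablmicdefgkabhnjcdefioabglmcdefhkabjincdefgoabhlmcdefjiabkgncdefho''),
    (''kkkkklllooottt'', ''abcilfmgdejabchknfidegabcjhlmfdekabcgihnjdefabckglhmdeiabcfjgnhdek''),
    (''kkkkklmmnnottt'', ''gflabickdhejmgabfcndiehklabgcfdjemihabkcgdfenjlabhcidgefkmabjchdne''),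
    (''kkkkklmooooost'', ''ahbicdjekfgamblcdheinfagbjcdkelmhafbgcdiejnkalbfcdgehmiajbkcdfegln''),
    (''kkkkklnqqqrrrrt'', ''hkoabijcldemfgabnhckdeijfabglcmdeonhabfkcgdeijlabmfcndeg''),
    (''kkkkklooppstttt'', ''albfgcdheimanbjfcdkegoahbilcdfemjanbgkcdhefiaobljcdgemfanbhicdkejo''),
    (''kkkkkmmmmmmtt'', ''afbgchlidejakbfcgmhdeiajbkcflgdehaibjckmfdegahbicjlkdefagbhcimjdek''),
    (''kkkkkmmmmpsstt'', ''ajbfcgmkdehaibncfjgdelahbicmkfdegajbhcinldefagbmchjidekafbgcnlhdei''),
    (''kkkkkmmmstttttt'', ''abicjdfeklgabhcmdnefoiabgchdjeklfabmcgdhenoiabfcjdgehklabmcfdnegoh''),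
    (''kkkkkmmoptttttt'', ''jkafbhcidgelmanbfcodhegiajbkcfdlemnagbhcidfeojakbgcldhefiambncgdoe'')]"
  by (simp only: cert_simps)

lemmas [simp] = certs_valid [OF large_words_4, simplified]

lemma large_words_5: "list_all cert_ok [
    (''kkkkkmnnnnnnn'', ''ghabcijdklefmabcghdijeklabcmfdgheijabckldmfe''),
    (''kkkkknnssttttttt'', ''jkabhcdlemnofabgcdiepjkhabfcdgelmnoabicdfepg''),
    (''kkkkkoooppptttt'', ''ilabcfgdehmjnabckidefoglabchjdemkinabcfgdeohjlabckidefgmnabchjdeok''),
    (''kkkkkopptttttttt'', ''abcdefijklgabcdehmnofpabcdegijklhabcdefmnopgabcdehijkflabcdegmnoph''),
    (''kkkkkppppppppp'', ''abfgchdeijkablmcndefghabijckdelmn''), (''kkkkktttttttttttt'', ''abcdefghijkabcdelmnopq''),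
    (''kkkkloooostttttt'', ''klmefabgcdnhopieabjcdfglkmhabecdinpofgabjcdehlkimabfcdgenpohabicdj''),
    (''kkkkmmmmmmtttt'', ''aekflgbchdiajmenfbcgdhailjkebcfdgahnimjbcedfaglhkibcjdeafngmhbcidj''),
    (''kkkkmmmmptttttt'', ''aebjkflgcdiahbemnofcdgajbhieklcdfagbmnhoecdiafbgjklhcdeambfignocdh''),
    (''kkkkmmnooootttt'', ''aeblmfhgcdiajbeknofcdhagbilejmcdfakbhgonecdiafbjlkmhcdeagbfionjcdk''),
    (''kkkkmmnprttttttt'', ''ajbkhelmcdfanbgopiecdhafbjklgmcdeanbfhopicdgaebjkflmcdhanbegopfcdi''),
    (''kkkkmnnnoootttt'', ''ialjmfbgecdhankiobjfcdeaghmlbkicdjaefngbhocdk''),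
    (''kkkkmnooossttttt'', ''lgambfcjdehnkaibgcodfpelahbmcidgnjfaebkchdpoi''),
    (''kkkkmostttttttttt'', ''hiajbfcdklemnaobgcdpfqheajbicdkmlnoaebfcdgpqhjaibecdkflmnaobgcdeqp''),
    (''kkkkmqqqqrrrttttt'', ''abjmcndfghoabekcidlpjqabfgcedhnmkabilcjdeofgabhpcqdkiel''),
    (''kkkknnnnnnnntt'', ''aefmghbcdijaklnefbcdghaijmklbcdefaghnijbcdkl''),
    (''kkkknnnnnnttttt'', ''abefcdgklhiabjmcdefngoabhicdjklefabgmcdhiojn''),
    (''kkkknnnntttttttt'', ''abecdfijkglabhcdemnfopabgcdhjieklabfcdgmnhop''),
    (''kkkknnnqqqrrrrtt'', ''koahpbicldefjagmbnckdhoiaefbgcldjmpankbecfdghiaolbjcmdefnagkbpchdiljaefbgcmdn''),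
    (''kkkknnttttttttttt'', ''gheijkabfcdlmnopeabqcdfghijkabecdlmofnpabqcd''),
    (''kkkknoooppppppt'', ''afbijocdgklaebmnhcdfijagbkelcdmhn''),
    (''kkkkooooqqqrrttt'', ''eablfncmodigabhejckfdlpabmgichednjabfokclgdmhabeipcfjdnkabghlcemdofabijpcghdk''),
    (''kkkkoqqqqqqqqqq'', ''fghabijkecdlmnabofghcdijkabelmncdo''),
    (''kkkkorrrrrrrssttt'', ''aebmocfdgphaibnjcedqklambfgchdoieanbjpckdlmfaqbegchdinjaobklcmdefpagbhicndjqk''),
    (''kkkkpppppptttttt'', ''eakbcfglmdhianbcjeopdfgakbchilmdjeanbcgfopdhiakbcjelmdgfanbchipodj''),
    (''kkkkppptttttttttt'', ''abcehijdkflabcgmnodepqabcfihjdgklabcenmodfpqabcgihjdelkabcfnmodgpq''),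
    (''kkkkppqqqqqqqqtt'', ''gahibjocefdkalmbngchidjaepbfkclmdn''),
    (''kkkllmmmnprsttt'', ''mafkbgchnldeaijbfcgohmdaekbicfjgnhaldbecoifmgahjbdckenlfaigbhcdjeo''),
    (''kkkllmmoppptttt'', ''afigbcljmdhaekfbcgniodajehbcflgkmadiebcjhfngaodkbcelimfagjdbchekno''),
    (''kkkllnoqqqqqrrtt'', ''mabhiocfnjdeabgklcmphfdabeincgjoklabdefcmhpigabndecjfkloabmgdcehinfabjpkcdegl''),
    (''kkkllopppprttttt'', ''abgckhlidmjabecfnogpdhabicejlkfmdabgcheonipjabdcflegkhmabicdjneofp''),
    (''kkklmmnoooopstt'', ''ablhecfingdabjkmcelfhoabdgicjkenfabldhcmgioeabfjdcklhngabeifcdmjok''),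
    (''kkklmppsttttttttt'', ''eafbcgijkdlmaebchnfopdgaqbceikjlmdafbcgnehopqadbckijfeglambcdnohpq''),
    (''kkklnnnnqqqqrrtt'', ''aoidbpmjcefaghnbdklcioaefmbgdhcjnaklpbefdcghaimobjnkcdfaelgbhpicmdajfnbegkchl''),
    (''kkklopqqqqrrrsttt'', ''naogpkebchidalqjfmbcnegadkhiobclfpajdemnbcgqkahidflbcejoamngdpbckfhaeilqdbcjm''),
    (''kkkmmmmmmmoott'', ''adbecfkghimajbdcelfngkaibjcdhemflagbicjkdhenafbgciljmdkaebfcghinjl''),
    (''kkkmmmmmmrttttt'', ''abdcejfkglhabicdmenfogabhcikdjelfabgchmindoeabfcgkhlijdabecfmgnhoi''),
    (''kkkmmmmmpppqqqt'', ''abdlmceiojfabghdcknelmabfigchdjoeabknfcglhmdabiejcfkgnh''),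
    (''kkkmmmmnoootttt'', ''adbilemfjcgahbkdnoeicfagblhjdmkceafbginohdcjaebflkgmicdahbejfnogck''),
    (''kkkmmmmpsstttttt'', ''dklaebcfimjgndahbceofpklgadbcjmehfinagbcdopkelfahbcgmdjineafbcopgh'')]"
  by (simp only: cert_simps)

lemmas [simp] = certs_valid [OF large_words_5, simplified]

lemma large_words_6: "list_all cert_ok [
    (''kkkmmmoooqrssttt'', ''dlagbhcemfnkiadbjcgohefpalbdckimngeafbhcdjopliaebfcgkdhmnajbecfiop''),
    (''kkkmmmstttttttttt'', ''hdiajbgcekflmnadbocpqehfiajbdcgklmenafbocdqphijaebfckgdlmnaobecfqp''),
    (''kkkmmoooooottttt'', ''adfelmgbnchaiodjekbpcfaglhmdibecjaknofgpbdceahijlkmbfcdaegophibjck''),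
    (''kkkmmooooopppst'', ''afkgbchldieanjmbcfkgodaelhbcijmnfadkebcglhoiajmdbcefkngalhibcdmejo''),
    (''kkkmmoooopqrrrtt'', ''lfadjebomcgkhaindbefcpjlagmhbdoceifaknjbgpcdheamlibfocjgdaehkbpnci''),
    (''kkkmmoppppprssst'', ''lgdhaebpijcfmknadbeghcolijafbdkecpmghanbijdcefkoalbghpcdiejambnfkco''),
    (''kkkmmoprstttttttt'', ''abdcjkflmheabgcdinopqfabecjkdglmhabicefnodpqabgcjkelmfdabhcinogepq''),
    (''kkkmnoooooopppt'', ''faglbhcimdjeaknbfcglhodamebicjnkfgadlbhcemiojankbdcfglehamibjcdnko''),
    (''kkkmoppprsttttttt'', ''adbkcfglhmnaibdcejopqfagbhcdklmenaibjcfgdhopaqbecklmndfagbhcijeopq''),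
    (''kkknnnnnnnntttt'', ''daefbcghlmijakdbcefnghoaijbclkdemfaghbcijnok''),
    (''kkknnnnnnnoottt'', ''kamdefgnhbciajlkodefbcgahimjnlkbcdaefghiojbcl''),
    (''kkknnnnnnttttttt'', ''adejfklbcghaimndeobcfpaghjiklbcdeafmnghobcip''),
    (''kkknnnnnqqqqrrrt'', ''dpiejafgmbchnodkaelibcfgjhmadpnbceokfgahlibcdjmenafgobchkl''),
    (''kkknnnntttttttttt'', ''abchijdeklmabcfgnopqdeabcihjfgkmlabcdenopqfg''),
    (''kkknnnooootttttt'', ''kadelgmhbicnafjodepbgchaiklfmjbdceagnhoipbfcj''),
    (''kkknnoqqqqqqrrttt'', ''omabdegcnhipfabjklcdemqgabnfhcoijdeabklpcmfgnhabdeicqjkloabfmgcdenhpabijkcflq''),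
    (''kkknpppqqqqqqqqt'', ''habeijdcklmnabfgohcedijabklmncfgpo''),
    (''kkkooooottttttttt'', ''dabijkeflcmgabhdnopqcefabjgkihdcmlabefnoqgcph''),
    (''kkkooooqqqqqstttt'', ''hdaebijcfngkoalbdmcehpqfagbjickdlneambfocghpjiadbekclqfmganbhjcdeiopafbkgclmq''),
    (''kkkpppppppssttttt'', ''abcdefmnghkabcoijpldefabcghmnkqijabcdefopghlabcijmnkdefabcghoplijq''),
    (''kklllpqssssssssst'', ''cdehijkfgablcdemnopqabhicdejkfgablmncdeophabifjkcdeglabmnqop''),
    (''kkllmmoopprttttt'', ''iabejflmgncdabhkeifojpcabdgmlehfniabcdjkogepfabhcdimlnjeabfgcdhkop''),
    (''kklloppppsttttttt'', ''fabkglhmcindabeojfpqcghabdkilemncfabodghjpqicabekdflmnghabciodejpq''),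
    (''kklmmmooppqqrttt'', ''dnaeiocgbhmfkadjepcbilgnafhdoebcmjkaigfpdbechlanojmfbdiceaghpklbfj''),
    (''kklmmmoppprsssst'', ''dchlmabeinofgdcjabkheplmfidabcgjneohkfabdciplgejmabfhdcknoieabgjfp''),
    (''kklmnoooprstttttt'', ''labfgjmdhnocabeikpfgdqlabchjemoindabfcgpkheqlabdicofmjgnabehdcpkiq''),
    (''kklmoppppppptttt'', ''abfgdhmnijcabkelodfgphabcijmnedklabfcghopijdabekclmfnghabdijceokpl''),
    (''kklnnnnnopqqqqqt'', ''dkablmcniefghabjdockplmiabefghcjdnoabkilefcghmabjdnopicefabghkldjmcnabiefghop''),
    (''kkmmmmmmmmttttt'', ''kcdlefghmabijncdoefgabhkijlcdmeabfghnijocdabekfghlijmabcdenfghoiabj''),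
    (''kkmmmmmmnoptttt'', ''cljdaebfmginhkcadbejflogihacbdkmefjngahbcidolefkagbjhcmdineafbgkoh''),
    (''kkmmmmmmtttttttt'', ''acidjekflbgahmcndoepbfagihjcldkbeafngmhocpbdaeiflgjhkbcadnemfogpbh''),
    (''kkmmmmmnorrstttt'', ''acbdjemnfghaibcodpelkfagbhmcidnejafbgolhcpdiaebkfgmnjchadbeiofgplk''),
    (''kkmmmmmoqqqqrsst'', ''cdijphaebfmgkcdnlaobehfigjcdambpkenfhgoacbdljiemfkagbhcdnopelafbgijcdhmkaebfngol''),
    (''kkmmmmnooorrsstt'', ''acodhemnbfiagjcpdkebhlafoigcjdbemanhfkplcbdgaeijofhmbcnadgeplifbjk''),
    (''kkmmmmnpppqqqqrt'', ''habklcdigefmabjonhcdklgabefimpjcdoabgnefhklicabdjmgefonp''),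
    (''kkmmmmoooprrssst'', ''acklgbhmdneaficjbpogkdaehfmbclijnadgepbfochkaimdjbelfgcanhpobdiejf''),
    (''kkmmmmooppppqttt'', ''cabnijdgoefkabchlmpdijeabfgckohndlabeifjcgmpkabdhelfoicjabgmdkehfpl''),
    (''kkmmmmpsstttttttt'', ''hcabdjgkelfmiabcndopqegfabhjckdlmieabfngocqdphabejfklmcgdabineofqp''),
    (''kkmmmooooopqrstt'', ''mkolfacgdbehpijnakmcbdfegohalijbckdpefanghbmicjdoaeklbfghpciadnebj''),
    (''kkmmmooqqqrrssttt'', ''cmaohibjpdfenacgkbqlmhdiaefcbjgnopkadlebcmfihqagjdbenckloafpmbdgehciajqnbfkdleg'')]"
  by (simp only: cert_simps)

lemmas [simp] = certs_valid [OF large_words_6, simplified]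

lemma large_words_7: "list_all cert_ok [
    (''kkmmmopppppppttt'', ''cghniabjkdeofclmabghipdjkecabflmongdhiabcjkefplmdabghcioejkfabdlmp''),
    (''kkmmmoppprrsttttt'', ''acgmjfndhbeaoicplkgqbdaefhmcjinboadgeplfchbkaimdqengjbcafhopdielbk''),
    (''kkmmnnnppppqqqqr'', ''palmchijedbfagnkocplmbeadfhgijcnbkaoedlfmghbcaijnkedofbg''),
    (''kkmmoooooppppttt'', ''jnkabefgochdlmabijkpefcgdabhlmoinjkcabdfeghplmiabcjdkofeghablicmdp''),
    (''kkmmooopppssstttt'', ''abhienckdflabgojpmhcidabenkfglqjcabdhioepmfgabcjdnklhieabfgcodpjmq''),
    (''kkmmoppppprrttttt'', ''fkmeaghcnbdiojpaflekbcgdhmaiqjnbfecodapghlbkijmcadfenbqghopacidjbl''),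
    (''kkmnnnnnnqqqrrrt'', ''dmenacfjgbhikodaelcmbfgnhiajdkebcolfgahimnbdeckjafgohbilp''),
    (''kkmnqqqrrrrsssssss'', ''lmnohieabfgcjdpqrkablmnochideabfgjpqrck''),
    (''kkmooppqrssstttttt'', ''ambnjdekicfagbohplqrdeacbmfngjkihaobcdepqlfragbmnchjdekaibfopgcqlr''),
    (''kkmoppppppptttttt'', ''abeflmndcghabijkopefqcabdghlmijknabcefodpghqabijcklmefdabghopcijqk''),
    (''kknnnnnnnnooott'', ''cdefnkabghilmjcdeabfkoghinlmabjcdefkghiablmoj''),
    (''kknnnnnnooottttt'', ''iabcdeljfghmabkincdeopjabfghlkicdeabmjnfghopk''),
    (''kknnnnnpqqqrrsttt'', ''ncdaebfilomjkgacbdenfhpqialgbcmdejfkahnbogicldeamfbjkhpgq''),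
    (''kknnnoooqqqqqsttt'', ''finopjkgabcdhelfmqiabngjcdkheoabfmlipgcdnabhejkfqomlabgcdihenpfabjkmlgcdqhabe''),
    (''kknnnpqqqqqqsstttt'', ''cmdngeabhijkfocldabepgqmnhijabcdkeflorgabphicdjeqkabflmgnocdhabeijkpfqlr''),
    (''kknnnqqqqqqrrrrtt'', ''clmdaepfgnbohicajdkelbmqfgancohdbepijaklmfcbgdneaoqhijbk''),
    (''klllnnnnnnnqqrs'', ''efbcdoghniajklbcdefmgahiojbcdkneaflghibcdjmakoefngbcdhailjkm''),
    (''klllnnnnnnoqqqq'', ''bcldemfghaijbckdnoelafghbcidjkmaenofbcgdhiajklembcfdgahinjok''),
    (''kllmmmmmmmmqrr'', ''defghmibclajkdefghnibacmjkdefghliabcnjk''),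
    (''kllmmmmqqqssssss'', ''defklmbhciagjdefnobpcaklgmdefhbiacjnogp''),
    (''kllmnnnoooqqrsst'', ''bkcenfdhlaigbjcomekfadhnbicgjlpaefdobhcmigajknefbdclhaoigmjp''),
    (''kllmnnnopppqqqrt'', ''eflbcmipdhajgnebcfkloadmihgbcejfankdlpobcgmaefihdjnbckaglpefmdibcahjngko''),
    (''kllnnnnpqqqqttttt'', ''mbcindefopajkbclghqdeafmibcnjkgoadelfbchpiqagjkdebcflmahnogipbcdeafjklqhg''),
    (''kllnnpppqqqqqsttt'', ''fbciodepqgajkbclmhfdeainobcgjkpqadelmbchfinagjkdebcolmahfpiqgbcdeajknlmh''),
    (''klmmmooooopqqqst'', ''lcmdfeogahibjkcndleafmgbhiocjdaeknlbfgmhcadiejobkpnfacgdheibjlmakocfdgebhiajnp''),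
    (''klnnnnnoooopqrst'', ''hibjkpocdeafglbhinjkmacdefbgolhiajkncdbefgmaphiojkbcdeafglnm''),
    (''klnnoqqqqqqqqqqtt'', ''bfgcdphqiajkblmnocdeafghbipjkqlacdmnboefghaijkcdblpmnaoefghqbcdiajklmneo''),
    (''kmmmmmmmmqqqsss'', ''bcdemfngahjikbcdeofaglhminbcdeafjgkhoil''),
    (''kmmmmmmoppsssttt'', ''kbnacdeolhfgipabjcdemknfgahobicdejlpafgmkbhcdeianjfgolbpcdaehmifgj''),
    (''kmmmmmmrrsssstttt'', ''bcdnjkaeofghlbcdiampeqfgjkbcadnlheifgmoabcdjkqepfgahlbcdinmeoafgjkbcdhqlaeifgpm''),
    (''kmmmmmnnppqqqrrt'', ''iankbcdjgefoahlmibcdnkgaefjhpobcdlamgefinhkbcadjopgeflmh''),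
    (''kmmmmmnooqqqrrst'', ''bjacohdgmenfiabkcljdhgeoafmbicnpdkleahfgbjciodmaenkfhbgclpadiejofmbhcagndkeilfp''),
    (''kmmmmmooooorsttt'', ''agnbcdeohmiajfklbcdepgahnifjobcdeakmglhfipbcadejnkogfhmabcdeipjlkf''),
    (''kmmmmnoqrrrrrrrtt'', ''giajhbcdekflpamgnobcdeijafhkqlgbcdeamnofijphbcadegklqfmnoabcdeijghpfaklbcdemnoq''),
    (''kmmmmoooooopsttt'', ''fagmbcdnheijalkfobcdgpeahijmnlbcdkaefgohijpbcadlekmfgnhiabcdjeolkp''),
    (''kmmmmoooprssttttt'', ''mbnklcdeafghopbijqcadenmfghbklacideopqjfbaghcmdeniklabfopcgdehqaji''),
    (''kmmmmrrrrssssssss'', ''jfaklbgcmhndeaiopqbjcfkladegmhnbicoapqdejfklbgacmnhdeoipqabjckfldegmanhbocpiqde''),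
    (''kmmmnnnnnppqrrtt'', ''efmghaionlbcdjefaghkimpbcdnaeflghjikbcadmoefnghliabcdjkp''),
    (''kmmmnnnqqqrrrsstt'', ''enpaokblcdhifgaejmqbncdokafglehibjcdampnfgoekblacdhijqfgm''),
    (''kmmnnpqqqqqrrrrrt'', ''ghialjbckdemnfaopghbcildeajkqfmnbcopadeghiljkbcafmndeopq'')]"
  by (simp only: cert_simps)

lemmas [simp] = certs_valid [OF large_words_7, simplified]

lemma large_words_8: "list_all cert_ok [
    (''kmoppppppppppppt'', ''abdefghijkcalmbnopdefgahijkbclmnoadefgphbijkaclmnodefbgahijkcplmno''),
    (''knnnnnnnnpqqqrrt'', ''kbcndelfaghjoimbckdaefnghlpijbacodefmghknaibjcldefogahmpi''),
    (''knnnnopppppqqqqrt'', ''blcdmpaneghijkbocadflmepnghiabcjdkofelmaqngbchdjikaeoflmpbcndagjheikfoq''),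
    (''knppqqqqqqqqqqqqt'', ''efghacdijbklmnoapefghcdbijaklmnoqp''), (''llllllllllltt'', ''abcdefghijklabcdefghijkm''),
    (''llllllllllrrr'', ''abcdekfghijlabcdemfghijkabcdelfghijm''),
    (''lllllllllpppp'', ''abcjdefkghilabcmdefjghikabcldefmghijabckdeflghim''),
    (''lllllllllttttt'', ''abcjdefkghilabcmdefnghijabckdeflghimabcndefjghikabcldefmghin''),
    (''llllllllpppptt'', ''abcidefjghmkabcldefighnjabckdeflghmiabcjdefkghnl''),
    (''llllllllppttttt'', ''abcidefkghljabcmdefighnoabcjdefkghliabcmdefjghno''),
    (''lllllllrrrrrrtt'', ''abchdiefgjnkabcldmefghoiabcjdkefglnmabchdiefgjokabcldmefghniabcjdkefglom''),
    (''llllllnnnnnntt'', ''mgabhcidjekfnlabgchdiejfkmablcgdheifjnabkcldgehfimabjckdlegfhnabicjdkelf''),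
    (''llllllnnnnqtttt'', ''akbgchdlmefiajbncgdhkefoaibjcldgmefhakbicjdnoefgahblcidjkefmagbhcndioefj''),
    (''llllllpppppppp'', ''abghcdijefklabmncdghefijabklcdmnefghabijcdklefmn''),
    (''llllllppppppttt'', ''abghcdimefjkablncdghefioabjkcdlmefghabincdjkeflo''),
    (''llllllrrrrrrrrr'', ''agbhcidjekflambncodgehfiajbkcldmenfo''),
    (''lllllltttttttttt'', ''abghcdijefklabmncdopefghabijcdklefmnabopcdghefijabklcdmnefop''),
    (''lllllnnnnrrrrrtt'', ''abcojkdfeglhabcimndpefjgabchkidleomfabcgnhdpeijkabcflgdhemni''),
    (''lllllnnpqqqqtttt'', ''abmchdnefijoabgckdlehpfmabicgdjenkolabfchdgeipmjabkcfdleghnoabicjdfekpgl''),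
    (''lllllnnqqtttttttt'', ''abfcjdkhlgemabicfdnopqegabhcjdflkiemabgcndphfqeoabicgdjlkmefabhcndgpioeq''),
    (''lllllpppppppptt'', ''abfgcdhienjkablmcdfgeohiabjkcdlmenfgabhicdjkeolm''),
    (''lllllppppppttttt'', ''abfgcdhlemijabkncdfgeohpabijcdklemfgabhncdijeokp''),
    (''lllllpppptttttttt'', ''abcfdjkgelmhabcidnofepqgabchdjkielmfabcgdnohepqi''),
    (''lllllqrrrrrtttttt'', ''abglchmdiefnabjockpdgeqhabifclmdjenkabgochpdiefqabjlckmdgenhabifcopdjeqk''),
    (''llllmnnnopqqsttt'', ''afkgbchdminealjfbcgdhkopaeimbcfdglhjanekbcidfogpahlebcjdkifmagnhbcedlpjo''),
    (''llllmnnqqqttttttt'', ''hkalbfigcdmnejaobhpfcdgiqeakbljmcdfhgnaeboipcdqjfkagbehlcdminoafbgejcdpq''),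
    (''llllmnqqqrrtttttt'', ''abclgmendhifabcojkpedgqlabcfihmndejkabcgofpqdiehabcljkmfdgneabcihqopdfjk''),
    (''lllloooooooooo'', ''aefbghcijdklamnbefcghdijaklbmncefdghaijbklcmndefaghbijckldmn''),
    (''llllooooooooott'', ''aefbghcijdklamnbefcghdijaklbmocefdghaijbklcmndefaghbijckldmo''),
    (''llllpppppppptttt'', ''abefcmghdnijabklcoefdpghabijcmkldnefabghcoijdpkl''),
    (''llllqqqqqqqrrtttt'', ''anbefgcdhijoakblmpcdeqfgahbijncdklmoapbefgcdhijqakblmncdefgpahboijcdklmq''),
    (''llllrrrrrrrrrrrr'', ''abefghcdijklabmnopcdefghabijklcdmnop''),
    (''llllrrrrrrrrrrrtt'', ''abefghcdijklabmnopcdefghabijklcdmnoq''),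
    (''lllmmmqssssssssst'', ''defhijkabclmgdefnopabchijkdeflmabcgnopq''),
    (''lllmmnnpqqqtttttt'', ''abfcilhmndejabgckfopqideabhcgjnflmkdabecioghpfqjabdceknlgimfabhcdejopqgk''),
    (''lllmnnnnoqqqrrrs'', ''abijklcefgphabdmnicojefgabhdlkcpimneabfgdochjlkiabepfdcgmhno''),
    (''lllmnnpqqqrrttttt'', ''aebfhkmcglndaibeofjcphqkadblgeicfmnjaobdhkpcelfgaibqdjncmhekafblgdocipjq''),
    (''lllnnnnrrrrrsssst'', ''hiqajkdmbcenfgoaplhibcdjekfagmnqbcopdleafhgibcjkmndaeofpbcgl''),
    (''lllnnnppqqqrssttt'', ''daeoimbcgjkpfadhelbcniqogafjdkbcemhlpainfgbcdjekqahomlbcfidgeajpknbchqfl''),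
    (''lllnpqqqqqqqqrttt'', ''afgbhopijdckalmbenfgqhcdaijbkolmpecnadfbghijqkclaembdnpfogchajibkedlmqcn'')]"
  by (simp only: cert_simps)

lemmas [simp] = certs_valid [OF large_words_8, simplified]

lemma large_words_9: "list_all cert_ok [
    (''lllpppppppppppp'', ''adefbghicjklamnobdefcghiajklbmnocdefaghibjklcmno''),
    (''lllppppppppppttt'', ''adefbghncijkalmobdefcghpaijkblmncdefaghobijkclmp''),
    (''lllpppppppptttttt'', ''abdeclfgmnhiabjkcodepqfgabhicljkmndeabfgcohipqjk''),
    (''lllqqqqqqrrrrrrtt'', ''jabpdefgcklhiabmnojqcdefgabklpihcmnojabdefgqcklihabmnojpcdefgabklihqcmno''),
    (''lllttttttttttttttt'', ''adefbghicjklamnobpqrcdefaghibjklcmnoapqrbdefcghiajklbmnocpqr''),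
    (''llmnnnnnnppqqqrt'', ''oabdjelfgmchiabkndpejfgclabmhiodkenfcabgjlhimdpekabcfgnohijdlabecmfgkphin''),
    (''llmnpqqqqqqqrrrtt'', ''fgabhijcpkldmnaboefgchijqdabklmnpcoefgabdhijqkclmnaboedfgphcijabklmndeoq''),
    (''llnnnnppqqqqqrttt'', ''nigabjkcodplemfabhnigcjdkqeablmfohpcndiabegjkflmqchabdneiogfjkpabcldmehq''),
    (''llnqqqqqqqqqrrrrt'', ''adeqmncbfghiajopkldbcemnafghqijbopclakdemnfbghijacoplqkbdemnafgchijboplk''),
    (''llnqqqqqrrrrrttttt'', ''ainjkbolmdpeacfghbqirjknalmcdboefghpaiqjkbclmrdnaefgobhicjkpalmdqbefgrch''),
    (''llpppppppppppptt'', ''acdebfghoijkalmnbcdepfghaijkblmnocdeafghbijkplmn''),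
    (''llrrrrrrrrrrrrrrr'', ''acdefgbhijklamnopqbcdefgahijklbmnopq''),
    (''llrrrrrrrrrtttttttt'', ''lmacdenobfghpqaijkrsbcdelmafghnobijkpqacdersbfghlmaijknobcdepqafghrsbijk''),
    (''lmmmmmmmqqssssst'', ''kibcldmefagnphjbcodkeafgilhmbcndpaefgjoh''),
    (''lmmmmmnoopqqrrst'', ''bpchdmgnefajobickdhlgefamnbjcidophefakgblcmdinjefhaobgckdlpiefamhbncgdjokefail''),
    (''lmmmmpppppppqqqt'', ''bcdfgehmnijakbcdloefgphamnbcdijekloafghbcdmneijaklpo''),
    (''lmmmpppqqqqqqqqtt'', ''ebcdhipjklfamnbcdogeqhiajklbcdfmnpoagehibcdjklfamnqog''),
    (''lmmoooooppppppqt'', ''idbjckleomfagnhbicdjpklaemfgbnchidoajklepbmcfgnahidojkblcemafgnhp''),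
    (''lmnnpppqqqqqqqqqt'', ''hcdijaeklmbfnopcdaghijebklmfqacdnopgbhijeaklcdmfqbnopaghijcdekblmafnopgq''),
    (''lrrrrrrrrrrrrrrrtt'', ''abcdefqghijkalmnoprbcdefaghijkqlmnopabcdefrghijkalmnopqbcdefaghijkrlmnop''),
    (''mmmmmmmmmmmmtt'', ''abcdefghijklmabcdefghijkln''), (''mmmmmmmmmmmtttt'', ''abcdefghijklmabcdefghijkno''),
    (''mmmmmmmmmmqqttt'', ''abcmdefgnhijkabcldefgohijmabckdefglhijnabcodefgkhijl''),
    (''mmmmmmmmmppprrr'', ''amjbcdefgnhikaolbcdefgmhijankbcdefgohil''),
    (''mmmmmmmmnnoqqrs'', ''aobicdjlefkghambncdijeofghakblcdmiejfgnhabokcdleifgjhabmncdkeofgihabljcdmekfgnh''),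
    (''mmmmmmmmoosstttt'', ''abckdiemfngjhabcodleifkgphabcjdmenfiglhabckdjeofpgihabcmdlejfkgnhabcidoepfjglh''),
    (''mmmmmmmmoqqqtttt'', ''abmncdiejfghkabolcdpeifghjabmkcdnelfghiabpjcdoekfghl''),
    (''mmmmmmmmpttttttt'', ''jkabcdlmiefghnoabcdpjkefghlmabcdinoefghp''),
    (''mmmmmmmoooooott'', ''nhabcidjekflgomabchdiejfkglnabcmdheifjgkoabcldmehfigjnabckdlemfhgioabcjdkelfmg''),
    (''mmmmmmmoooostttt'', ''abcdlehfigmnjabcdkeofhgilpabcdjekfmghniabcdlejfkgophabcdiemfjgklnabcdheifogjpk''),
    (''mmmmmmmoopppqttt'', ''ajbhcdefmgnkoaiblcdefjghpmakbicdeflgojhanbmcdefkgilp''),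
    (''mmmmmmmoopqqqqtt'', ''abcdhekfigljoabcdmehfngikpabcdlejfhgmoiabcdnekflghjpabcdiemfngkohabcdleifjgmpn''),
    (''mmmmmmpppppppptt'', ''aghboijcdefklamnbghpcdefijaklbmnocdefghaijbklpcdefmn''),
    (''mmmmmmqqqrrrrrstt'', ''aobcdepghjfikalbcdemnoqfghajbcdekilpfmnaobcdeghjqfkialbcdenmopfghajbcdekiqlfnm''),
    (''mmmmmmqrrsstttttt'', ''labcmhngdeiofpabcjkqldehmfnabcgoipdejkfq''),
    (''mmmmmmqrssttttttt'', ''klmabcijhgdefnopabcqklmdefhijabcgnopdefq''),
    (''mmmmmmrrrrsssssst'', ''gabcdqhkeiflmjabcdnopegfhqkabcdilmejfnop''),
    (''mmmmmoopqqqrrrstt'', ''plambcfodgeinjhakbcqldfemgopaibchndjefklgambcoidqehnfjagbcpkdlemoihafbcgndjekq''),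
    (''mmmmooooppqrrrsst'', ''ialebjcmdkqofgahibecpdjnlmkafgbhcidqeojpanlbfcgdhikemajqbocfdgphn''),
    (''mmmmrssttttttttttt'', ''habijklecdfgmnabopqrhcdijklabegfmncdopqr'')]"
  by (simp only: cert_simps)

lemmas [simp] = certs_valid [OF large_words_9, simplified]

lemma large_words_10: "list_all cert_ok [
    (''mmnnnnnpqqqqqrrtt'', ''cdefijghnokablcdefpmgijhabnocdefklgqmabijhcdefnogkablpmq''),
    (''mnnnnnqqqqqqqqrrt'', ''obcdeghijkalfmnbcdepoqgahifjkbcdelmnapogfhibcdejkalqmnfp''),
    (''nnnnnnnnnnnnttt'', ''abcdefmghijklnabcdefoghijklmabcdefnghijklo''),
    (''nnnnnnnnnntttttt'', ''abcdeklfghijmnabcdeopfghijklabcdemnfghijop''),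
    (''nnnnnnnnttttttttt'', ''abcdijkefghlmnabcdopqefghijkabcdlmnefghopq''),
    (''nnnnnnnqqqqqqqqtt'', ''ahipjkbcdefglmanoqhibcdefgjkalmpnobcdefghiajkqlmbcdefgno''),
    (''nnnnnqqqqqqqrstttt'', ''abcofdgmehipqjabckldnfeogmhiabcjpdkleqfnrgabchidjoeklmpfabcgqdhiejnrkl''),
    (''ooooooooooootttt'', ''abcdmefghnijkloabcdpefghmijklnabcdoefghpijklmabcdnefghoijklp''),
    (''oooooooootttttttt'', ''abcjkdeflmghinoabcpqdefjkghilmabcnodefpqghijkabclmdefnoghipq''),
    (''ooooootttttttttttt'', ''abghicdjklefmnoabpqrcdghiefjklabmnocdpqrefghiabjklcdmnoefpqr''),
    (''oootttttttttttttttt'', ''adefgbhijkclmnoapqrsbdefgchijkalmnobpqrscdefgahijkblmnocpqrs''),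
    (''ppppppppppppttttt'', ''abcmdefnghiojklpabcqdefmghinjkloabcpdefqghimjklnabcodefpghiqjklmabcndefoghipjklq''),
    (''pppppppptttttttttt'', ''abijcdklefmnghopabqrcdijefklghmnabopcdqrefijghklabmncdopefqrghijabklcdmnefopghqr''),
    (''ppppttttttttttttttt'', ''aefgbhijcklmdnopaqrsbefgchijdklmanopbqrscefgdhijaklmbnopcqrsdefgahijbklmcnopdqrs''),
    (''qqqqqqqqqqqqqqtttt'', ''abcdefghoijpklqmnabcdefghrijoklpmnabcdefghqijrklomnabcdefghpijqklrmn''),
    (''qqqqqqqqqqqqqtttttt'', ''abcdefghijknolpqmabcdefghijkrslnomabcdefghijkpqlrsm''),
    (''rrrrrrrrrrrrrrrtttt'', ''abcdepfghijqklmnorabcdesfghijpklmnoqabcderfghijsklmnopabcdeqfghijrklmnos'')]"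
  by (simp only: cert_simps)

lemmas [simp] = certs_valid [OF large_words_10, simplified]

section \<open>Search over boxes with all periods at least 9\<close>

lemma large_1: "solved large_cfg [0, 0, 0, 0, 2, 4, 8, 8, 8, 8, 8, 13] [4, 4, 4, 11, 12, 13, 14, 14, 14, 14, 14, 14]"
  by (rule check_solved[where t = "B 3 6 (C ''ikca'' (B 11 14 (C ''fmad'' (W ''jjjjooooooooo'')) (C ''ec'' (B 4 12 (C ''dbfegiedffhjfgjl'' (B 2 4
    (C ''fheegjhkjmil'' (B 0 2 (C ''glfidcefeghmfjjn'' (B 4 11 (C ''gmin'' (B 2 3 (C ''eiaa'' (B 3 5 (C ''fm'' (W
    ''immmmnnnnnnnnt'')) (W ''illllmnnnoopqq''))) (B 4 10 (C ''dd'' (B 6 14 (C ''fmaa'' (W ''immmmnnnnnnnnt'')) (W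
    ''lllloooooooooo''))) (W ''kkkmmmmmmmoott'')))) (W ''kllmmmmmmmmqrr''))) (B 4 11 (C ''dc'' (B 4 10 (B 5 13 (B 5
    12 (C ''in'' (B 4 9 (C ''gl'' (B 0 3 (C ''degn'' (W ''lllloooooooooo'')) (W ''jjjooooooooott''))) (W
    ''iimmmmmmqqqqrr''))) (W ''iilmnnnnnnnntt'')) (W ''immmmnnnnnnnnt'')) (W ''jjlmmmmmmmrstt''))) (W
    ''iimmmmmmmmmttt'')))) (B 4 11 (B 5 13 (B 4 10 (B 5 12 (C ''aa'' (B 6 14 (C ''eefhjm'' (B 0 4 (C ''hlefgjimkn''
    (B 0 3 (C ''ehfiin'' (B 0 2 (C ''gmfk'' (W ''ikkkmmnnnnnott'')) (W ''iimmmmmmqqqqrr''))) (B 4 7 (W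
    ''iiikmmnnopqqtt'') (W ''iiikmmnnopqqtt'')))) (W ''iiiimppqqqqrrt''))) (W ''lllloooooooooo''))) (W
    ''kkkknnnnnnnntt'')) (W ''kkkkmmmmmmtttt'')) (W ''kkkknnnnnnnntt'')) (W ''kkkkmmmmmmtttt'')))) (W
    ''mmmmmmmmmmmmtt''))))) (C ''hiij'' (B 11 14 (C ''fjcbgk'' (B 3 11 (C ''hlegeh'' (B 0 4 (C ''eiim'' (B 0 3 (B 3
    10 (C ''flaa'' (B 3 9 (C ''cdekab'' (W ''iillllmmmmnpq'')) (W ''illllllllrrrr''))) (W ''llllllllllrrr'')) (W
    ''iiimmmmmmqqqq''))) (W ''iiiimmmmooprt''))) (W ''llllllllllltt''))) (B 3 9 (B 0 4 (C ''ik'' (B 4 12 (C ''fg''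
    (B 7 14 (C ''ca'' (B 5 13 (C ''fhgihj'' (B 5 12 (B 0 2 (C ''jmegehgjfihkil'' (B 2 3 (C ''ejaa'' (B 6 12 (C
    ''dh'' (W ''illlllllrrrrtt'')) (W ''illlllmmmmoptt''))) (B 4 10 (C ''gkhl'' (B 3 8 (C ''aacdhmjn'' (B 3 7 (C
    ''in'' (W ''illllmnnnoopqq'')) (W ''illllllrrrrrrr''))) (W ''llllllllpppptt''))) (B 6 12 (B 2 4 (C ''aa'' (B 3 8
    (C ''ek'' (W ''ikmmmmmmmmmstt'')) (W ''illlllllrrrrtt''))) (W ''kkkkmmmmmmtttt'')) (W ''kkkmmmmmmmoott''))))) (B
    4 11 (B 3 8 (B 9 14 (C ''il'' (B 0 3 (C ''fj'' (B 6 12 (C ''ej'' (W ''jjlmmmmmmmrstt'')) (W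
    ''iillllnnnooott''))) (W ''iiilllrrrrrrtt''))) (W ''iillllrrrrrrrr'')) (W ''jjlllllltttttt'')) (W
    ''iimmmmmmmmmttt''))) (W ''llllllnnnnnntt''))) (W ''llllllnnnnnntt''))) (W ''llllllpppppppp''))) (W
    ''mmmmmmmmmmmmtt''))) (W ''iiiillrrrrtttt'')) (W ''lllllllllttttt''))))"]) simp_all

text \<open>Thirteen or fourteen periods, at least five of them up to 11; \<open>large_1\<close> is
  the counterpart with at most four.\<close>

lemma large_2: "solved large_cfg [0, 0, 5, 5, 5, 5, 6, 7, 7, 8, 8, 13] [8, 9, 10, 11, 12, 13, 14, 14, 14, 14, 14, 14]"
  by (rule check_solved[where t = "B 4 9 (B 0 8 (B 0 7 (B 11 14 (C ''hj'' (B 0 6 (C ''ilggffaafgfhef'' (B 0 5 (B 5 13 (C ''dg'' (B 0 4 (C ''gk'' (B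
    2 8 (C ''achm'' (W ''iiillllrrrrrr'')) (W ''kkkkkkkkopptt''))) (W ''iiiilllrrrrtt''))) (W ''kkkkkmnnnnnnn'')) (W
    ''iiiiimppqqqqt''))) (W ''iiiiiittttttt''))) (C ''ih'' (B 0 6 (C ''jigg'' (B 6 11 (B 2 8 (C ''ffjj'' (B 0 5 (C
    ''hheffgii'' (B 7 14 (C ''kk'' (B 0 2 (C ''dgilgicf'' (B 5 10 (C ''ehjnhk'' (W ''kkkkkklnopprrt'')) (W
    ''kkkkkknnnntttt''))) (B 3 8 (C ''ijjk'' (B 5 10 (C ''kl'' (B 0 4 (C ''df'' (B 9 14 (C ''hk'' (B 2 7 (C ''ehgj''
    (W ''iikkknnnoorttt'')) (W ''iikkkkkrrrrttt''))) (W ''iillllrrrrrrrr''))) (W ''iiiikmqqqqrstt''))) (W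
    ''iikkknnnoorttt''))) (W ''jjlllllltttttt'')))) (W ''kkkkkppppppppp''))) (W ''iiiiirrrrrtttt''))) (W
    ''kkkkkkkktttttt'')) (B 2 7 (B 0 5 (B 0 4 (C ''ff'' (B 7 14 (B 3 8 (B 5 13 (C ''fgjl'' (B 5 12 (C ''ef'' (B 0 2
    (C ''dffhjmeg'' (B 6 12 (C ''aafj'' (W ''ikkkkmmnnnortt'')) (W ''kkkkklmooooost''))) (B 5 8 (C ''im'' (B 3 7 (C
    ''cfhl'' (W ''kkkkkknooopptt'')) (W ''iilllllrrrrrtt''))) (W ''iikkknnnoorttt'')))) (W ''kkkknnnnnnnntt''))) (W
    ''kkkknnnnnnnntt'')) (W ''kkkkklllooottt'')) (W ''kkkkkppppppppp''))) (W ''jjjjooooootttt'')) (W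
    ''jjjjooooootttt'')) (W ''kkkkkkkopptttt'')))) (W ''iiiiiittttttt'')))) (W ''iiiiiittttttt'')) (W
    ''iiiiiittttttt'')) (B 4 11 (B 0 8 (B 0 7 (B 11 14 (B 0 6 (C ''ij'' (B 2 10 (B 0 5 (B 2 9 (C ''ik'' (B 0 4 (C
    ''dfgj'' (B 5 13 (C ''dgjl'' (B 0 2 (C ''hl'' (B 2 8 (C ''hm'' (B 3 9 (C ''cg'' (W ''kkkkkkkoopppp'')) (W
    ''lllllllllpppp''))) (W ''kkkkkkkkopptt''))) (B 3 9 (B 2 8 (C ''hl'' (B 2 7 (C ''hm'' (B 0 3 (C ''dh'' (W
    ''iillllllrrrrr'')) (W ''iiillllrrrrrr''))) (W ''iikkkkkmmpprt''))) (W ''iikkkkkkmoqtt'')) (W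
    ''iilllllllrrtt'')))) (W ''kkkkkmnnnnnnn''))) (W ''iiiimmmmmrrtt''))) (W ''kkkkkkkkktttt'')) (W
    ''iiiiimmmrrttt'')) (W ''kkkkkkkkkktt''))) (W ''iiiiiittttttt'')) (B 7 12 (B 2 8 (B 1 4 (B 4 10 (B 2 7 (C ''ij''
    (B 3 9 (C ''jk'' (B 0 3 (C ''df'' (B 5 11 (C ''aajlhj'' (W ''kkkkkmmmmpsstt'')) (W ''kkkkklmmnnottt''))) (W
    ''iiimmmmmmrrttt''))) (W ''lllllllllttttt''))) (W ''kkkkkkkmmttttt'')) (W ''kkkkmmmmmmtttt'')) (W
    ''jjjjlmmmsttttt'')) (W ''kkkkkkkktttttt'')) (W ''kkkkkmmmmpsstt''))) (W ''iiiiiittttttt'')) (W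
    ''iiiiiittttttt'')) (W ''kkkkkmmmmmmtt''))"]) simp_all

lemma large_3: "solved large_cfg [0, 0, 0, Suc 0, 5, 5, 6, 10, 13, 13, 13, 16] [Suc 0, 2, 2, 5, 7, 7, 11, 14, 16, 16, 16, 16]"
  by (rule check_solved[where t = "B 0 1 (B 3 3 (C ''ggjnko'' (B 2 2 (C ''ffghhkinjokp'' (B 4 7 (C ''gihlio'' (W ''lmmmmpppppppqqqt'')) (B 6 9 (C
    ''ca'' (W ''kmmmmmmoppsssttt'')) (W ''lmmmmmnoopqqrrst'')))) (B 6 11 (C ''ff'' (B 7 14 (B 7 13 (C ''jpef'' (B 6
    9 (C ''egin'' (W ''kkmmmmnpppqqqqrt'')) (W ''kkmmmmoooprrssst''))) (W ''kkmmmopppppppttt'')) (W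
    ''llpppppppppppptt''))) (W ''kkmmmooooopqrstt'')))) (B 7 14 (B 7 13 (B 5 7 (C ''ko'' (B 2 2 (C ''joggkp'' (B 3 5
    (C ''giffhkinjp'' (B 3 4 (C ''cagj'' (W ''klmmmooooopqqqst'')) (W ''llllrrrrrrrrrrrr''))) (B 7 11 (C ''ip'' (W
    ''llllrrrrrrrrrrrr'')) (W ''lllllppppppttttt'')))) (B 6 11 (B 7 12 (C ''jokp'' (B 3 5 (C ''gh'' (B 4 6 (C
    ''ipdd'' (W ''llllrrrrrrrrrrrr'')) (W ''kklmmmoppprsssst''))) (B 9 16 (C ''efgg'' (W ''kklmmmoppprsssst'')) (W
    ''llllrrrrrrrrrrrr'')))) (W ''kklmoppppppptttt'')) (W ''kkmmmooooopqrstt'')))) (B 3 5 (C ''kn'' (B 2 2 (C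
    ''jnko'' (B 6 9 (C ''ioef'' (B 7 12 (C ''caipdd'' (W ''llllrrrrrrrrrrrr'')) (W ''lmmmmpppppppqqqt''))) (B 4 6 (C
    ''io'' (B 7 12 (C ''cagj'' (W ''kllmnnnoooqqrsst'')) (W ''lmmmmpppppppqqqt''))) (W ''lmmmmmnoopqqrrst'')))) (B 6
    11 (B 7 12 (C ''jnko'' (B 4 6 (C ''io'' (B 6 10 (C ''ipdd'' (W ''llllrrrrrrrrrrrr'')) (W ''kllmnnnoooqqrsst'')))
    (W ''kklmmmoppprsssst''))) (W ''kklmoppppppptttt'')) (W ''kkmmmooooopqrstt'')))) (W ''lllllnnpqqqqtttt''))) (W
    ''lllppppppppppttt'')) (W ''llpppppppppppptt''))) (B 3 5 (B 4 7 (B 6 11 (B 6 10 (B 8 16 (C ''db'' (B 7 14 (C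
    ''kn'' (B 3 4 (C ''ffggjn'' (W ''ilmmmnopqqqqqrtt'')) (B 5 6 (C ''jn'' (W ''illlrrrrrrrrrrtt'')) (W
    ''illlmnpqqqqrtttt'')))) (W ''llpppppppppppptt''))) (W ''innnnpppqqqqqqqr'')) (W ''joooooooootttttt'')) (W
    ''joooooooootttttt'')) (W ''jmmmmmmqsssttttt'')) (W ''illllrrrrrrrtttt''))"]) simp_all

lemma large_4: "solved large_cfg [0, 0, 0, Suc 0, 2, 3, 5, 10, 10, 11, 12, 16] [Suc 0, 2, 2, 5, 7, 7, 11, 15, 16, 16, 16, 16]"
  by (rule check_solved[where t = "B 4 5 (C ''knjlikgfjmil'' (B 3 3 (C ''cainfd'' (B 7 15 (C ''ggjoghhkkp'' (B 2 2 (C ''aagj'' (W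
    ''joooooooootttttt'')) (B 7 14 (C ''fegijp'' (B 0 1 (C ''edhm'' (W ''kkmmoooooppppttt'')) (B 6 10 (C ''fg'' (W
    ''imnnnnnppppqqqst'')) (W ''joooooooootttttt'')))) (W ''llpppppppppppptt'')))) (W ''kmoppppppppppppt''))) (B 7
    13 (C ''cafdggjnko'' (B 3 4 (C ''ghimjokp'' (B 1 2 (B 0 1 (C ''ffipgjcbed'' (B 5 7 (C ''hl'' (W
    ''kklmoppppppptttt'')) (W ''kllmnnnoooqqrsst''))) (B 6 10 (C ''jp'' (W ''illrrrrrrrrrrrrr'')) (W
    ''joooooooootttttt''))) (W ''jjooooootttttttt''))) (B 0 1 (C ''jp'' (W ''llllrrrrrrrrrrrr'')) (W
    ''illlrrrrrrrrrrtt'')))) (W ''lllppppppppppttt'')))) (B 7 15 (B 8 13 (C ''dbgfgg'' (B 0 1 (C ''dcffknjl'' (B 2 2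
    (C ''giddhk'' (B 3 5 (C ''jp'' (W ''llllrrrrrrrrrrrr'')) (W ''lllllppppppttttt''))) (B 7 12 (C ''gh'' (B 4 7 (C
    ''ddjn'' (B 4 6 (C ''jp'' (W ''llllrrrrrrrrrrrr'')) (W ''kkllmmoopprttttt''))) (W ''kmmmmmmoppsssttt''))) (W
    ''kklmoppppppptttt'')))) (B 4 7 (B 6 11 (C ''dc'' (B 6 10 (C ''knff'' (B 9 16 (C ''dd'' (B 7 12 (C ''cbdejl'' (W
    ''illllrrrrrrrtttt'')) (W ''illlmnpqqqqrtttt''))) (W ''illrrrrrrrrrrrrr''))) (W ''joooooooootttttt''))) (W
    ''joooooooootttttt'')) (W ''jmmmmmmqsssttttt'')))) (B 6 6 (C ''deaa'' (W ''illllrrrrrrrtttt'')) H)) (W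
    ''lmmmmpppppppqqqt''))"]) (simp_all add: large_3)

lemma large_5: "solved large_cfg [0, 0, 3, 3, 3, 4, 4, 5, 7, 8, 10, 16] [3, 5, 5, 5, 7, 7, 9, 9, 16, 16, 16, 16]"
  by (rule check_solved[where t = "B 8 12 (C ''geedhf'' (B 3 5 (C ''gf'' (B 0 3 (C ''kmfejihgihjj'' (B 0 2 (C ''eeffggkojkiijl'' (B 2 4 (C ''aa''
    (B 4 7 (C ''gi'' (W ''ikknnoooostttttt'')) (W ''jmmmmmmqsssttttt''))) (B 6 9 (B 9 16 (C ''aa'' (B 4 7 (C ''gh''
    (W ''ikkknnoosttttttt'')) (W ''jmmmmmmqsssttttt''))) (W ''llllrrrrrrrrrrrr'')) (W ''kkkkmnooossttttt'')))) (B 4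
    6 (B 6 8 (C ''cdjm'' (W ''iillrrrrrrrrtttt'')) (W ''jjooooootttttttt'')) (W ''jjmmmmsstttttttt'')))) (W
    ''jjjoootttttttttt''))) (B 0 2 (C ''gfjihgkk'' (B 9 16 (C ''ihkl'' (B 5 7 (C ''cdknjj'' (B 6 9 (C ''ffjkhh'' (B
    2 5 (C ''joaa'' (W ''illllrrrrrrrrrr'')) (W ''kkkkkopptttttttt''))) (W ''kkkkloooostttttt''))) (B 2 5 (C
    ''jjiijkkm'' (B 1 4 (B 0 1 (C ''cdghef'' (W ''kkkkmmnprttttttt'')) (B 9 12 (C ''eg'' (W ''jmmmmmmqsssttttt''))
    (W ''illllrrrrrrrtttt''))) (W ''jjjjoootttttttt''))) (W ''kkkkknnssttttttt'')))) (W ''llllrrrrrrrrrrrr''))) (W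
    ''jjlllttttttttttt'')))) (B 0 3 (C ''ge'' (B 3 5 (C ''hf'' (B 5 7 (C ''kn'' (B 0 2 (C ''edgfjmko'' (B 6 8 (C
    ''fejokp'' (B 2 4 (C ''aajp'' (W ''illrrrrrrrrrrrrr'')) (B 0 1 (C ''in'' (W ''kkkkppqqqqqqqqtt'')) (W
    ''illlrrrrrrrrrrtt'')))) (B 2 4 (C ''fejo'' (B 8 16 (C ''eeff'' (B 8 15 (C ''aa'' (B 3 4 (C ''gi'' (W
    ''ikknnoooostttttt'')) (W ''illlrrrrrrrrrrtt''))) (W ''kkknpppqqqqqqqqt''))) (W ''kkknpppqqqqqqqqt''))) (W
    ''kkkkooooqqqrrttt'')))) (B 9 14 (C ''dd'' (W ''iillrrrrrrrrtttt'')) (W ''iinnqqqqqqqqrrtt'')))) (B 0 2 (C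
    ''ed'' (B 8 16 (C ''km'' (B 8 15 (B 2 4 (C ''jmkn'' (B 4 6 (C ''aajohi'' (W ''ilmnnnnqqqqqrttt'')) (B 6 9 (C
    ''jn'' (B 0 1 (C ''jpdd'' (W ''llllrrrrrrrrrrrr'')) (W ''immmmmqqqqqqrrtt''))) (W ''kkkmmmoooqrssttt'')))) (B 9
    14 (C ''efhh'' (W ''kkkkmmnprttttttt'')) (W ''kkkknnnqqqrrrrtt''))) (W ''kkknpppqqqqqqqqt''))) (W
    ''kkknpppqqqqqqqqt''))) (W ''iiknnnpqqqqttttt'')))) (B 0 1 (C ''hf'' (B 9 16 (C ''gfhg'' (B 8 15 (C ''km'' (B 5
    7 (C ''cd'' (B 6 9 (B 8 14 (C ''cehh'' (W ''kkkkkopptttttttt'')) (W ''kkkkppqqqqqqqqtt'')) (W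
    ''kkkkloooostttttt''))) (B 7 8 (C ''jn'' (W ''kkkllnoqqqqqrrtt'')) (W ''lllllnnpqqqqtttt'')))) (W
    ''kkknpppqqqqqqqqt''))) (W ''llllrrrrrrrrrrrr''))) (W ''illllrrrrrrrtttt'')))) (W ''iiirrrrrrrrrtttt''))"]) simp_all

lemma large_6: "solved large_cfg [0, 0, 3, 3, 3, 3, 4, 10, 10, 10, 10, 15] [4, 5, 5, 5, 7, 7, 14, 15, 16, 16, 16, 16]"
  by (rule check_solved[where t = "B 11 16 (B 0 4 (C ''gefdjkjl'' (B 7 15 (C ''gf'' (B 3 5 (C ''ggikjmil'' (B 0 2 (C ''ffed'' (B 6 14 (C
    ''gjhleejn'' (B 7 13 (C ''cdio'' (W ''kkkkoqqqqqqqqqq'')) (W ''kkkmmooooopppst''))) (W ''kkkmnoooooopppt''))) (B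
    6 11 (B 4 7 (C ''edfejn'' (B 0 3 (C ''cdjo'' (W ''iillrrrrrrrrrrr'')) (W ''iiimqqqqqqqqrrt''))) (W
    ''iilmmmmpqqqqrtt'')) (W ''jjoooooooootttt'')))) (B 0 3 (B 7 14 (B 7 13 (C ''ggikkm'' (B 0 2 (C ''ffghiljmkn''
    (B 2 5 (C ''gjjo'' (B 0 1 (C ''eghk'' (W ''kkkllmmoppptttt'')) (W ''illllrrrrrrrrrr''))) (B 7 11 (C ''eg'' (W
    ''kkkkkmmoptttttt'')) (W ''kkkkkoooppptttt'')))) (B 9 13 (C ''gl'' (W ''jjoooooooootttt'')) (W
    ''iilllrrrrrrrrtt'')))) (W ''lllllpppppppptt'')) (W ''lllllpppppppptt'')) (W ''iiillrrrrrrtttt'')))) (W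
    ''lllpppppppppppp''))) (W ''jjjjppppttttttt'')) (B 0 2 (B 7 13 (B 2 5 (C ''ge'' (B 4 7 (C ''kk'' (B 6 12 (C
    ''fdkl'' (B 8 16 (B 8 15 (B 4 5 (C ''gfjkjlkm'' (B 2 4 (C ''ggikjmkn'' (B 3 4 (C ''feghiljnko'' (B 0 1 (C
    ''gkff'' (W ''kkknnnooootttttt'')) (B 6 9 (C ''fg'' (W ''ilmnnnnqqqqqrttt'')) (W ''ikknnoooostttttt'')))) (B 7
    12 (C ''gh'' (B 9 16 (C ''fegi'' (B 0 1 (C ''gkff'' (W ''kkknnnooootttttt'')) (W ''ikknnoooostttttt''))) (W
    ''llllrrrrrrrrrrrr''))) (W ''kklmoppppppptttt'')))) (B 6 11 (B 7 12 (C ''ggkn'' (W ''kkkkpppppptttttt'')) (W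
    ''kklmoppppppptttt'')) (W ''kkkkpppppptttttt'')))) (B 2 4 (C ''gfjk'' (B 6 11 (B 7 12 (C ''km'' (B 9 14 (C
    ''ggff'' (B 6 10 (C ''ddikjl'' (B 0 1 (C ''gief'' (W ''kkkmmmoooqrssttt'')) (W ''illlmnpqqqqrtttt''))) (W
    ''kkknnnooootttttt''))) (B 3 5 (B 0 1 (C ''ggff'' (B 6 10 (C ''il'' (B 6 9 (C ''jpdd'' (W ''llllrrrrrrrrrrrr''))
    (W ''kkkmmoooopqrrrtt''))) (W ''kkknnnooootttttt''))) (B 3 4 (B 6 10 (B 6 9 (C ''il'' (B 4 6 (C ''jp'' (W
    ''illrrrrrrrrrrrrr'')) (W ''immmmmqqqqqqrrtt''))) (W ''ikknnoooostttttt'')) (W ''joooooooootttttt'')) (W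
    ''illlrrrrrrrrrrtt''))) (W ''kkkllopppprttttt'')))) (W ''kklmoppppppptttt'')) (W ''kkkmmoooooottttt''))) (W
    ''kkkkpppppptttttt''))) (W ''kkknpppqqqqqqqqt'')) (W ''kkknpppqqqqqqqqt''))) (W ''ooooooooooootttt''))) (W
    ''kkkmmmmpsstttttt''))) (W ''kkkkpppppptttttt'')) (W ''lllppppppppppttt'')) (W ''jjpppppppptttttt''))"]) simp_all

lemma large_7: "solved large_cfg [0, 0, 0, 0, Suc 0, 2, 3, 4, 5, 6, 7, 15] [4, 5, 5, 5, 7, 7, 14, 15, 16, 16, 16, 16]"
  by (rule check_solved[where t = "B 2 3 (B 7 10 (C ''lpedjkfedaifiggfdbihjliikm'' (B 0 1 (C ''imjoggdceeffkp'' (B 2 2 (C ''ghddjp'' (W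
    ''llllrrrrrrrrrrrr'')) (B 4 7 (C ''ddjp'' (W ''llllrrrrrrrrrrrr'')) (W ''kllmmmmqqqssssss'')))) (B 3 5 (B 4 7 (C
    ''jn'' (B 3 4 (C ''cbggjoijikil'' (B 0 2 (B 4 6 (C ''iphh'' (W ''innnnpppqqqqqqqr'')) (W ''immmmmqqqqqqrrtt''))
    (W ''iinnqqqqqqqqrrtt''))) (W ''illlrrrrrrrrrrtt''))) (W ''jmmmmmmqsssttttt'')) (W ''illllrrrrrrrtttt'')))) (B
    11 16 (C ''edimcagedbgfggfehkjnghhl'' (B 0 2 (C ''dceegiff'' (B 7 15 (C ''gldd'' (B 6 13 (C ''egaaiode'' (W
    ''illllrrrrrrrrrr'')) (W ''llllooooooooott''))) (W ''lllpppppppppppp''))) (B 6 11 (C ''efdc'' (W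
    ''iimmmmpppqqqqrt'')) (W ''jjoooooooootttt'')))) (B 0 2 (C ''gdgejkfc'' (B 6 14 (C ''ebkl'' (B 6 13 (B 6 12 (C
    ''da'' H) (W ''ooooooooooootttt'')) (W ''ooooooooooootttt''))) (W ''ooooooooooootttt''))) (W
    ''jjpppppppptttttt'')))) (B 7 10 (B 11 16 (C ''eejkabhg'' (B 0 4 (C ''cdikjmde'' (W ''iilllrrrrrrrrtt'')) (W
    ''iiiirrrrrrrtttt''))) (C ''fd'' (B 0 4 (C ''jgkhifhekijhigkj'' H) (W ''jjjjtttttttttttt'')))) (C ''gd'' H))"]) (simp_all add: large_4 large_5 large_6)

lemma large_8: "solved large_cfg [0, 0, 0, Suc 0, 3, 8, 11, 11, 11, 12, 13, 15] [Suc 0, 2, 2, 5, 10, 11, 14, 15, 15, 15, 15, 15]"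
  by (rule check_solved[where t = "B 4 7 (C ''imdbjn'' (B 3 4 (C ''cahmjoin'' (B 4 5 (C ''aafj'' (W ''ilnnnnnnnnpqqtt'')) (B 1 2 (B 0 1 (C ''fjgm''
    (B 2 2 (C ''hodc'' (W ''lllpppppppppppp'')) (W ''kknnnnnnnnooott''))) (B 5 10 (C ''gm'' (W ''joooooooooooott''))
    (W ''ilnnnnnnnnpqqtt''))) (W ''jjoooooooootttt'')))) (B 6 13 (C ''ca'' (B 7 15 (C ''eeko'' (B 5 11 (C ''hlinjo''
    (B 1 2 (B 0 1 (C ''fjio'' (W ''klllnnnnnnoqqqq'')) (B 3 5 (C ''fj'' (W ''ilnnnnnnnnpqqtt'')) (W
    ''illllrrrrrrrrrr''))) (W ''jjoooooooootttt''))) (W ''klllnnnnnnnqqrs''))) (W ''lllpppppppppppp''))) (W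
    ''llllooooooooott'')))) (B 6 13 (B 0 1 (C ''il'' (B 4 10 (C ''dbjmkn'' (B 3 4 (C ''infijohl'' (B 4 9 (C
    ''cahnio'' (B 1 2 (B 2 2 (C ''fkeh'' (W ''mmmmmmmmnnoqqrs'')) (B 4 8 (C ''dcho'' (W ''lllpppppppppppp'')) (W
    ''kkmmmmmmnoptttt''))) (W ''jjoooooooootttt''))) (W ''mmmmmmmmmppprrr''))) (B 7 15 (B 2 2 (C ''fihlimjnko'' (B 4
    9 (C ''fj'' (B 4 8 (C ''hnde'' (W ''lllllpppppppptt'')) (W ''mmmmmmmmnnoqqrs''))) (B 5 10 (C ''ca'' (W
    ''kmmmmmmmmqqqsss'')) (W ''mmmmmmmmnnoqqrs'')))) (B 4 9 (C ''imjnko'' (B 5 11 (C ''hlinjo'' (B 1 2 (B 5 10 (C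
    ''hm'' (B 3 5 (C ''ehfi'' (W ''kkmmmmmmnoptttt'')) (W ''lllllpppppppptt''))) (B 4 8 (C ''dehm'' (W
    ''lllllpppppppptt'')) (W ''kkmmmmmmnoptttt''))) (W ''jjoooooooootttt''))) (W ''klllnnnnnnnqqrs''))) (W
    ''kkmmmmmmnoptttt''))) (W ''lllpppppppppppp'')))) (W ''mmmmmmmmmmqqttt''))) (B 3 3 (C ''im'' (B 4 9 (C ''johm''
    (B 5 11 (C ''db'' (B 5 10 (C ''hocb'' (W ''immmmmmoopppqqq'')) (W ''ilnnnnnnnnpqqtt''))) (W
    ''jmmmnnnnnnnprst''))) (W ''immmmmmmmpqqqtt''))) (B 4 9 (B 7 15 (C ''il'' (B 3 5 (C ''jnim'' (B 5 10 (C
    ''johlin'' (B 2 2 (C ''ddeh'' (W ''illlmmmmopppqtt'')) (W ''iklmmmnnoopqqqr''))) (W ''ilnnnnnnnnpqqtt''))) (W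
    ''illllmmnoppqttt''))) (W ''lllpppppppppppp'')) (W ''jlmmmmmmmsssttt'')))) (W ''mmmmmmmoooooott''))"]) simp_all

lemma large_9: "solved large_cfg [0, 0, 0, 3, 3, 8, 8, 8, 9, 10, 11, 16] [Suc 0, 2, 2, 5, 9, 9, 11, 11, 16, 16, 16, 16]"
  by (rule check_solved[where t = "B 8 13 (C ''ed'' (B 4 7 (C ''jkkl'' (B 0 1 (C ''hiknijjl'' (B 2 2 (C ''ddeegi'' (B 9 16 (C ''hkde'' (W
    ''lllllppppppttttt'')) (W ''llllrrrrrrrrrrrr''))) (B 6 11 (C ''eeko'' (B 3 5 (C ''jngihj'' (B 4 6 (C ''ddjp'' (W
    ''llllrrrrrrrrrrrr'')) (W ''kklmmmoppprsssst''))) (B 7 11 (C ''gi'' (B 9 16 (B 8 12 (C ''gjef'' (W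
    ''kklmmmoppprsssst'')) (W ''lllllnnpqqqqtttt'')) (W ''llllrrrrrrrrrrrr''))) (W ''lllllppppppttttt'')))) (W
    ''kknnnnnnooottttt'')))) (B 6 10 (C ''kn'' (B 9 16 (C ''eehi'' (B 8 12 (C ''ddij'' (W ''illlnnnnqqtttttt'')) (W
    ''ilnnnnnnpqqqtttt''))) (W ''illrrrrrrrrrrrrr''))) (W ''joooooooootttttt'')))) (B 0 1 (B 6 10 (C ''kljk'' (B 2 2
    (C ''hiknjl'' (B 3 5 (C ''giijjmko'' (B 4 8 (C ''hkca'' (W ''kmmmmmmoppsssttt'')) (W ''lmmmmmmmqqssssst''))) (B
    7 11 (B 9 16 (C ''ehgi'' (B 8 12 (C ''ca'' (B 7 10 (C ''eijn'' (W ''lllllnnnnrrrrrtt'')) (W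
    ''kmmmmmmoppsssttt''))) (W ''lllllnnpqqqqtttt''))) (W ''llllrrrrrrrrrrrr'')) (W ''lllllppppppttttt'')))) (B 6 9
    (B 4 8 (C ''jn'' (B 7 10 (C ''dejp'' (W ''llllrrrrrrrrrrrr'')) (W ''kmmmmmmoppsssttt''))) (W
    ''kkmmmmmmtttttttt'')) (W ''kkmmmmmnorrstttt'')))) (B 9 13 (B 2 2 (C ''ikkl'' (B 4 8 (C ''gk'' (W
    ''mmmmmmmoooostttt'')) (W ''mmmmmmmmoosstttt''))) (B 4 8 (B 10 14 (C ''gk'' (W ''kknnnnnnooottttt'')) (W
    ''kmmmmmmoppsssttt'')) (W ''kkmmmmmmtttttttt''))) (B 2 1 (B 4 8 (C ''ddkp'' (B 6 11 (C ''jp'' (W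
    ''llllrrrrrrrrrrrr'')) (W ''mmmmmmmoooostttt''))) (W ''mmmmmmmmoosstttt'')) (W ''kmmmmmmoppsssttt'')))) (W
    ''jmmmmmmqsssttttt'')))) (B 4 9 (B 3 5 (B 4 6 (C ''kn'' (B 0 1 (C ''hijnko'' (B 2 2 (C ''edgi'' (B 9 16 (C
    ''gkca'' (W ''kllmnnnoooqqrsst'')) (W ''lllmnnnnoqqqrrrs''))) (B 6 11 (B 3 4 (C ''gijo'' (B 5 9 (C ''iohj'' (W
    ''kklnnnnnopqqqqqt'')) (W ''kkmnnnnnnqqqrrrt''))) (B 9 16 (B 6 10 (C ''fiio'' (W ''kkmnnnnnnqqqrrrt'')) (W
    ''kllmnnnoooqqrsst'')) (W ''llllrrrrrrrrrrrr''))) (W ''kknnnnnnooottttt'')))) (B 7 9 (C ''ip'' (W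
    ''illrrrrrrrrrrrrr'')) (W ''ilnnnnnnpqqqtttt'')))) (B 0 1 (B 6 10 (C ''kn'' (B 2 2 (C ''jnko'' (B 4 8 (C ''hi''
    (B 8 15 (C ''gi'' (B 2 1 (C ''hj'' (W ''lmmmmmnoopqqrrst'')) (W ''kmmmmmnooqqqrrst''))) (B 2 1 (C ''jp'' (B 6 9
    (C ''dd'' (W ''llllrrrrrrrrrrrr'')) (W ''lllmnnnnoqqqrrrs''))) (B 6 9 (B 7 11 (C ''ipdd'' (W
    ''llllrrrrrrrrrrrr'')) (W ''kmmmmmnnppqqqrrt'')) (W ''kmmmmmnooqqqrrst''))))) (W ''lmmmmmmmqqssssst''))) (B 7 10
    (B 4 8 (C ''jnko'' (B 6 9 (C ''jp'' (B 3 4 (C ''eg'' (W ''kllmmmmqqqssssss'')) (W ''llllrrrrrrrrrrrr''))) (W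
    ''kmmmmmnooqqqrrst''))) (W ''kkmmmmmmtttttttt'')) (W ''kklmmmooppqqrttt'')))) (B 9 15 (B 2 2 (B 4 8 (B 3 4 (C
    ''cagk'' (W ''kmmmmmooooorsttt'')) (W ''llllmnnnopqqsttt'')) (W ''mmmmmmmmoqqqtttt'')) (W ''kklmmmooppqqrttt''))
    (W ''lmmmmmnoopqqrrst''))) (W ''illmmmnpqqqqrttt''))) (W ''lllllnnpqqqqtttt'')) (W ''mmmmmmmmoqqqtttt''))"]) simp_all

lemma large_10: "solved large_cfg [0, 0, 0, 0, 2, 8, 8, 12, 12, 12, 12, 16] [Suc 0, 2, 2, 3, 7, 9, 11, 15, 16, 16, 16, 16]"
  by (rule check_solved[where t = "C ''km'' (B 2 1 (C ''jnecimko'' (B 3 2 (C ''eegi'' (B 4 7 (C ''io'' (B 3 1 (C ''hoef'' (W ''mmmmmmpppppppptt''))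
    (W ''lmmmmpppppppqqqt''))) (W ''mmmmmmmoopppqttt''))) (B 7 14 (C ''ed'' (B 4 6 (C ''iogj'' (B 4 5 (C ''fi'' (W
    ''llmnnnnnnppqqqrt'')) (W ''lmmmmpppppppqqqt''))) (B 6 9 (C ''ip'' (W ''lmmmmpppppppqqqt'')) (W
    ''lmmmmmnoopqqrrst'')))) (W ''llpppppppppppptt'')))) (B 4 7 (B 7 15 (B 8 14 (C ''ec'' (B 2 2 (C ''jmkn'' (B 4 5
    (C ''aadb'' (W ''ilnnnnnnpqqqtttt'')) (B 6 11 (C ''ko'' (B 3 3 (C ''aa'' (B 3 2 (C ''gj'' (W
    ''joooooooootttttt'')) (W ''ilnnnnnnpqqqtttt''))) (B 0 1 (C ''fijp'' (W ''kmmmnnnnnppqrrtt'')) (W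
    ''ilnnnnnnpqqqtttt'')))) (W ''kmmmmoooooopsttt'')))) (B 0 1 (C ''ed'' (B 3 3 (C ''jn'' (B 5 9 (C ''efgj'' (W
    ''kkmmmooooopqrstt'')) (W ''kmmmnnnnnppqrrtt''))) (W ''kklmoppppppptttt''))) (W ''ilnnnnnnpqqqtttt'')))) (B 4 4
    (B 2 2 (C ''ko'' (B 0 1 (C ''jpdb'' (B 5 9 (C ''gk'' (W ''klnnnnnoooopqrst'')) (W ''knnnnnnnnpqqqrrt''))) (W
    ''imnnnnnppppqqqst''))) (B 0 1 (B 6 11 (C ''jo'' (B 5 9 (C ''ec'' (B 7 14 (C ''ipgjdc'' (W
    ''kklnnnnnopqqqqqt'')) (W ''llpppppppppppptt''))) (W ''knnnnnnnnpqqqrrt''))) (W ''kknnnnnnooottttt'')) (W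
    ''ilnnnnnnpqqqtttt''))) (B 0 1 (B 5 9 (B 2 2 (C ''ko'' (B 3 3 (C ''jokp'' (B 4 6 (C ''gjio'' (B 4 5 (C ''hn'' (W
    ''lmmoooooppppppqt'')) (W ''lmmmmpppppppqqqt''))) (B 6 9 (W ''kmmmmmnnppqqqrrt'') (W ''lmmmmmnoopqqrrst'')))) (B
    9 15 (C ''gj'' (W ''kllmnnnoooqqrsst'')) (W ''kllmnnnopppqqqrt'')))) (B 4 6 (B 3 3 (B 6 11 (C ''jp'' (B 8 15 (C
    ''hn'' (W ''llpppppppppppptt'')) (W ''kkmmnnnppppqqqqr''))) (W ''kknnnnnnooottttt'')) (W ''kklmoppppppptttt''))
    (W ''kkmmmmooppppqttt''))) (W ''kmmmnnnnnppqrrtt'')) (W ''immmnnnnpppqqrtt'')))) (W ''kmoppppppppppppt'')) (W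
    ''kmmmmmmoppsssttt'')))"]) simp_all

lemma large_11: "solved large_cfg [0, 0, 0, 0, 0, 8, 8, 8, 8, 9, 10, 15] [2, 2, 2, 5, 12, 13, 14, 15, 16, 16, 16, 16]"
  by (rule check_solved[where t = "B 11 16 (C ''eaebiiij'' (B 4 12 (C ''jkhi'' (B 4 11 (B 5 13 (C ''dakl'' (B 5 12 (C ''ec'' (B 6 11 (C
    ''eddbjlkm'' (B 4 7 (C ''aaimjo'' (B 3 5 (C ''hl'' (B 0 2 (C ''fjin'' (W ''ilnnnnnnnnpqqtt'')) (W
    ''iinnnnnnppqqqrt''))) (W ''illllrrrrrrrrrr''))) (B 0 1 (C ''im'' (B 4 10 (C ''hljo'' (B 4 9 (C ''ddca'' (B 7 15
    (C ''fjcbeh'' (W ''kkmmmmmmnoptttt'')) (W ''lllpppppppppppp''))) (W ''mmmmmmmmmppprrr''))) (W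
    ''mmmmmmmmmmqqttt''))) (B 4 9 (C ''ikhjiljmkn'' (B 0 2 (C ''hkim'' (B 5 10 (C ''dcjo'' (B 3 5 (C ''hmhn'' (B 7
    15 (C ''fieh'' (W ''jmmmmmmmopppppt'')) (W ''lllpppppppppppp''))) (W ''illllrrrrrrrrrr''))) (W
    ''ilnnnnnnnnpqqtt''))) (B 3 3 (C ''hm'' (W ''iimmmmmnppqqqtt'')) (W ''iilmmmmpqqqqrtt'')))) (W
    ''jlmmmmmmmsssttt''))))) (B 0 2 (C ''jlkm'' H) (W ''jjoooooooootttt'')))) (W ''nnnnnnnnnnnnttt''))) (W
    ''nnnnnnnnnnnnttt'')) (W ''mmmmmmmmmmmtttt''))) (W ''mmmmmmmmmmmmtt''))) (B 5 11 (C ''ea'' (B 0 2 (B 5 10 (C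
    ''iijjkk'' (B 6 14 (B 6 13 (B 7 12 (C ''eb'' (B 3 3 (C ''jkklkm'' (B 4 6 (C ''cajnijhiikko'' (B 2 2 (C
    ''injpecgihj'' (B 5 9 (C ''aagj'' (W ''joooooooootttttt'')) (W ''knnnnnnnnpqqqrrt''))) (B 6 11 (C ''ecil'' (B 0
    1 (C ''ip'' (B 5 9 (C ''eehk'' (W ''kkmmnnnppppqqqqr'')) (W ''kkmnnnnnnqqqrrrt''))) (W ''ilnnnnnnpqqqtttt'')))
    (W ''kknnnnnnooottttt'')))) (B 2 1 (C ''jngiijeg'' (B 6 11 (C ''im'' (B 4 8 (C ''iphj'' (W
    ''mmmmmmmoopqqqqtt'')) (W ''mmmmmmmmoqqqtttt''))) (W ''mmmmmmmoooostttt''))) (B 8 13 (C ''hi'' (B 6 10 (C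
    ''jlkn'' (B 2 2 (C ''eh'' (B 0 1 (C ''hk'' (W ''kmmmmmmoppsssttt'')) (W ''jmmmmmmqsssttttt''))) (B 4 8 (C ''aa''
    (B 4 7 (C ''jp'' (W ''ikmmmmooqrrrrrrr'')) (W ''jmmmmmmqsssttttt''))) (W ''kkmmmmmmtttttttt'')))) (B 4 7 (C
    ''aa'' (W ''joooooooootttttt'')) (W ''kmmmmmmoppsssttt'')))) (B 4 9 (B 6 11 (C ''kn'' (B 2 2 (C ''ko'' (B 4 8 (C
    ''hijn'' (B 6 9 (C ''aa'' (W ''immmmmqqqqqqrrtt'')) (W ''kmmmmmnooqqqrrst''))) (W ''lmmmmmmmqqssssst''))) (B 4 8
    (B 6 10 (C ''jn'' (B 0 1 (C ''jo'' (B 6 9 (C ''eg'' (W ''kkmmmmmoqqqqrsst'')) (W ''kmmmmmnooqqqrrst''))) (W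
    ''immmmmqqqqqqrrtt''))) (W ''kkmmmmnooorrsstt'')) (W ''kkmmmmmmtttttttt'')))) (W ''kmmmmmooooorsttt'')) (W
    ''mmmmmmmmoqqqtttt'')))))) H)) (B 3 5 (B 3 4 (B 4 9 (B 4 8 (B 6 12 (C ''eb'' H) (W ''ooooooooooootttt'')) (W
    ''mmmmmmmmpttttttt'')) (W ''mmmmmmmmoqqqtttt'')) (W ''llllpppppppptttt'')) (W ''lllllnnpqqqqtttt''))) (W
    ''ooooooooooootttt'')) (W ''ooooooooooootttt''))) (W ''nnnnnnnnnntttttt'')) (W ''jjooooootttttttt''))) (W
    ''nnnnnnnnnntttttt''))"]) (simp_all add: large_8 large_9 large_10)

lemma large_12: "solved large_cfg [0, 0, 3, 3, 3, 8, 8, 8, 9, 10, 11, 15] [3, 5, 5, 5, 8, 10, 14, 15, 15, 15, 15, 15]"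
  by (rule check_solved[where t = "B 7 12 (C ''ed'' (B 0 2 (C ''eeijkmjkhi'' (B 2 4 (C ''jmefgijnikhjilko'' (B 3 5 (C ''aa'' (B 6 11 (C ''fjehio''
    (W ''ikkmmmmmnoqrrst'')) (W ''ikkmnnooooorttt''))) (B 0 1 (C ''ehfi'' (W ''kkkllmmmnprsttt'')) (B 5 9 (C ''eh''
    (W ''ikklmmmmopssttt'')) (W ''illllnnnnrrrrtt''))))) (B 4 8 (B 5 10 (B 6 11 (C ''jm'' (B 8 15 (C ''aade'' (B 5 9
    (C ''jo'' (W ''illllrrrrrrrrrr'')) (W ''illllnnnnrrrrtt''))) (W ''kkkkoqqqqqqqqqq''))) (W ''kkkkmnnnoootttt''))
    (W ''kkkknnnnnnttttt'')) (W ''kkkkmmmmptttttt'')))) (B 6 11 (B 8 15 (B 3 5 (C ''km'' (B 4 8 (B 5 10 (C ''jmdd''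
    (B 0 3 (C ''jo'' (W ''iillrrrrrrrrrrr'')) (W ''iiilrrrrrrrrrtt''))) (W ''iikmnnnnnnssttt'')) (W
    ''jjmmmmmmrrssttt''))) (B 9 13 (C ''hiij'' (B 2 5 (C ''ef'' (B 0 3 (C ''fjkl'' (W ''iikmnnnnnnssttt'')) (W
    ''iiillmpqqrttttt''))) (B 4 6 (C ''fj'' (W ''kkkknnnnnnttttt'')) (W ''iikkkmnnttttttt'')))) (W
    ''iilllrrrrrrrrtt''))) (W ''iilmnqqqqqqqqrr'')) (W ''jjoooooooootttt'')))) (B 0 3 (B 2 5 (B 7 15 (B 4 4 (C
    ''hnab'' (W ''iinnnnnnppqqqrt'')) (B 6 14 (B 0 2 (C ''km'' (B 8 14 (C ''eegi'' (B 2 4 (C ''gjjm'' (B 4 7 (C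
    ''aagk'' (W ''ikkmnnooooorttt'')) (B 3 5 (B 6 13 (C ''ko'' (B 7 13 (C ''aagk'' (W ''ikkmnnooooorttt'')) (W
    ''kkkmmooooopppst''))) (W ''kkkmmmmnoootttt'')) (W ''kkkllmmoppptttt'')))) (B 6 11 (B 4 8 (B 5 10 (C ''aajode''
    (W ''illllrrrrrrrrrr'')) (W ''kkkknnnnnnttttt'')) (W ''kkkkmmmmptttttt'')) (W ''kkkkmnnnoootttt'')))) (B 4 8 (B
    2 4 (C ''gi'' (B 3 5 (B 4 6 (C ''gk'' (B 0 1 (C ''hn'' (W ''kkkmnoooooopppt'')) (W ''ikkmnnooooorttt''))) (B 6
    13 (B 0 1 (C ''gk'' (B 3 4 (C ''eg'' (W ''kkkmmmmnoootttt'')) (W ''kkklmmnoooopstt''))) (B 6 11 (B 7 13 (C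
    ''fj'' (W ''ilnnnnnnnnpqqtt'')) (W ''ikkmmooppppppst'')) (W ''ikkmnnooooorttt''))) (W ''kkkmmooooopppst''))) (B
    7 13 (B 4 7 (C ''gjjo'' (B 0 1 (C ''fjgl'' (W ''kkknnnnnnnoottt'')) (W ''illllrrrrrrrrrr''))) (W
    ''kkkllmmoppptttt'')) (W ''lllllpppppppptt'')))) (B 5 10 (B 6 13 (B 7 14 (B 8 15 (C ''ee'' (B 6 12 (B 6 11 (C
    ''aa'' (B 4 7 (C ''hm'' (W ''ikkmmooppppppst'')) (W ''ikkkmmmnppqqrtt''))) (W ''kkkkmnnnoootttt'')) (W
    ''kkkkmnnnoootttt''))) (W ''kkkkoqqqqqqqqqq'')) (W ''kkkknoooppppppt'')) (W ''llllooooooooott'')) (W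
    ''kkkknnnnnnttttt''))) (W ''kkkmmmmmpppqqqt'')))) (B 6 11 (B 8 14 (B 3 5 (B 4 8 (B 5 10 (C ''efdd'' (W
    ''iillmnnpppqqttt'')) (W ''iikmnnnnnnssttt'')) (W ''jjmmmmmmrrssttt'')) (W ''iillmnnpppqqttt'')) (W
    ''iinnnnnnppqqqrt'')) (W ''jjoooooooootttt''))) (W ''kkkmnoooooopppt''))) (W ''lllpppppppppppp'')) (W
    ''kkkkkoooppptttt'')) (W ''jjjpppppppptttt''))"]) simp_all

text \<open>Fifteen or sixteen periods, at most five of them up to 12.\<close>

lemma large_13: "solved large_cfg [0, 0, 0, 0, 0, Suc 0, 3, 4, 5, 5, 6, 15] [5, 5, 5, 5, 12, 13, 14, 15, 16, 16, 16, 16]"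
  by (rule check_solved[where t = "C ''fb'' (B 5 8 (C ''ea'' (B 0 5 (C ''jfkg'' H) (W ''jjjjjtttttttttt''))) (B 0 5 (B 2 3 (C ''kijikj'' H) (B 5 11
    (B 11 16 (C ''kiji'' (B 0 4 (C ''jjii'' (B 4 10 (C ''kk'' (B 4 9 H (W ''kkkmmmmmmrttttt''))) (W
    ''kkkmmmmmmrttttt''))) (W ''jjjjoootttttttt''))) (B 0 2 (B 6 11 (B 5 9 (B 2 4 (C ''kikjjijjkk'' (B 7 15 (B 4 8
    (B 7 14 (B 4 7 (C ''iikljk'' (B 8 16 (B 7 13 (B 8 15 (B 6 10 (B 9 14 (C ''ed'' (B 7 12 (C ''eeijkm'' (B 3 5 (C
    ''aa'' (B 3 4 (C ''gi'' (W ''ikknnoooostttttt'')) (W ''illlnnnnqqtttttt''))) (B 0 1 (C ''il'' (W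
    ''lllllnnpqqqqtttt'')) (W ''illlnnnnqqtttttt'')))) (W ''kklmoppppppptttt''))) (B 4 5 (C ''ijhiik'' (B 3 4 (C
    ''aail'' (W ''ilnnnnnnpqqqtttt'')) (B 8 12 (C ''aa'' (W ''illlrrrrrrrrrrtt'')) (W ''kkklnnnnqqqqrrtt'')))) (B 7
    12 (B 3 5 (B 0 1 (C ''ijhiikko'' (B 7 11 (C ''kp'' (B 1 2 (B 3 4 (C ''imjo'' (W ''kkknnnnnqqqqrrrt'')) (B 8 12
    (C ''jp'' (W ''llllrrrrrrrrrrrr'')) (W ''kkklnnnnqqqqrrtt''))) (W ''jjooooootttttttt''))) (W
    ''kkkmmoppppprssst''))) (B 3 4 (B 7 11 (B 6 9 (C ''il'' (B 7 9 (C ''jp'' (W ''illrrrrrrrrrrrrr'')) (W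
    ''ilnnnnnnpqqqtttt''))) (W ''ikknnoooostttttt'')) (W ''iklmmoooppprrstt'')) (W ''illlrrrrrrrrrrtt''))) (B 0 1 (B
    8 12 (B 7 10 (C ''jp'' (W ''llllrrrrrrrrrrrr'')) (W ''kkkllopppprttttt'')) (W ''lllllnnpqqqqtttt'')) (W
    ''illlrrrrrrrrrrtt''))) (W ''kklmoppppppptttt'')))) (W ''kkknnnooootttttt'')) (W ''kkknpppqqqqqqqqt'')) (W
    ''lllppppppppppttt'')) (W ''kkknpppqqqqqqqqt''))) (W ''kkkmmmmpsstttttt'')) (W ''llpppppppppppptt'')) (W
    ''kkmmmmmmtttttttt'')) (W ''lllpppppppppppp''))) (W ''kkkknnnntttttttt'')) (W ''kkknnnnnnttttttt'')) (W
    ''kknnnnnnooottttt'')) (W ''jjooooootttttttt''))) (W ''kkknnnnnnnntttt''))) (W ''jjjjoootttttttt'')))"]) (simp_all add: large_7 large_11 large_12)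

lemma large_14: "solved large_cfg [0, 0, 0, 0, 0, Suc 0, 2, 2, 4, 5, 6, 17] [2, 2, 2, 2, 6, 6, 8, 8, 16, 17, 18, 18]"
  by (rule check_solved[where t = "B 11 18 (C ''klhedajfebjggcifjhgdjiigjj'' (B 2 2 (C ''fdkogejkihhfjljm'' (B 0 1 (C ''ecfegfiiijikjn'' (B 4 6 (C
    ''hg'' (B 8 16 (C ''imed'' (B 8 15 (C ''cajp'' (W ''kmmnnpqqqqqrrrrrt'')) (W ''lmmmpppqqqqqqqqtt''))) (W
    ''lmnnpppqqqqqqqqqt''))) (W ''mmmmmmqqqrrrrrstt''))) (B 6 7 (B 4 6 (C ''il'' (B 4 5 (C ''injp'' (W
    ''innqqqqqqqrrrrrrt'')) (W ''jmmmmqqrssssssttt''))) (W ''jmmmmqqrssssssttt'')) (W ''jooooootttttttttt'')))) (B 8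
    16 (B 9 17 (C ''fcge'' (B 0 2 (C ''fd'' (B 8 15 (C ''hfihjkkmjlkn'' (B 4 6 (C ''ii'' (B 4 4 (C ''ggaa'' (W
    ''jooooootttttttttt'')) (B 6 7 (C ''jnfekpij'' (B 0 1 (C ''injo'' (W ''llmnpqqqqqqqrrrtt'')) (W
    ''ilmnqqqqqqrrrrttt''))) (B 0 1 (C ''il'' (B 4 5 (C ''jp'' (W ''llmnpqqqqqqqrrrtt'')) (W
    ''kkmmmooqqqrrssttt''))) (W ''jooooootttttttttt''))))) (B 7 7 (C ''aa'' (W ''jmmmmqqrssssssttt'')) (W
    ''kkmmmmpsstttttttt'')))) (W ''klnnoqqqqqqqqqqtt''))) (W ''jjoootttttttttttt''))) (W ''llrrrrrrrrrrrrrrr'')) (W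
    ''knppqqqqqqqqqqqqt'')))) (B 5 6 (B 0 2 (C ''kgjfkhhciejg'' (B 7 8 (C ''eaki'' (B 4 5 (C ''kj'' (B 4 4 (C
    ''kkjh'' (B 8 16 (B 8 15 (B 6 7 (C ''fbji'' (B 8 14 (C ''da'' (B 6 6 (C ''kljjkm'' (B 9 17 (C ''gchdif'' (B 9 16
    (B 0 1 (C ''ebfcighejkihkn'' (B 2 2 (C ''jm'' (B 3 2 (C ''feikil'' (W ''nnnnnqqqqqqqrstttt'')) (W
    ''llnqqqqqrrrrrttttt''))) (B 9 13 (C ''fdijkpgehfkq'' (B 1 1 (B 4 3 (C ''ilfe'' (W ''kknnnpqqqqqqsstttt'')) (B 7
    7 (C ''kr'' (W ''kkmnqqqrrrrsssssss'')) (W ''kkmooppqrssstttttt''))) (W ''joootttttttttttttt''))) (W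
    ''llnqqqqqrrrrrttttt'')))) (B 7 5 (C ''gd'' (W ''joootttttttttttttt'')) (W ''jppppttttttttttttt''))) (W
    ''lrrrrrrrrrrrrrrrtt''))) (W ''lrrrrrrrrrrrrrrrtt''))) (W ''ooooootttttttttttt''))) (W ''qqqqqqqqqqqqqqtttt'')))
    (W ''ooooootttttttttttt'')) (W ''qqqqqqqqqqqqqqtttt'')) (W ''qqqqqqqqqqqqqqtttt''))) (W
    ''mmmmrssttttttttttt''))) (W ''mmmmrssttttttttttt''))) (W ''pppppppptttttttttt''))) (W ''jjtttttttttttttttt''))
    (W ''ooooootttttttttttt''))"]) simp_all

lemma large_15: "solved large_cfg [0, 0, 0, 3, 3, 3, 4, 4, 5, 7, 8, 17] [2, 4, 4, 5, 6, 6, 8, 8, 10, 17, 17, 17]"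
  by (rule check_solved[where t = "B 4 5 (C ''cakiifjhkj'' (B 9 17 (C ''he'' (B 0 2 (C ''fdkkjikl'' (B 2 4 (C ''gehfigjjkmkn'' (B 2 3 (C
    ''gfhgihjkjlko'' (B 3 4 (C ''aajm'' (W ''illrrrrrrrrrrtttt'')) (B 0 1 (C ''ghffij'' (W ''lllmnnpqqqrrttttt''))
    (W ''jlllttttttttttttt'')))) (B 6 8 (C ''jk'' (B 3 4 (C ''kpgfhgihjljm'' (B 0 1 (C ''ffjpii'' (W
    ''lllqqqqqqrrrrrrtt'')) (W ''illrrrrrrrrrrtttt''))) (B 0 1 (C ''jn'' (B 9 15 (C ''ij'' (W
    ''kkklopqqqqrrrsttt'')) (W ''llllrrrrrrrrrrrtt''))) (W ''jlllttttttttttttt'')))) (W ''kkkooooottttttttt'')))) (B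
    7 7 (B 0 1 (C ''ff'' (W ''kkkknnttttttttttt'')) (W ''jlllttttttttttttt'')) (W ''kkkkppptttttttttt'')))) (B 7 6
    (C ''dd'' (W ''jlllttttttttttttt'')) (W ''jjppppttttttttttt'')))) (W ''llrrrrrrrrrrrrrrr''))) (B 0 2 (C ''ki''
    (B 9 17 (C ''if'' (B 9 12 (C ''cahf'' (B 2 3 (C ''ihgfkjkkkl'' (B 3 5 (C ''ko'' (B 0 1 (C ''ghefcb'' (W
    ''kkmmmmpsstttttttt'')) (W ''jmmmmqqrssssssttt''))) (B 0 1 (C ''cbgg'' (B 4 6 (C ''kq'' (W
    ''kklllpqssssssssst'')) (W ''kkmmmmpsstttttttt''))) (W ''jlllttttttttttttt'')))) (B 4 6 (B 6 8 (C ''kjigjh'' (B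
    6 7 (C ''dd'' (B 0 1 (C ''kn'' (B 7 7 (C ''ijkq'' (W ''kmmmmrrrrssssssss'')) (W ''kkklmppsttttttttt''))) (W
    ''jlllttttttttttttt''))) (W ''kkkmmoprstttttttt''))) (W ''kkkooooottttttttt'')) (W ''kkkmmmstttttttttt'')))) (B
    3 5 (C ''ca'' (B 10 17 (B 2 3 (C ''gfigkm'' (B 1 2 (B 7 8 (C ''kn'' (B 0 1 (C ''jpef'' (W
    ''mmmmmmrrrrsssssst'')) (W ''jmmmmqqrssssssttt''))) (B 0 1 (C ''koff'' (B 8 10 (C ''cb'' (B 4 6 (C ''jpdd'' (W
    ''llllrrrrrrrrrrrr'')) (W ''kkmmmmpsstttttttt''))) (W ''lllmnnpqqqrrttttt''))) (B 10 14 (C ''ef'' (W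
    ''jmmmmmqqrsttttttt'')) (W ''jmmmmqqrssssssttt'')))) (W ''jjoootttttttttttt''))) (B 6 7 (B 4 6 (C ''km'' (B 2 4
    (C ''ihhfkn'' (B 0 1 (C ''hh'' (W ''kkkmoppprsttttttt'')) (W ''jmmmmqqrssssssttt''))) (B 10 14 (C ''aa'' (W
    ''jlllttttttttttttt'')) (W ''kkkkorrrrrrrssttt'')))) (W ''kkkmmmstttttttttt'')) (W ''kkkmmoprstttttttt''))) (W
    ''kmmmmrrrrssssssss''))) (W ''lllllqrrrrrtttttt'')))) (W ''llrrrrrrrrrrrrrrr''))) (W ''jjoootttttttttttt''))"]) simp_all

lemma large_16: "solved large_cfg [0, 0, 0, 3, 3, 3, 3, 3, 4, 5, 7, 17] [2, 4, 4, 5, 6, 6, 8, 8, 16, 17, 17, 17]"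
  by (rule check_solved[where t = "C ''jfiehdkhjg'' (B 8 11 (C ''gd'' H) (B 0 2 (C ''gd'' (B 3 5 (B 8 16 (B 8 15 (B 9 17 (B 9 16 (C ''he'' (B 9 15
    (B 4 5 (C ''cakl'' (B 2 4 (C ''hf'' (B 2 3 (C ''fdge'' (B 8 14 (C ''gfkm'' (B 3 4 (C ''kohgjl'' (B 1 2 (B 0 1 (C
    ''ghff'' (W ''lllnnnppqqqrssttt'')) (B 9 13 (C ''gh'' (W ''jooooootttttttttt'')) (W ''illrrrrrrrrrrtttt''))) (W
    ''jjoootttttttttttt''))) (B 0 1 (C ''jm'' (W ''llllqqqqqqqrrtttt'')) (W ''jlllttttttttttttt'')))) (W
    ''lllnpqqqqqqqqrttt''))) (B 6 8 (C ''fd'' (B 8 14 (C ''gekm'' (B 3 4 (C ''jlkn'' (B 0 1 (C ''ffkq'' (B 7 8 (C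
    ''imgg'' (W ''kkkooooqqqqqstttt'')) (W ''lllnnnppqqqrssttt''))) (B 9 13 (B 5 6 (C ''gg'' (W
    ''jooooootttttttttt'')) (W ''illnnnqqqrttttttt'')) (W ''illrrrrrrrrrrtttt'')))) (B 0 1 (B 9 13 (C ''ffhh'' (W
    ''kkkmoppprsttttttt'')) (W ''llllqqqqqqqrrtttt'')) (W ''jlllttttttttttttt'')))) (W ''lllnpqqqqqqqqrttt''))) (W
    ''kkkooooottttttttt'')))) (B 7 7 (B 9 13 (C ''aa'' (W ''jlllttttttttttttt'')) (W ''llllqqqqqqqrrtttt'')) (W
    ''kkkkppptttttttttt'')))) (B 0 1 (B 8 14 (B 2 2 (C ''ffkn'' (B 3 4 (C ''ghjl'' (W ''lllmnnpqqqrrttttt'')) (W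
    ''llllmnqqqrrtttttt''))) (B 10 17 (C ''hf'' (B 2 4 (C ''gfkl'' (B 1 3 (B 4 6 (C ''hg'' (B 2 3 (C ''jm'' (B 3 4
    (C ''ff'' (W ''lllmnnpqqqrrttttt'')) (W ''llllqqqqqqqrrtttt''))) (W ''kkkmmoprstttttttt''))) (B 7 7 (C ''cc'' (W
    ''kkkmmmstttttttttt'')) (W ''kkmmmmpsstttttttt''))) (W ''jjoootttttttttttt''))) (B 6 6 (C ''jl'' (W
    ''kkkkmqqqqrrrttttt'')) (W ''kkkkmostttttttttt'')))) (W ''kmmmmrrrrssssssss''))) (W ''lllnpqqqqqqqqrttt'')) (W
    ''illmnqqqqrrtttttt''))) (W ''lllqqqqqqrrrrrrtt''))) (W ''lllqqqqqqrrrrrrtt'')) (W ''llrrrrrrrrrrrrrrr'')) (W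
    ''lllqqqqqqrrrrrrtt'')) (W ''lllqqqqqqrrrrrrtt'')) (W ''lllllqrrrrrtttttt''))) (W ''iilrrrrrrrrtttttt'')))"]) (simp_all add: large_15)

lemma large_17: "solved large_cfg [0, 0, 0, 0, 2, 3, 4, 9, 9, 11, 13, 17] [0, Suc 0, Suc 0, 4, 6, 6, 8, 11, 16, 17, 17, 17]"
  by (rule check_solved[where t = "B 4 4 (C ''jndageijkpik'' (B 3 3 (C ''fd'' (B 8 16 (C ''imgffejokq'' (B 1 1 (B 2 1 (C ''ghdbec'' (W
    ''llmnpqqqqqqqrrrtt'')) (B 6 8 (C ''dbec'' (W ''llmnpqqqqqqqrrrtt'')) (B 3 2 (C ''hkiojp'' (W
    ''knnnnopppppqqqqrt'')) (B 4 3 (C ''ff'' (W ''llnnnnppqqqqqrttt'')) (W ''llmnpqqqqqqqrrrtt''))))) (W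
    ''jpppppppptttttttt''))) (W ''lmnnpppqqqqqqqqqt''))) (B 9 15 (C ''ff'' (W ''lllnnnppqqqrssttt'')) (W
    ''lllqqqqqqrrrrrrtt'')))) (B 8 13 (C ''dage'' (B 3 3 (C ''fegfkojlijjmkp'' (B 4 6 (C ''jokq'' (B 1 1 (B 2 1 (C
    ''hkgh'' (W ''mmmmooooppqrrrsst'')) (B 4 5 (C ''dbjq'' (W ''llrrrrrrrrrrrrrrr'')) (W ''kmmmmrrrrssssssss''))) (W
    ''jpppppppptttttttt''))) (W ''mmmmmmrrrrsssssst''))) (B 7 11 (B 9 17 (C ''fegf'' (B 9 16 (B 9 15 (C ''kn'' (B 1
    1 (B 4 6 (C ''ijjl'' (B 5 6 (C ''caghee'' (W ''kmmmmoooprssttttt'')) (W ''lllmnnpqqqrrttttt''))) (B 3 4 (C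
    ''ca'' (B 6 8 (C ''kp'' (W ''mmmmmmrrrrsssssst'')) (W ''kmmmmoooprssttttt''))) (W ''llllmnqqqrrtttttt''))) (W
    ''jpppppppptttttttt''))) (W ''lllqqqqqqrrrrrrtt'')) (W ''lllqqqqqqrrrrrrtt''))) (W ''llrrrrrrrrrrrrrrr'')) (W
    ''lllpppppppptttttt'')))) (B 3 4 (C ''gekn'' (B 3 2 (C ''gfjnko'' (B 4 6 (C ''jokp'' (B 2 1 (C ''feinjp'' (B 5 6
    (C ''ghee'' (W ''mmmmmoopqqqrrrstt'')) (W ''mnnnnnqqqqqqqqrrt''))) (B 8 15 (C ''fe'' (B 9 16 (C ''ghee'' (W
    ''kmmmmoooprssttttt'')) (W ''kmmnnpqqqqqrrrrrt''))) (W ''lmmmpppqqqqqqqqtt'')))) (W ''mmmmmmqrrsstttttt''))) (B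
    9 15 (C ''fegf'' (B 1 1 (B 4 6 (B 2 1 (C ''dcff'' (W ''lllmnnpqqqrrttttt'')) (B 3 3 (C ''kpgghjjn'' (B 4 5 (C
    ''ff'' (W ''llnnnnppqqqqqrttt'')) (W ''mmmmmoopqqqrrrstt''))) (W ''kllnnpppqqqqqsttt''))) (B 3 3 (B 10 15 (C
    ''gh'' (W ''mmmmmmqrssttttttt'')) (W ''mmmmmmqrrsstttttt'')) (W ''lllmnnpqqqrrttttt''))) (W
    ''jpppppppptttttttt''))) (W ''llmnpqqqqqqqrrrtt'')))) (W ''llllqqqqqqqrrtttt'')))"]) simp_all

lemma large_18: "solved large_cfg [0, 0, 0, 0, Suc 0, 2, 3, 9, 9, 9, 10, 17] [0, 3, 3, 4, 6, 6, 11, 11, 16, 17, 17, 17]"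
  by (rule check_solved[where t = "C ''gd'' (B 6 11 (B 2 2 (C ''fckkjjkl'' (B 6 10 (C ''eb'' (B 6 9 (C ''jkkm'' H) (W ''oooooooootttttttt''))) (W
    ''oooooooootttttttt''))) (B 4 6 (C ''kk'' (B 8 16 (B 6 10 (C ''fc'' (B 6 9 (C ''jjkl'' (B 9 17 (B 4 4 (C
    ''jkgekmijjlkn'' (B 2 3 (C ''ikjmko'' (B 3 3 (C ''fdgf'' (B 8 15 (C ''fe'' (B 9 15 (C ''ingh'' (W
    ''kknnnoooqqqqqsttt'')) (W ''kknnnqqqqqqrrrrtt''))) (W ''klnnoqqqqqqqqqqtt''))) (B 9 15 (C ''fe'' (B 8 13 (C
    ''ff'' (W ''lllnnnppqqqrssttt'')) (W ''kllnnpppqqqqqsttt''))) (W ''lllqqqqqqrrrrrrtt'')))) (B 7 10 (B 6 8 (C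
    ''jn'' (B 9 15 (C ''feilgf'' (W ''kkknnoqqqqqqrrttt'')) (W ''lllqqqqqqrrrrrrtt''))) (W ''kkkooooottttttttt''))
    (W ''kkkpppppppssttttt'')))) (B 8 15 (B 7 11 (B 8 12 (C ''ge'' (B 2 3 (C ''kmjkkn'' (B 3 4 (C ''fegf'' (B 4 5 (C
    ''jn'' (B 7 10 (C ''ghdc'' (W ''kklmnoooprstttttt'')) (W ''kkmmoppppprrttttt''))) (W ''kkmmmoppprrsttttt''))) (B
    9 12 (W ''kklloppppsttttttt'') (W ''kklloppppsttttttt'')))) (B 10 13 (W ''kkkmoppprsttttttt'') (W
    ''kkkmoppprsttttttt'')))) (B 9 16 (B 9 15 (C ''ge'' (B 2 3 (B 3 4 (C ''gf'' (B 4 5 (C ''jm'' (B 7 10 (C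
    ''fekoggkp'' (B 1 1 (B 3 3 (C ''inff'' (W ''llnnnnppqqqqqrttt'')) (B 8 13 (C ''ff'' (W ''lllmnnpqqqrrttttt''))
    (W ''kllnnpppqqqqqsttt''))) (W ''jooooootttttttttt''))) (W ''kkmmoppppprrttttt''))) (W ''kkmmmoppprrsttttt'')))
    (W ''kklloppppsttttttt'')) (W ''kkkmoppprsttttttt''))) (W ''llmnpqqqqqqqrrrtt'')) (W ''llmnpqqqqqqqrrrtt''))) (W
    ''kkmoppppppptttttt'')) (W ''llmnpqqqqqqqrrrtt''))) (W ''llrrrrrrrrrrrrrrr''))) (W ''oooooooootttttttt''))) (W
    ''oooooooootttttttt'')) (W ''knppqqqqqqqqqqqqt''))) (W ''kkmmmmpsstttttttt''))) (W ''oooooooootttttttt''))"]) (simp_all add: large_17)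

lemma large_19: "solved large_cfg [0, 0, 0, 0, 2, 7, 7, 7, 7, 8, 10, 17] [0, 2, 2, 5, 7, 7, 8, 11, 11, 17, 17, 17]"
  by (rule check_solved[where t = "B 3 3 (C ''jikkjjihklkm'' (B 4 5 (C ''cadbkojk'' (B 9 17 (C ''hiecijjljm'' (B 4 4 (C ''hkcb'' (W
    ''kknnnnnpqqqrrsttt'')) (W ''kmmmnnnqqqrrrsstt''))) (W ''llrrrrrrrrrrrrrrr''))) (B 2 1 (C ''kojkhhiijljmkp'' (B
    4 6 (C ''dbjq'' (W ''llrrrrrrrrrrrrrrr'')) (W ''mmmmmmrrrrsssssst''))) (B 4 7 (B 10 17 (B 9 16 (C ''dbijhh'' (B
    9 15 (C ''jkhi'' (B 2 2 (C ''gh'' (W ''kmmmmoooprssttttt'')) (W ''kkmmmoppprrsttttt''))) (W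
    ''kmmmnnnqqqrrrsstt''))) (W ''kmmmmnoqrrrrrrrtt'')) (W ''kmmmmrrrrssssssss'')) (W ''kmmmmmmrrsssstttt''))))) (B
    7 11 (B 9 17 (B 9 12 (C ''edih'' (B 2 2 (C ''eejikk'' (B 3 5 (C ''hh'' (B 8 11 (C ''knef'' (B 10 16 (C ''hjdd''
    (W ''llllmnnqqqttttttt'')) (W ''lllmmmqssssssssst''))) (W ''lllmmnnpqqqtttttt''))) (B 8 9 (C ''jk'' (W
    ''lllllqrrrrrtttttt'')) (W ''lllllnnqqtttttttt'')))) (B 4 6 (C ''ii'' (B 3 5 (C ''knij'' (B 7 10 (C ''dd'' (B 4
    5 (C ''hi'' (W ''kklloppppsttttttt'')) (W ''llllmnnqqqttttttt''))) (W ''kkmmooopppssstttt''))) (W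
    ''lllllnnqqtttttttt''))) (W ''kkmmmmpsstttttttt'')))) (B 3 5 (B 4 5 (C ''ih'' (B 9 16 (C ''cakmii'' (B 9 15 (C
    ''hh'' (B 10 17 (C ''cbedij'' (W ''lllmnnpqqqrrttttt'')) (W ''lllnnnnrrrrrsssst''))) (W ''lllqqqqqqrrrrrrtt'')))
    (W ''lllnnnnrrrrrsssst''))) (B 7 10 (B 9 16 (B 8 11 (B 8 10 (C ''km'' (B 10 17 (C ''ih'' (B 10 16 (C ''ca'' (B 4
    7 (B 9 15 (C ''cb'' (B 4 6 (C ''hi'' (W ''kkmmmoppprrsttttt'')) (W ''kkmmmmpsstttttttt''))) (W
    ''kmmmmnoqrrrrrrrtt'')) (W ''kmmmmmmrrsssstttt''))) (W ''lllnnnnrrrrrsssst''))) (W ''lllnnnnrrrrrsssst''))) (W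
    ''lllmnnpqqqrrttttt'')) (W ''lllmnnpqqqrrttttt'')) (W ''lllnnnnrrrrrsssst'')) (W ''lllmnnpqqqrrttttt''))) (W
    ''lllllqrrrrrtttttt''))) (W ''llrrrrrrrrrrrrrrr'')) (W ''lllpppppppptttttt''))"]) simp_all

text \<open>Seventeen to nineteen periods, at most five of them up to 12.\<close>

lemma large_20: "solved large_cfg [0, 0, 0, 0, 0, 0, 0, Suc 0, 2, 3, 4, 17] [2, 5, 5, 5, 12, 13, 14, 15, 16, 17, 18, 19]"
  by (rule check_solved[where t = "B 5 7 (C ''jd'' (B 11 19 (C ''hbickegaidjekf'' (B 7 9 (C ''fagb'' (B 2 5 (B 3 3 H (B 11 18 (C ''kg'' H) (W
    ''lllttttttttttttttt''))) (W ''kkkkktttttttttttt''))) (B 11 18 (B 7 12 (B 0 1 (B 3 5 (C ''gbeagc'' (B 2 4 (C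
    ''fbkj'' H) (W ''kkkkppptttttttttt''))) (W ''lllllpppptttttttt'')) (W ''jpppppppptttttttt'')) (W
    ''ppppppppppppttttt'')) (W ''pppppppptttttttttt'')))) (B 5 3 (B 7 8 (B 7 4 (B 0 1 (C ''jk'' (B 3 2 (C ''ii'' (B
    8 13 (C ''cajnjo'' (W ''rrrrrrrrrrrrrrrtttt'')) (W ''qqqqqqqqqqqqqtttttt''))) (W ''llrrrrrrrrrtttttttt''))) (W
    ''jtttttttttttttttttt'')) (W ''ppppttttttttttttttt'')) (W ''pppppppptttttttttt'')) (W
    ''oootttttttttttttttt'')))) (B 11 18 (B 6 11 (B 2 3 (B 6 9 (B 0 1 (C ''kheajhki'' (B 5 8 (C ''kj'' (B 7 15 (B 8
    12 (C ''eb'' H) (B 3 5 (B 3 4 (B 4 7 (B 4 6 (B 7 14 (B 7 13 (B 8 16 (C ''eb'' (B 8 15 (B 7 12 (C ''km'' (B 3 2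
    (C ''eckohhjmjn'' (B 4 5 (C ''dakqhijo'' (B 8 13 (C ''caed'' (W ''kmmmnnnqqqrrrsstt'')) (W
    ''mmnnnnnpqqqqqrrtt''))) (W ''mmmmmoopqqqrrrstt''))) (B 9 17 (B 9 16 (B 2 2 (C ''ec'' (B 9 15 (C ''hh'' (B 8 14
    (C ''kn'' (B 3 3 (C ''cahjedkpjm'' (W ''kmmmnnnqqqrrrsstt'')) (W ''lllnnnppqqqrssttt''))) (W
    ''llnnnnppqqqqqrttt''))) (W ''llmnpqqqqqqqrrrtt''))) (B 9 15 (B 4 4 (C ''hh'' (B 3 3 (B 9 14 (C ''hkec'' (W
    ''kkmoppppppptttttt'')) (W ''kknnnnnpqqqrrsttt'')) (W ''kllnnnnpqqqqttttt''))) (B 3 3 (B 7 11 (B 7 10 (C ''hh''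
    (B 9 14 (C ''kqee'' (W ''kmmmmrrrrssssssss'')) (W ''kknnnnnpqqqrrsttt''))) (W ''kkmmoppppprrttttt'')) (W
    ''kkmmoppppprrttttt'')) (W ''lllmnnpqqqrrttttt''))) (W ''kknnnqqqqqqrrrrtt''))) (W ''llnqqqqqqqqqrrrrt'')) (W
    ''llrrrrrrrrrrrrrrr'')))) (W ''ppppppppppppttttt'')) (W ''nnnnnnnqqqqqqqqtt''))) (W ''mnnnnnqqqqqqqqrrt'')) (W
    ''ppppppppppppttttt'')) (W ''ppppppppppppttttt'')) (W ''mmmmmmqrssttttttt'')) (W ''mmmmmmqrssttttttt'')) (W
    ''lllmnnpqqqrrttttt'')) (W ''lllmnnpqqqrrttttt''))) (W ''ppppppppppppttttt''))) (W ''nnnnnnnnttttttttt''))) (W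
    ''jooooootttttttttt'')) (W ''oooooooootttttttt'')) (W ''kkknnnntttttttttt'')) (W ''oooooooootttttttt'')) (W
    ''ooooootttttttttttt''))"]) (simp_all add: large_14 large_16 large_18 large_19)

text \<open>Exactly fifteen periods, at least six of them up to 12, so that \<open>large_13\<close>
  does not apply.\<close>

lemma large_21: "solved large_cfg [0, 0, 0, 6, 6, 6, 6, 6, 6, 7, 8, 15] [3, 8, 8, 8, 12, 13, 14, 15, 15, 15, 15, 15]"
  by (rule check_solved[where t = "C ''igjhhgihki'' (B 5 10 (B 2 8 (B 0 3 (B 2 7 (C ''ji'' (B 9 15 (B 7 14 (B 7 13 (C ''ca'' (B 7 12 (C ''gghhkj''
    (B 2 4 (C ''hifgghjjkk'' (B 0 2 (C ''egfhijjkkl'' (B 2 3 (C ''ehgiikhj'' (B 3 8 (C ''aakm'' (W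
    ''illlllmmpqqsttt'')) (W ''llllllllppttttt''))) (B 7 11 (B 4 9 (C ''jmdg'' (W ''lllllllrrrrrrtt'')) (W
    ''kkkmmmmmmrttttt'')) (W ''kkkllmmoppptttt'')))) (B 9 11 (C ''dh'' (W ''jjlllllltttttt'')) (W
    ''iillllrrrrrtttt'')))) (B 4 9 (B 4 8 (C ''iijjkk'' (B 0 2 (C ''ijjkkl'' (B 6 9 (C ''egcejm'' (B 0 1 (C ''in''
    (W ''kkkkklnqqqrrrrt'')) (W ''illlllrrrrrrrtt''))) (B 2 6 (C ''fg'' (B 6 11 (C ''jlkm'' (B 3 7 (C ''ikhj'' (B 2
    5 (C ''inaa'' (W ''illlllrrrrrrrtt'')) (W ''kkkkklooppstttt''))) (B 0 1 (C ''ce'' (W ''kkkkkmmoptttttt'')) (W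
    ''jlllllltttttttt'')))) (W ''kkkkmmnooootttt''))) (W ''kkkkkkooprstttt'')))) (B 9 11 (C ''cfgi'' (W
    ''kkkkkkooprstttt'')) (W ''iillllrrrrrtttt'')))) (B 7 9 (B 2 5 (C ''abjl'' (W ''jjmmmmmmrrssttt'')) (W
    ''kkkkkmmmstttttt'')) (W ''kkkkmmmmptttttt''))) (W ''kkkkmmmmptttttt'')))) (W ''llllllppppppttt''))) (W
    ''lllllpppppppptt'')) (W ''lllllpppppppptt'')) (W ''llllllrrrrrrrrr''))) (W ''kkkkkkktttttttt'')) (W
    ''jjjlllttttttttt'')) (W ''kkkkkkkktttttt'')) (B 8 11 (B 2 4 (B 0 3 (C ''ca'' (B 3 8 (C ''cb'' (B 4 10 (C ''aa''
    (B 9 13 (C ''dg'' (W ''jlllllltttttttt'')) (W ''illllnnnnrrrrtt''))) (W ''kkmmmmmmmmttttt''))) (W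
    ''llllllllppttttt''))) (W ''jjjlllttttttttt'')) (W ''kkkknnnnnnttttt'')) (W ''llllllnnnnqtttt'')))"]) simp_all

text \<open>The root box has only the pigeonhole bounds \<open>c - 1\<close>. Its initial chain
  shows that fewer than eleven periods are light.\<close>

lemma large_top: "solved large_cfg [0, 0, 0, 0, 0, 0, 0, 0, 0, 0, 0, 0] [8, 9, 10, 11, 12, 13, 14, 15, 16, 17, 18, 19]"
  by (rule check_solved[where t = "C ''ljlk'' (B 11 15 (C ''hgga'' (B 2 5 (C ''lmghfafbeafcebfd'' H) (B 11 13 (C ''fief'' (B 0 8 (C ''llfjei'' (B 0
    7 (B 0 6 (C ''dhgk'' (B 0 5 (B 2 10 (C ''abgl'' (B 3 10 (C ''cg'' (B 0 4 (C ''ci'' (W ''kkkkkkkkkppp'')) (W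
    ''iiiillllrrrr''))) (W ''iillllllllrr''))) (W ''kkkkkkkkkktt'')) (W ''iiiiilllrrtt''))) (W ''iiiiiimmmttt'')) (W
    ''iiiiiimmmttt''))) (W ''iiiiiiiittt''))) (C ''gfkhjh'' H)))) (C ''kajakb'' (B 3 6 (C ''iajbkcibhajckd'' (B 11
    17 (C ''hbicgajdkehcidgbjefakfhdgcie'' H) (B 0 3 H (W ''jjjtttttttttttttt'')))) (B 11 16 (B 0 4 (B 3 9 (C
    ''kgjgkh'' H) (W ''lllllllllttttt'')) (W ''jjjlllttttttttt'')) (W ''lllllltttttttttt'')))))"]) (simp_all add: large_1 large_2 large_13 large_20 large_21)

section \<open>The density threshold\<close>

text \<open>\<open>sched_of_many\<close> read backwards; it yields the upper corners of both root
  boxes.\<close>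

lemma cnt_less: "\<not> sched V \<Longrightarrow> 0 < c \<Longrightarrow> cnt V c < c"
  using sched_of_many[of c V] by (simp add: cnt_def not_less[symmetric]) blast

lemma sched_large:
  assumes "\<forall>a\<in>#A. 9 \<le> a" "1.264 \<le> ndens A"
  shows "sched A"
proof (rule sched_of_solved[OF large_cfg_def _ large_top, where \<theta> = 20 and A = A])
  show "list_all (\<lambda>v. 1000000 \<le> [111112, 100000, 100000, 90910, 83334, 76924, 71429, 66667, 62500, 58824, 55556, 52632] !
    (v - 9) * (if 2 * v \<le> 20 then v else v - 1)) [9..<20 + 1]"
    by simp
  \<comment> \<open>The lower corner is 0, so the pigeonhole bounds for 9 to 20 are all there is to
    check.\<close>
  show "in_box 9 [0, 0, 0, 0, 0, 0, 0, 0, 0, 0, 0, 0] [8, 9, 10, 11, 12, 13, 14, 15, 16, 17, 18, 19] V"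
    if "\<not> sched V" for V
    using cnt_less[OF that, of 9] cnt_less[OF that, of 10] cnt_less[OF that, of 11] cnt_less[OF that, of 12]
      cnt_less[OF that, of 13] cnt_less[OF that, of 14] cnt_less[OF that, of 15] cnt_less[OF that, of 16]
      cnt_less[OF that, of 17] cnt_less[OF that, of 18] cnt_less[OF that, of 19] cnt_less[OF that, of 20]
    by (simp add: in_box_Cons in_box_Nil)
qed (use assms in auto)

text \<open>Since 8 is half of the bound 16, merging and rounding preserve all counts up to 8. So
  \<open>V\<close> inherits from \<open>A\<close> both the single 3 at most and the presence of a
  period up to 8.\<close>

lemma sched_small:
  assumes "\<forall>a\<in>#A. 3 \<le> a" "1.264 \<le> ndens A" "\<exists>a\<in>#A. a \<le> 8" "count A 3 \<le> 1"
  shows "sched A"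
proof (rule sched_of_solved[OF small_cfg_def _ small_top, where \<theta> = 16 and A = A])
  show "list_all (\<lambda>v. 1000000 \<le> [333334, 250000, 200000, 166667, 142858, 125000, 125000, 111112, 100000, 90910, 83334,
    76924, 71429, 66667] ! (v - 3) * (if 2 * v \<le> 16 then v else v - 1)) [3..<16 + 1]"
    by simp
  show "in_box 3 [0, 0, 0, 0, 0, Suc 0, Suc 0, Suc 0, Suc 0, Suc 0, Suc 0, Suc 0, Suc 0, Suc 0]
    [Suc 0, 3, 4, 5, 6, 7, 8, 9, 10, 11, 12, 13, 14, 15] V"
    if V: "\<And>c. 2 * c \<le> 16 \<Longrightarrow> cnt V c = cnt A c" "\<not> sched V" for V
  proof -
    have "filter_mset (\<lambda>v. v \<le> 3) A = filter_mset (\<lambda>v. v = 3) A"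
      using assms(1) by (intro filter_mset_cong) auto
    then have "cnt V 3 \<le> 1"
      using V(1)[of 3] assms(4) by (simp add: cnt_def filter_eq_replicate_mset)
    moreover obtain a where "a \<in># filter_mset (\<lambda>v. v \<le> 8) A"
      using assms(3) by auto
    then have ne: "filter_mset (\<lambda>v. v \<le> 8) A \<noteq> {#}"
      by force
    have "0 < cnt A 8"
      unfolding cnt_def using ne by (rule nonempty_has_size[THEN iffD1])
    then have "0 < cnt V 8"
      using V(1)[of 8] by simp
    then have "0 < cnt V c" if "8 \<le> c" for c
      using cnt_mono[OF that, of V] by linarith
    ultimately show ?thesis
      using cnt_less[OF V(2), of 4] cnt_less[OF V(2), of 5] cnt_less[OF V(2), of 6] cnt_less[OF V(2), of 7]
        cnt_less[OF V(2), of 8] cnt_less[OF V(2), of 9] cnt_less[OF V(2), of 10] cnt_less[OF V(2), of 11]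
        cnt_less[OF V(2), of 12] cnt_less[OF V(2), of 13] cnt_less[OF V(2), of 14] cnt_less[OF V(2), of 15]
        cnt_less[OF V(2), of 16]
      by (simp add: in_box_Cons in_box_Nil Suc_le_eq)
  qed
qed (use assms in auto)

text \<open>Two periods 3 use up density 2/3. The chain from modulus 3 costs at most 1/4 + 1/7 +
  1/13 + 2/24, about 0.553, less than the remaining 0.597.\<close>

lemma chain_sum_3: "chain_sum 3 \<le> 1.264 - 2 / 3"
  using chain_sum_step[of 3] chain_sum_step[of 6] chain_sum_step[of 12] chain_sum_bounds(2)[of 24] by simp

lemma sched_ge_3:
  assumes "\<forall>a\<in>#A. 3 \<le> a" "1.264 \<le> ndens A"
  shows "sched A"
  using assms
proof (induction "size A" arbitrary: A rule: less_induct)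
  case less
  show ?case
  proof (cases "2 \<le> count A 3")
    case True
    then have "replicate_mset 2 3 \<subseteq># A"
      by (simp add: count_le_replicate_mset_subset_eq)
    then obtain R where R: "A = {#3, 3#} + R"
      by (metis mset_subset_eq_exists_conv numeral_2_eq_2 replicate_mset_0 replicate_mset_Suc)
    have "sched ({#3, 3#} + R)"
    \<comment> \<open>Three tasks of period 3 run in rotation; two of them are present, and the
      place of the third is the free class modulo 3.\<close>
    proof (rule sched_chain[where n = 3])
      show "sched (add_mset 3 {#3, 3#})"
        using sched_replicate[of 3] by (simp add: numeral_3_eq_3)
      show "\<forall>r\<in>#R. 0 < r"
        using less.prems(1) R by auto
      show "chain_sum 3 \<le> ndens R"
        using less.prems(2) chain_sum_3 by (simp add: R)
      \<comment> \<open>A rescaled multiset has at most as many members as \<open>R\<close>, two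
        fewer than \<open>A\<close>, which is why the induction is on the size.\<close>
      show "sched T" if "size T \<le> size R" "\<forall>r\<in>#T. 3 \<le> r" "1.264 \<le> ndens T" for T
        using less.hyps[of T] that by (simp add: R)
    qed simp
    then show ?thesis
      by (simp add: R)
  next
    case False
    show ?thesis
    proof (cases "\<exists>a\<in>#A. a \<le> 8")
      case True
      then show ?thesis
        using sched_small less.prems False by simp
    next
      case no_small: False
      then have "\<forall>a\<in>#A. 9 \<le> a"
        by (auto simp: not_le)
      then show ?thesis
        using sched_large less.prems(2) by blast
    qed
  qed
qed

theorem theorem1:
  fixes k :: nat and a :: "nat \<Rightarrow> nat"
  assumes "is_instance k a"
    and "density k a \<ge> alpha_star"
  shows "covering_schedulable k a"
proof (rule covering_schedulableI)
  let ?A = "image_mset a (mset_set {1..k})"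
  have "sched ({#} + ?A)"
  \<comment> \<open>Initially no task is placed and all days form the free class modulo 1, so the
    whole budget \<open>chain_sum 1\<close> is \<open>alpha_star\<close>.\<close>
  proof (rule sched_chain[where n = 1])
    show "sched (add_mset 1 {#})"
      using sched_single by simp
    show "\<forall>r\<in>#?A. 0 < r"
      using assms(1) by (auto simp: is_instance_def)
    have "ndens ?A = density k a"
      by (simp add: ndens_def density_def sum_unfold_sum_mset image_mset.compositionality comp_def)
    then show "chain_sum 1 \<le> ndens ?A"
      using assms(2) by (simp add: chain_sum_def alpha_star_def)
  qed (use sched_ge_3 in auto)
  then show "sched ?A"
    by simp
qed

end
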